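(* Let $M$, $M_+$, $M_-$ be the isoparametric hypersurface and the two focal submanifolds of an isoparametric family of OT-FKM type, and let $\xi$ be the vector bundle of rank $l$ over $S^m$ whose unit sphere bundle is $M_-$. Then: (i) $M_-$ is parallelizable if and only if $M_-$ is s-parallelizable, if and only if $\xi$ is trivial; (ii) $M_+$ is parallelizable; (iii) $M$ is parallelizable.
   Context: A smooth manifold $X$ is parallelizable if $TX$ is trivial, and s-parallelizable if the Whitney sum of $TX$ with a trivial line bundle is trivial. A symmetric Clifford system on $\mathbb{R}^{2l}$ is a tuple $\{P_0,\dots,P_m\}$ of real symmetric $2l\times 2l$ matrices with $P_\alpha P_\beta+P_\beta P_\alpha=2\delta_{\alpha\beta}I_{2l}$. Throughout $m>0$ and $l-m-1>0$; one has $l=k\delta(m)$ with $k$ a positive integer, where $\delta(m)=1,2,4,4,8,8,8,8$ for $m=1,\dots,8$ and $\delta(m+8)=16\delta(m)$. The function $f=F|_{S^{2l-1}(1)}$, with $F(x)=|x|^4-2\sum_{\alpha=0}^m\langle P_\alpha x,x\rangle^2$, is an isoparametric function with image $[-1,1]$; its level sets form an isoparametric family of OT-FKM type with $g=4$ and multiplicities $(m_1,m_2)=(m,l-m-1)$. Here $M=f^{-1}(t)$ with $-1<t<1$ is an isoparametric hypersurface, and $M_+=f^{-1}(1)$, $M_-=f^{-1}(-1)$ are the focal submanifolds, of codimension $m_1+1$ and $m_2+1$ in $S^{2l-1}(1)$ respectively. Definition of $\xi$: let $\Sigma=\Sigma(P_0,\dots,P_m)\cong S^m$ be the unit sphere in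 the span of $P_0,\dots,P_m$ (with $P_0,\dots,P_m$ orthonormal). For each $x\in M_-$ there is a unique $P\in\Sigma$ with $Px=x$, and $x\mapsto P$ makes $M_-$ an $S^{l-1}$-bundle over $S^m$. The associated vector bundle $\xi$ of rank $l$ over $S^m\cong\Sigma$ has as fiber over $P$ the $+1$-eigenspace of $P$ in $\mathbb{R}^{2l}$; $M_-$ is diffeomorphic to the unit sphere bundle $S(\xi)$. *)

theory Defs
  imports "HOL-Analysis.Analysis"
begin

text \<open>
  All vector bundles below are given as families of linear subspaces \<open>E x\<close> of one Euclidean space,
  indexed by the points \<open>x\<close> of a base \<open>X\<close>; the total space is \<open>Sigma X E\<close> with the subspace topology
  of the product.
\<close>

text \<open>
  Isomorphism over the identity of \<open>X\<close>. The map on each fibre is the restriction of a linear map of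
  the ambient spaces; every linear map between subspaces is of this form.
\<close>
definition bundle_isomorphic ::
  "'b::euclidean_space set \<Rightarrow> ('b \<Rightarrow> 'v::euclidean_space set) \<Rightarrow> ('b \<Rightarrow> 'w::euclidean_space set) \<Rightarrow> bool"
  where "bundle_isomorphic X E E' \<longleftrightarrow>
    (\<exists>f g. homeomorphism (Sigma X E) (Sigma X E') f g \<and>
      (\<forall>x\<in>X. \<exists>A. linear A \<and> (\<forall>v\<in>E x. f (x, v) = (x, A v))))"

text \<open>
  Triviality: isomorphic to a product bundle \<open>X \<times> W\<close>. Since the fibres lie in the ambient space \<open>'v\<close>,
  a model fibre \<open>W\<close> of the right dimension can be found among the subspaces of \<open>'v\<close>.
\<close>
definition trivial_bundle ::
  "'b::euclidean_space set \<Rightarrow> ('b \<Rightarrow> 'v::euclidean_space set) \<Rightarrow> bool"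
  where "trivial_bundle X E \<longleftrightarrow>
    (\<forall>x\<in>X. subspace (E x)) \<and> (\<exists>W :: 'v set. subspace W \<and> bundle_isomorphic X E (\<lambda>_. W))"

definition whitney_sum :: "('b \<Rightarrow> 'v set) \<Rightarrow> ('b \<Rightarrow> 'w set) \<Rightarrow> 'b \<Rightarrow> ('v \<times> 'w) set"
  where "whitney_sum E E' = (\<lambda>x. E x \<times> E' x)"

text \<open>
  The tangent space of an embedded submanifold \<open>X\<close> of Euclidean space at \<open>x\<close>, as the set of velocities
  of curves in \<open>X\<close> through \<open>x\<close>. On a smooth embedded submanifold, \<open>C\<^sup>1\<close> and smooth curves have the
  same velocities.
\<close>
definition tangent_space :: "'a::euclidean_space set \<Rightarrow> 'a \<Rightarrow> 'a set"
  where "tangent_space X x =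
    {v. \<exists>\<gamma> e. e > 0 \<and> \<gamma> C1_differentiable_on {-e<..<e} \<and> \<gamma> ` {-e<..<e} \<subseteq> X \<and>
          \<gamma> 0 = x \<and> (\<gamma> has_vector_derivative v) (at (0::real))}"

text \<open>The next two notions are meant for smooth embedded submanifolds \<open>X\<close> only.\<close>

definition parallelizable :: "'a::euclidean_space set \<Rightarrow> bool"
  where "parallelizable X \<longleftrightarrow> trivial_bundle X (tangent_space X)"

definition s_parallelizable :: "'a::euclidean_space set \<Rightarrow> bool"
  where "s_parallelizable X \<longleftrightarrow>
    trivial_bundle X (whitney_sum (tangent_space X) (\<lambda>_. UNIV :: real set))"

text \<open>A system \<open>P\<^sub>0, \<dots>, P\<^sub>m\<close> is a function on \<open>nat\<close>, of which only the values at \<open>\<alpha> \<le> m\<close> matter.\<close>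

definition symmetric_Clifford_system :: "nat \<Rightarrow> (nat \<Rightarrow> real^'n^'n) \<Rightarrow> bool"
  where "symmetric_Clifford_system m P \<longleftrightarrow>
    (\<forall>\<alpha>\<le>m. transpose (P \<alpha>) = P \<alpha>) \<and>
    (\<forall>\<alpha>\<le>m. \<forall>\<beta>\<le>m. P \<alpha> ** P \<beta> + P \<beta> ** P \<alpha> = (if \<alpha> = \<beta> then 2 else 0) *\<^sub>R mat 1)"

definition OT_FKM_poly :: "nat \<Rightarrow> (nat \<Rightarrow> real^'n^'n) \<Rightarrow> real^'n \<Rightarrow> real"
  where "OT_FKM_poly m P x = norm x ^ 4 - 2 * (\<Sum>\<alpha>\<le>m. ((P \<alpha> *v x) \<bullet> x)\<^sup>2)"

definition OT_FKM_level :: "nat \<Rightarrow> (nat \<Rightarrow> real^'n^'n) \<Rightarrow> real \<Rightarrow> (real^'n) set"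
  where "OT_FKM_level m P t = {x \<in> sphere 0 1. OT_FKM_poly m P x = t}"

abbreviation focal_plus :: "nat \<Rightarrow> (nat \<Rightarrow> real^'n^'n) \<Rightarrow> (real^'n) set"
  where "focal_plus m P \<equiv> OT_FKM_level m P 1"

abbreviation focal_minus :: "nat \<Rightarrow> (nat \<Rightarrow> real^'n^'n) \<Rightarrow> (real^'n) set"
  where "focal_minus m P \<equiv> OT_FKM_level m P (-1)"

text \<open>
  The unit sphere of the span of \<open>P\<^sub>0, \<dots>, P\<^sub>m\<close> for the inner product making the \<open>P\<^sub>\<alpha>\<close> orthonormal. This
  is not the standard inner product of \<open>real^'n^'n\<close>, for which \<open>P\<^sub>\<alpha>\<close> has squared norm \<open>CARD('n)\<close>.
\<close>
definition Clifford_sphere :: "nat \<Rightarrow> (nat \<Rightarrow> real^'n^'n) \<Rightarrow> (real^'n^'n) set"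
  where "Clifford_sphere m P = {\<Sum>\<alpha>\<le>m. a \<alpha> *\<^sub>R P \<alpha> | a. (\<Sum>\<alpha>\<le>m. (a \<alpha>)\<^sup>2) = 1}"

text \<open>The fibre over \<open>Q\<close> of the bundle \<open>\<xi>\<close> on the Clifford sphere: the eigenspace of \<open>Q\<close> for \<open>+1\<close>.\<close>
definition xi_fibre :: "real^'n^'n \<Rightarrow> (real^'n) set"
  where "xi_fibre Q = {x. Q *v x = x}"

end

theory Submission
  imports Defs
begin

text \<open>
  A family of subspaces does not change along a homotopy, up to a continuous family of linear
  automorphisms of the ambient space. Hence, to trivialize a tangent bundle, it suffices to deform a
  normal frame to a constant one.

  For \<open>M\<close>, the normal frame \<open>(x, Qx)\<close> deforms to \<open>(x, P\<^sub>0 P\<^sub>1 x)\<close>, which spans a complex line. Since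
  \<open>M\<close> is not the whole sphere, this line deforms to a constant one.

  For \<open>M\<^sub>+\<close>, decompose \<open>x\<close> into multiples of unit vectors \<open>u\<close>, \<open>w\<close> in the eigenspaces of \<open>P\<^sub>0\<close>. The normal
  space deforms to the span of \<open>u, w, P\<^sub>1 u, \<dots>, P\<^sub>m u\<close>. If the eigenspace \<open>E\<^sub>+\<close> has a complex structure
  \<open>J\<close>, then \<open>w\<close> can be moved to \<open>J u\<close>, and the frame comes from the sphere of \<open>E\<^sub>+\<close>, where the rank of its
  complement is in the stable range. This covers \<open>m \<ge> 2\<close>, with \<open>J = P\<^sub>1 P\<^sub>2\<close>, and even \<open>l\<close>. In the remaining
  case \<open>m = 1\<close>, \<open>l\<close> odd, \<open>M\<^sub>+\<close> is a Stiefel manifold of \<open>2\<close>-frames, and an obstruction of degree \<open>2\<close> is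
  removed by a reflection depending on the point.

  For \<open>M\<^sub>-\<close>, the sum of the tangent bundle and a trivial line bundle is the pullback of \<open>TS\<^sup>m \<oplus> \<xi>\<close>.
  Restricting it to a section of the sphere bundle of \<open>\<xi>\<close> shows that \<open>\<xi>\<close> is stably trivial if \<open>M\<^sub>-\<close> is
  s-parallelizable, and then \<open>\<xi>\<close> is trivial because its rank \<open>l\<close> exceeds \<open>m\<close>. Conversely, if \<open>\<xi>\<close> is
  trivial, then \<open>M\<^sub>-\<close> is a product of spheres, one of which has a unit tangent field: \<open>S\<^sup>1\<close> if \<open>m = 1\<close>,
  and \<open>S\<^sup>l\<^sup>-\<^sup>1\<close>, by means of \<open>P\<^sub>1 P\<^sub>2\<close>, if \<open>m \<ge> 2\<close>.
\<close>

section \<open>Families of linear maps and trivial bundles\<close>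

text \<open>The tangent spaces of \<open>M\<close> and \<open>M\<^sub>+\<close> are orthogonal
  complements in one fixed space, so a deformation of normal frames only has to stay linearly
  independent, and most deformations are straight lines.

  The hard case is \<open>m = 1\<close> with \<open>l\<close> odd, where \<open>Eplus\<close> has
  odd dimension and no complex structure. Once the complex line of \<open>u\<close> has become that
  of \<open>e\<close>, the third vector is \<open>u\<close> at the pole \<open>v = e\<close> and
  \<open>- u\<close> at \<open>v = - e\<close>. Both are maps of degree 1 of the unit sphere of the
  complement of \<open>e\<close>, whose dimension \<open>l - 1\<close> is even; the sum of the
  degrees is the obstruction 2. Reflecting in \<open>u\<close> at one pole and in \<open>e0\<close>
  at the other yields \<open>- u\<close> and minus the reflection of \<open>u\<close> in
  \<open>e0\<close>, of degrees 1 and -1.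

  For \<open>M\<^sub>-\<close> a second trivial line is added: it completes
  \<open>TS\<^sup>m\<close> to a trivial bundle of rank \<open>m + 1\<close>, while the first one
  completes the vertical tangent space to the fibre of \<open>xi\<close>. Thus \<open>xi\<close>
  becomes the complement of an explicit frame. The section of its sphere bundle comes from a point
  \<open>y\<close> of \<open>M\<^sub>+\<close>, because \<open>Q y\<close> is orthogonal to
  \<open>y\<close> for every \<open>Q\<close> in the Clifford sphere.\<close>

definition linear_family ::
  "'b::topological_space set \<Rightarrow> ('b \<Rightarrow> 'v::euclidean_space \<Rightarrow> 'w::euclidean_space) \<Rightarrow> bool"
  where "linear_family X A \<longleftrightarrow>
    (\<forall>x\<in>X. linear (A x)) \<and> (\<forall>v. continuous_on X (\<lambda>x. A x v))"

lemma linear_familyI: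
  assumes "\<And>x. x \<in> X \<Longrightarrow> linear (A x)" "\<And>v. continuous_on X (\<lambda>x. A x v)"
  shows "linear_family X A"
  using assms by (simp add: linear_family_def)

lemma linear_family_linear: "linear_family X A \<Longrightarrow> x \<in> X \<Longrightarrow> linear (A x)"
  by (simp add: linear_family_def)

lemma linear_family_subset: "linear_family X A \<Longrightarrow> Y \<subseteq> X \<Longrightarrow> linear_family Y A"
  unfolding linear_family_def using continuous_on_subset by blast

text \<open>A family is only required to be continuous in \<open>x\<close> for each fixed vector.
  Expanding the argument in \<open>Basis\<close> upgrades this to joint continuity, by finite
  dimension. The map \<open>r\<close> lets the base point vary with another parameter.\<close>

lemma linear_family_apply:
  fixes A :: "'b::topological_space \<Rightarrow> 'v::euclidean_space \<Rightarrow> 'w::euclidean_space"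
  assumes A: "linear_family X A" and r: "continuous_on T r" "r \<in> T \<rightarrow> X"
    and h: "continuous_on T h"
  shows "continuous_on T (\<lambda>y. A (r y) (h y))"
proof -
  have "A (r y) (h y) = (\<Sum>b\<in>Basis. (h y \<bullet> b) *\<^sub>R A (r y) b)" if "y \<in> T" for y
  proof -
    have l: "linear (A (r y))"
      using that r A by (auto simp: linear_family_def)
    have "A (r y) (h y) = A (r y) (\<Sum>b\<in>Basis. (h y \<bullet> b) *\<^sub>R b)"
      by (simp add: euclidean_representation)
    then show ?thesis
      by (simp add: linear_sum[OF l] linear_scale[OF l])
  qed
  moreover have "continuous_on T (\<lambda>y. \<Sum>b\<in>Basis. (h y \<bullet> b) *\<^sub>R A (r y) b)"
  proof (intro continuous_intros h)
    fix b :: 'v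
    have "continuous_on X (\<lambda>x. A x b)" using A by (simp add: linear_family_def)
    then show "continuous_on T (\<lambda>y. A (r y) b)"
      by (rule continuous_on_compose2) (use r in auto)
  qed
  ultimately show ?thesis
    by (simp cong: continuous_on_cong)
qed

lemma linear_family_apply':
  assumes "linear_family X A" "continuous_on X h"
  shows "continuous_on X (\<lambda>x. A x (h x))"
  by (rule linear_family_apply[OF assms(1)]) (auto intro: assms continuous_on_id)

lemma linear_family_compose:
  assumes A: "linear_family X A" and B: "linear_family X B"
  shows "linear_family X (\<lambda>x v. B x (A x v))"
proof (rule linear_familyI)
  show "linear (\<lambda>v. B x (A x v))" if "x \<in> X" for x
    using linear_compose[OF linear_family_linear[OF A that] linear_family_linear[OF B that]]
    by (simp add: o_def)
  show "continuous_on X (\<lambda>x. B x (A x v))" for v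
    using A by (intro linear_family_apply'[OF B]) (simp add: linear_family_def)
qed

lemma linear_family_pullback:
  assumes "linear_family X A" "continuous_on T r" "r \<in> T \<rightarrow> X"
  shows "linear_family T (\<lambda>y. A (r y))"
  using assms linear_family_apply[OF assms continuous_on_const]
  by (auto simp: linear_family_def)

lemma linear_family_add:
  "linear_family X A \<Longrightarrow> linear_family X B \<Longrightarrow> linear_family X (\<lambda>x v. A x v + B x v)"
  by (auto simp: linear_family_def intro!: linear_compose_add continuous_intros)

lemma linear_family_diff:
  "linear_family X A \<Longrightarrow> linear_family X B \<Longrightarrow> linear_family X (\<lambda>x v. A x v - B x v)"
  by (auto simp: linear_family_def intro!: linear_compose_sub continuous_intros)

lemma linear_family_const: "linear f \<Longrightarrow> linear_family X (\<lambda>x. f)"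
  by (simp add: linear_family_def)

lemma linear_family_id: "linear_family X (\<lambda>x v. v)"
  by (simp add: linear_family_def linear_id[unfolded id_def])

text \<open>Projections and reflections below are written as combinations of such terms, with
  normalizing factors moved into \<open>h\<close>, so that their continuity follows from this
  rule.\<close>

lemma linear_family_rank1:
  assumes "linear_family X A" "continuous_on X g" "continuous_on X h"
  shows "linear_family X (\<lambda>x v. (A x v \<bullet> g x) *\<^sub>R h x)"
proof (rule linear_familyI)
  fix x assume "x \<in> X"
  then interpret linear "A x" using assms(1) by (simp add: linear_family_def)
  show "linear (\<lambda>v. (A x v \<bullet> g x) *\<^sub>R h x)"
    by (rule linearI) (simp_all add: add scale inner_add_left scaleR_add_left)
next
  show "continuous_on X (\<lambda>x. (A x v \<bullet> g x) *\<^sub>R h x)" for v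
    using assms by (auto simp: linear_family_def intro!: continuous_intros)
qed

text \<open>The norm of \<open>A x v\<close> attains its minimum on the product of \<open>X\<close>
  with the unit sphere of \<open>W\<close>, and injectivity makes this minimum positive.\<close>

lemma linear_family_lower_bound:
  assumes A: "linear_family X A" and X: "compact X" and W: "subspace W"
    and inj: "\<And>x. x \<in> X \<Longrightarrow> inj_on (A x) W"
  obtains c where "c > 0" "\<And>x v. x \<in> X \<Longrightarrow> v \<in> W \<Longrightarrow> c * norm v \<le> norm (A x v)"
proof -
  let ?K = "X \<times> (sphere 0 1 \<inter> W)"
  show thesis
  proof (cases "?K = {}")
    \<comment> \<open>Either \<open>X\<close> is empty or \<open>W\<close> is zero; any positive
      constant works.\<close>
    case True
    have "1 * norm v \<le> norm (A x v)" if "x \<in> X" "v \<in> W" for x v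
    proof -
      have "v = 0"
      proof (rule ccontr)
        assume "v \<noteq> 0"
        then have "(x, (1 / norm v) *\<^sub>R v) \<in> ?K"
          using that W by (auto simp: subspace_scale)
        then show False using True by blast
      qed
      then show ?thesis by simp
    qed
    then show ?thesis using that[of 1] by simp
  next
    case False
    have comp: "compact ?K"
      by (intro compact_Times X compact_Int_closed closed_subspace W compact_sphere)
    have "continuous_on ?K (\<lambda>y. norm (A (fst y) (snd y)))"
      by (intro continuous_on_norm linear_family_apply[OF A]) (auto intro!: continuous_intros)
    then obtain z where z: "z \<in> ?K" "\<And>y. y \<in> ?K \<Longrightarrow> norm (A (fst z) (snd z)) \<le> norm (A (fst y) (snd y))"
      using continuous_attains_inf[OF comp False] by blast
    define c where "c = norm (A (fst z) (snd z))"
    have "c > 0"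
    proof -
      have "fst z \<in> X" "snd z \<in> W" "snd z \<noteq> 0" using z(1) by auto
      then have "A (fst z) (snd z) \<noteq> A (fst z) 0"
        using inj W by (metis inj_onD subspace_0)
      then show ?thesis
        using linear_0[OF linear_family_linear[OF A \<open>fst z \<in> X\<close>]] by (simp add: c_def)
    qed
    moreover have "c * norm v \<le> norm (A x v)" if "x \<in> X" "v \<in> W" for x v
    proof (cases "v = 0")
      case False
      interpret linear "A x" using linear_family_linear[OF A \<open>x \<in> X\<close>] .
      have "(x, (1 / norm v) *\<^sub>R v) \<in> ?K"
        using that W False by (auto simp: subspace_scale)
      then have "c \<le> norm (A x ((1 / norm v) *\<^sub>R v))"
        using z(2) by (fastforce simp: c_def)
      then show ?thesis using False by (simp add: scale field_simps)
    qed simp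
    ultimately show ?thesis using that by blast
  qed
qed

text \<open>The bound controls \<open>g z - g y\<close> by
  \<open>A (r z) (g z) - A (r z) (g y)\<close>, which tends to 0 by joint continuity. It serves both
  for inverses of trivializations and for velocities of curves defined by an inverse
  function.\<close>

lemma linear_family_inverse_continuous:
  assumes A: "linear_family X A" and W: "subspace W" and c: "c > 0"
    and bd: "\<And>x v. x \<in> X \<Longrightarrow> v \<in> W \<Longrightarrow> c * norm v \<le> norm (A x v)"
    and r: "continuous_on T r" "r \<in> T \<rightarrow> X" and g: "g \<in> T \<rightarrow> W"
    and h: "continuous_on T (\<lambda>y. A (r y) (g y))"
  shows "continuous_on T g"
proof -
  have "(g \<longlongrightarrow> g y) (at y within T)" if y: "y \<in> T" for y
  proof -
    have "continuous_on T (\<lambda>z. A (r z) (g z) - A (r z) (g y))"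
      by (intro continuous_on_diff h linear_family_apply[OF A r] continuous_on_const)
    then have "((\<lambda>z. A (r z) (g z) - A (r z) (g y)) \<longlongrightarrow> A (r y) (g y) - A (r y) (g y)) (at y within T)"
      using y unfolding continuous_on_def by blast
    then have lim: "((\<lambda>z. norm (A (r z) (g z) - A (r z) (g y)) / c) \<longlongrightarrow> 0) (at y within T)"
      using tendsto_divide_zero tendsto_norm_zero by fastforce
    have "((\<lambda>z. g z - g y) \<longlongrightarrow> 0) (at y within T)"
    proof (rule Lim_null_comparison[OF _ lim])
      show "\<forall>\<^sub>F z in at y within T. norm (g z - g y) \<le> norm (A (r z) (g z) - A (r z) (g y)) / c"
        unfolding eventually_at_filter
      proof (intro always_eventually allI impI)
        fix z assume "z \<in> T"
        then have "r z \<in> X" "g z - g y \<in> W" using r g y W by (auto intro!: subspace_diff)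
        then have "c * norm (g z - g y) \<le> norm (A (r z) (g z - g y))" using bd by blast
        then show "norm (g z - g y) \<le> norm (A (r z) (g z) - A (r z) (g y)) / c"
          using c linear_diff[OF linear_family_linear[OF A \<open>r z \<in> X\<close>]] by (simp add: field_simps)
      qed
    qed
    then show ?thesis using LIM_zero_cancel by blast
  qed
  then show ?thesis by (simp add: continuous_on_def)
qed

text \<open>Only the linear parametrization of the fibres has to be continuous, not its inverse.
  Over a compact base this is equivalent to \<open>trivial_bundle\<close>, and it is easier to
  compose and to pull back.\<close>

definition trivialized ::
  "'b::topological_space set \<Rightarrow> ('b \<Rightarrow> 'v::euclidean_space set) \<Rightarrow> bool"
  where "trivialized X E \<longleftrightarrow>
    (\<exists>(W :: 'v set) A. subspace W \<and> linear_family X A \<and> (\<forall>x\<in>X. inj_on (A x) W \<and> A x ` W = E x))"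

text \<open>The model may lie in any Euclidean space: it has the dimension of a fibre, so an
  isometry moves it into the ambient space of the fibres.\<close>

lemma trivializedI:
  fixes E :: "'b::topological_space \<Rightarrow> 'v::euclidean_space set"
    and A :: "'b \<Rightarrow> 'w::euclidean_space \<Rightarrow> 'v"
  assumes W: "subspace W" and A: "linear_family X A"
    and E: "\<And>x. x \<in> X \<Longrightarrow> inj_on (A x) W" "\<And>x. x \<in> X \<Longrightarrow> A x ` W = E x"
  shows "trivialized X E"
proof (cases "X = {}")
  case True
  then show ?thesis
    unfolding trivialized_def linear_family_def by (intro exI[of _ "{0}"]) auto
next
  case False
  then obtain x where x: "x \<in> X" by blast
  have "dim W = dim (A x ` W)"
    using dim_image_eq[OF linear_family_linear[OF A x], of W] E(1)[OF x] W
    by (metis span_eq_iff)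
  then have "dim W \<le> dim (UNIV :: 'v set)"
    by (metis dim_UNIV dim_subset_UNIV)
  then obtain W' :: "'v set" where W': "subspace W'" "dim W' = dim W"
    using choose_subspace_of_subspace by (metis subspace_UNIV span_UNIV)
  obtain f g where f: "linear f" "f ` W' = W" "\<And>v. v \<in> W' \<Longrightarrow> norm (f v) = norm v"
      "\<And>v. v \<in> W' \<Longrightarrow> g (f v) = v"
    using isometries_subspaces[OF W'(1) W W'(2)] by metis
  have inj: "inj_on f W'" using f(4) by (metis inj_on_inverseI)
  have "subspace W' \<and> linear_family X (\<lambda>x v. A x (f v)) \<and>
     (\<forall>x\<in>X. inj_on (\<lambda>v. A x (f v)) W' \<and> (\<lambda>v. A x (f v)) ` W' = E x)"
  proof (intro conjI ballI W' linear_family_compose[OF linear_family_const[OF f(1)] A])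
    fix x assume x: "x \<in> X"
    show "inj_on (\<lambda>v. A x (f v)) W'"
      using comp_inj_on[OF inj, of "A x"] E(1)[OF x] f(2) by (simp add: o_def)
    show "(\<lambda>v. A x (f v)) ` W' = E x"
      using E(2)[OF x] f(2) by (metis image_image)
  qed
  then show ?thesis unfolding trivialized_def by blast
qed

lemma trivialized_pullback:
  fixes E :: "'b::topological_space \<Rightarrow> 'v::euclidean_space set"
  assumes "trivialized X E" "continuous_on T r" "r \<in> T \<rightarrow> X"
  shows "trivialized T (\<lambda>y. E (r y))"
proof -
  obtain W :: "'v set" and A where *: "subspace W" "linear_family X A" "\<forall>x\<in>X. inj_on (A x) W \<and> A x ` W = E x"
    using assms(1) unfolding trivialized_def by blast
  show ?thesis
    by (rule trivializedI[OF *(1) linear_family_pullback[OF *(2) assms(2,3)]]) (use * assms in auto)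
qed

lemma trivialized_cong:
  assumes "\<And>x. x \<in> X \<Longrightarrow> E x = E' x"
  shows "trivialized X E \<longleftrightarrow> trivialized X E'"
  using assms unfolding trivialized_def by (metis (no_types, lifting))

lemma trivialized_imp_trivial_bundle:
  fixes E :: "'b::euclidean_space \<Rightarrow> 'v::euclidean_space set"
  assumes X: "compact X" and t: "trivialized X E"
  shows "trivial_bundle X E"
proof -
  obtain W :: "'v set" and A where W: "subspace W" and A: "linear_family X A"
    and inj: "\<And>x. x \<in> X \<Longrightarrow> inj_on (A x) W" and im: "\<And>x. x \<in> X \<Longrightarrow> A x ` W = E x"
    using t unfolding trivialized_def by blast
  obtain c where c: "c > 0" "\<And>x v. x \<in> X \<Longrightarrow> v \<in> W \<Longrightarrow> c * norm v \<le> norm (A x v)"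
    using linear_family_lower_bound[OF A X W inj] by blast
  define k where "k = (\<lambda>x. inv_into W (A x))"
  have kW: "k x y \<in> W" "A x (k x y) = y" if "x \<in> X" "y \<in> E x" for x y
    using im that unfolding k_def by (metis inv_into_into, metis f_inv_into_f)
  have kA: "k x (A x v) = v" if "x \<in> X" "v \<in> W" for x v
    using inj that by (simp add: k_def)
  define f where "f = (\<lambda>(x, y). (x, k x y))"
  define g where "g = (\<lambda>(x, v). (x, A x v))"
  have conk: "continuous_on (Sigma X E) (\<lambda>z. k (fst z) (snd z))"
  proof (rule linear_family_inverse_continuous[OF A W c, where r = fst])
    have "continuous_on (Sigma X E) snd" by (intro continuous_intros)
    then show "continuous_on (Sigma X E) (\<lambda>y. A (fst y) (k (fst y) (snd y)))"
      by (rule continuous_on_eq) (auto simp: kW)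
  qed (auto simp: kW intro!: continuous_intros)
  have "homeomorphism (Sigma X E) (Sigma X (\<lambda>_. W)) f g"
  proof (rule homeomorphismI)
    show "continuous_on (Sigma X E) f"
      unfolding f_def split_def by (intro continuous_intros conk)
    show "continuous_on (Sigma X (\<lambda>_. W)) g"
      unfolding g_def split_def
      by (intro continuous_on_Pair linear_family_apply[OF A]) (auto intro!: continuous_intros)
  qed (use im in \<open>auto simp: f_def g_def kW kA\<close>)
  moreover have "\<exists>B. linear B \<and> (\<forall>v\<in>E x. f (x, v) = (x, B v))" if x: "x \<in> X" for x
  proof -
    obtain B where B: "linear B" "\<forall>w\<in>W. B (A x w) = w"
      using linear_exists_left_inverse_on[OF linear_family_linear[OF A x] W inj[OF x]] by blast
    have "f (x, v) = (x, B v)" if "v \<in> E x" for v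
      using B(2) kW[OF x that] unfolding f_def by (metis case_prod_conv)
    then show ?thesis using B(1) by blast
  qed
  moreover have "subspace (E x)" if "x \<in> X" for x
    using linear_subspace_image[OF linear_family_linear[OF A that] W] im[OF that] by simp
  ultimately show ?thesis
    unfolding trivial_bundle_def bundle_isomorphic_def using W by blast
qed

text \<open>The fibre coordinate \<open>k\<close> is delivered with its continuity on the total
  space because it later yields the coordinates of the tautological section \<open>x\<close> of the
  pullback of \<open>xi\<close> to \<open>M\<^sub>-\<close>.\<close>

lemma trivial_bundleE:
  fixes E :: "'b::euclidean_space \<Rightarrow> 'v::euclidean_space set"
  assumes "trivial_bundle X E"
  obtains W A k where "subspace (W :: 'v set)" "linear_family X A"
    "\<And>x. x \<in> X \<Longrightarrow> inj_on (A x) W" "\<And>x. x \<in> X \<Longrightarrow> A x ` W = E x"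
    "continuous_on (Sigma X E) (\<lambda>z. k (fst z) (snd z))"
    "\<And>x y. x \<in> X \<Longrightarrow> y \<in> E x \<Longrightarrow> k x y \<in> W" "\<And>x y. x \<in> X \<Longrightarrow> y \<in> E x \<Longrightarrow> A x (k x y) = y"
proof -
  from assms obtain W :: "'v set" and f g where W: "subspace W" and hom: "homeomorphism (Sigma X E) (Sigma X (\<lambda>_. W)) f g"
    and fib: "\<And>x. x \<in> X \<Longrightarrow> \<exists>A. linear A \<and> (\<forall>v\<in>E x. f (x, v) = (x, A v))"
    and E: "\<And>x. x \<in> X \<Longrightarrow> subspace (E x)"
    unfolding trivial_bundle_def bundle_isomorphic_def by blast
  obtain B where B: "B \<subseteq> W" "pairwise orthogonal B" "\<And>b. b \<in> B \<Longrightarrow> norm b = 1" "independent B"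
      "card B = dim W" "span B = W"
    using orthonormal_basis_subspace[OF W] by metis
  have fB: "finite B" using B(4) by (simp add: independent_imp_finite)
  have rep: "w = (\<Sum>b\<in>B. (w \<bullet> b) *\<^sub>R b)" if "w \<in> W" for w
  proof -
    have "w \<in> span B" using that B by simp
    then show ?thesis
      using orthonormal_basis_expand[OF B(2) B(3) _ fB] by (metis)
  qed
  \<comment> \<open>Only \<open>f\<close> is given as fibrewise linear. \<open>A\<close> is linear
    by construction, from the values of \<open>g\<close> on an orthonormal basis of
    \<open>W\<close>; linearity of \<open>f\<close> then shows that it agrees with \<open>g\<close>
    on \<open>W\<close>.\<close>
  define A where "A = (\<lambda>x v. \<Sum>b\<in>B. (v \<bullet> b) *\<^sub>R snd (g (x, b)))"
  define k where "k = (\<lambda>x y. snd (f (x, y)))"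
  have cf: "continuous_on (Sigma X E) f" and cg: "continuous_on (Sigma X (\<lambda>_. W)) g"
    using hom by (auto simp: homeomorphism_def)
  have fg: "f (g (x, w)) = (x, w)" "g (x, w) \<in> Sigma X E" if "x \<in> X" "w \<in> W" for x w
    using hom that unfolding homeomorphism_def by (blast intro: SigmaI)+
  have gf: "g (f (x, y)) = (x, y)" "f (x, y) \<in> Sigma X (\<lambda>_. W)" if "x \<in> X" "y \<in> E x" for x y
    using hom that unfolding homeomorphism_def by (blast intro: SigmaI)+
  have fk: "f (x, y) = (x, k x y)" if "x \<in> X" "y \<in> E x" for x y
    using fib[OF that(1)] that(2) by (auto simp: k_def)
  have gx: "fst (g (x, w)) = x" "snd (g (x, w)) \<in> E x" if "x \<in> X" "w \<in> W" for x w
  proof -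
    have "f (g (x, w)) = (fst (g (x, w)), k (fst (g (x, w))) (snd (g (x, w))))"
      using fk fg(2)[OF that] by (metis (no_types, lifting) SigmaE fst_conv snd_conv)
    then show 1: "fst (g (x, w)) = x" using fg(1)[OF that] by simp
    then show "snd (g (x, w)) \<in> E x" using fg(2)[OF that] by auto
  qed
  have lin: "linear (A x)" for x
    unfolding A_def
    by (rule linearI) (simp_all add: inner_add_left scaleR_add_left sum.distrib scaleR_sum_right)
  have Ag: "A x w = snd (g (x, w))" if x: "x \<in> X" and w: "w \<in> W" for x w
  proof -
    obtain L where L: "linear L" "\<forall>v\<in>E x. f (x, v) = (x, L v)" using fib[OF x] by blast
    have bW: "b \<in> W" if "b \<in> B" for b using B(1) that by blast
    have Lg: "L (snd (g (x, b))) = b" if "b \<in> W" for b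
      using L(2) gx[OF x that] fg(1)[OF x that] by (metis prod.collapse snd_conv)
    have AE: "A x w \<in> E x"
      unfolding A_def using E[OF x] gx(2)[OF x] bW by (intro subspace_sum) (auto intro: subspace_scale)
    have "L (A x w) = (\<Sum>b\<in>B. (w \<bullet> b) *\<^sub>R b)"
      unfolding A_def using bW Lg by (simp add: linear_sum[OF L(1)] linear_scale[OF L(1)])
    then have "f (x, A x w) = (x, w)" using rep[OF w] L(2) AE by simp
    then show ?thesis using gf(1)[OF x AE] by (metis snd_conv)
  qed
  have fam: "linear_family X A"
  proof (rule linear_familyI[OF lin])
    fix v
    have "continuous_on X (\<lambda>x. g (x, b))" if "b \<in> B" for b
      by (rule continuous_on_compose2[OF cg]) (use that B(1) in \<open>auto intro!: continuous_intros\<close>)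
    then show "continuous_on X (\<lambda>x. A x v)"
      unfolding A_def by (intro continuous_intros) auto
  qed
  show thesis
  proof (rule that[OF W fam])
    fix x assume x: "x \<in> X"
    show "inj_on (A x) W"
    proof (rule inj_onI)
      fix v w assume "v \<in> W" "w \<in> W" "A x v = A x w"
      then have "g (x, v) = g (x, w)" using Ag[OF x] gx(1)[OF x] by (simp add: prod_eq_iff)
      then show "v = w" using fg(1)[OF x] \<open>v \<in> W\<close> \<open>w \<in> W\<close> by (metis snd_conv)
    qed
    show kW: "k x y \<in> W" if "y \<in> E x" for y using gf(2)[OF x that] by (auto simp: k_def)
    show Ak: "A x (k x y) = y" if "y \<in> E x" for y
      using gf(1)[OF x that] fk[OF x that] Ag[OF x kW[OF that]] by simp
    show "A x ` W = E x"
    proof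
      show "A x ` W \<subseteq> E x" using Ag[OF x] gx(2)[OF x] by auto
      show "E x \<subseteq> A x ` W" using Ak kW by (metis image_eqI subsetI)
    qed
  next
    show "continuous_on (Sigma X E) (\<lambda>z. k (fst z) (snd z))"
      unfolding k_def using cf by (auto intro!: continuous_intros)
  qed
qed

lemma trivial_bundle_iff_trivialized:
  fixes E :: "'b::euclidean_space \<Rightarrow> 'v::euclidean_space set"
  assumes "compact X"
  shows "trivial_bundle X E \<longleftrightarrow> trivialized X E"
proof
  assume "trivial_bundle X E"
  then show "trivialized X E" by (rule trivial_bundleE) (rule trivializedI)
qed (rule trivialized_imp_trivial_bundle[OF assms])

section \<open>Deformations of families of subspaces\<close>

text \<open>Injective endomorphisms are automorphisms of the whole ambient space, so orthogonal
  complements are transported as well, by the adjoints.\<close>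

definition gl_equivalent ::
  "'b::topological_space set \<Rightarrow> ('b \<Rightarrow> 'v::euclidean_space set) \<Rightarrow> ('b \<Rightarrow> 'v set) \<Rightarrow> bool"
  where "gl_equivalent X N N' \<longleftrightarrow>
    (\<exists>A. linear_family X A \<and> (\<forall>x\<in>X. inj (A x) \<and> A x ` N x = N' x))"

lemma gl_equivalentI:
  assumes "linear_family X A" "\<And>x. x \<in> X \<Longrightarrow> inj (A x)" "\<And>x. x \<in> X \<Longrightarrow> A x ` N x = N' x"
  shows "gl_equivalent X N N'"
  using assms unfolding gl_equivalent_def by blast

lemma gl_equivalent_refl: "(\<And>x. x \<in> X \<Longrightarrow> N x = N' x) \<Longrightarrow> gl_equivalent X N N'"
  by (rule gl_equivalentI[OF linear_family_id]) auto

lemma gl_equivalent_trans [trans]: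
  fixes N :: "'b::topological_space \<Rightarrow> 'v::euclidean_space set"
  assumes "gl_equivalent X N N'" "gl_equivalent X N' N''"
  shows "gl_equivalent X N N''"
proof -
  obtain A where A: "linear_family X A" "\<forall>x\<in>X. inj (A x) \<and> A x ` N x = N' x"
    using assms(1) unfolding gl_equivalent_def by blast
  obtain B where B: "linear_family X B" "\<forall>x\<in>X. inj (B x) \<and> B x ` N' x = N'' x"
    using assms(2) unfolding gl_equivalent_def by blast
  show ?thesis
  proof (rule gl_equivalentI[OF linear_family_compose[OF A(1) B(1)]])
    fix x assume x: "x \<in> X"
    show "inj (\<lambda>v. B x (A x v))"
      using A(2) B(2) x inj_compose[of "B x" "A x"] by (simp add: o_def)
    show "(\<lambda>v. B x (A x v)) ` N x = N'' x"
      using A(2) B(2) x by (metis image_image)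
  qed
qed

lemma gl_equivalent_pullback:
  assumes "gl_equivalent X N N'" "continuous_on T r" "r \<in> T \<rightarrow> X"
  shows "gl_equivalent T (\<lambda>y. N (r y)) (\<lambda>y. N' (r y))"
proof -
  obtain A where "linear_family X A" "\<forall>x\<in>X. inj (A x) \<and> A x ` N x = N' x"
    using assms(1) unfolding gl_equivalent_def by blast
  then show ?thesis
    using assms(3) by (intro gl_equivalentI[OF linear_family_pullback[OF _ assms(2,3)]]) auto
qed

text \<open>\<open>adjoint (A x) w\<close> is orthogonal to \<open>N x\<close> exactly if
  \<open>w\<close> is orthogonal to the image \<open>C\<close> of \<open>N x\<close>. So the
  adjoints parametrize the complements by the complement of \<open>C\<close>.\<close>

lemma orthogonal_comp_trivialized:
  fixes N :: "'b::topological_space \<Rightarrow> 'v::euclidean_space set"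
  assumes "gl_equivalent X N (\<lambda>_. C)"
  shows "trivialized X (\<lambda>x. orthogonal_comp (N x))"
proof -
  obtain A where A: "linear_family X A" and inj: "\<And>x. x \<in> X \<Longrightarrow> inj (A x)"
    and im: "\<And>x. x \<in> X \<Longrightarrow> A x ` N x = C"
    using assms unfolding gl_equivalent_def by blast
  have lin: "linear (A x)" if "x \<in> X" for x using linear_family_linear[OF A that] .
  have fam: "linear_family X (\<lambda>x. adjoint (A x))"
  proof (rule linear_familyI)
    show "linear (adjoint (A x))" if "x \<in> X" for x using adjoint_linear[OF lin[OF that]] .
    fix v
    have eq: "(\<Sum>b\<in>Basis. (v \<bullet> A x b) *\<^sub>R b) = adjoint (A x) v" if "x \<in> X" for x
      using adjoint_works[OF lin[OF that]] by (metis (no_types, lifting) euclidean_representation inner_commute sum.cong)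
    have "continuous_on X (\<lambda>x. \<Sum>b\<in>Basis. (v \<bullet> A x b) *\<^sub>R b)"
      using A by (intro continuous_intros) (auto simp: linear_family_def)
    then show "continuous_on X (\<lambda>x. adjoint (A x) v)"
      by (rule continuous_on_eq) (rule eq)
  qed
  show ?thesis
  proof (rule trivializedI[OF subspace_orthogonal_comp[of C] fam])
    fix x assume x: "x \<in> X"
    have surj: "surj (A x)" using linear_inj_imp_surj[OF lin[OF x] inj[OF x]] .
    then have injad: "inj (adjoint (A x))" using lin[OF x] by simp
    then show "inj_on (adjoint (A x)) (orthogonal_comp C)" using inj_on_subset by blast
    have surjad: "surj (adjoint (A x))"
      using linear_inj_imp_surj[OF adjoint_linear[OF lin[OF x]] injad] .
    have iff: "adjoint (A x) w \<in> orthogonal_comp (N x) \<longleftrightarrow> w \<in> orthogonal_comp C" for w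
      unfolding orthogonal_comp_def orthogonal_def im[OF x, symmetric]
      by (simp add: adjoint_works[OF lin[OF x]] inner_commute)
    show "adjoint (A x) ` orthogonal_comp C = orthogonal_comp (N x)"
    proof
      show "orthogonal_comp (N x) \<subseteq> adjoint (A x) ` orthogonal_comp C"
        using surjad iff by (metis (no_types, lifting) image_eqI subsetI surjD)
    qed (use iff in auto)
  qed
qed

section \<open>Continuous families of subspaces and homotopies of frames\<close>

lemma span_insert_span: "span (insert a (span B)) = span (insert a B)"
  by (simp add: span_insert span_span)

text \<open>Continuity is witnessed by projections onto the subspaces, not necessarily orthogonal
  ones; the comparison of nearby subspaces uses nothing else.\<close>

definition continuous_subspaces ::
  "'b::topological_space set \<Rightarrow> ('b \<Rightarrow> 'v::euclidean_space set) \<Rightarrow> bool"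
  where "continuous_subspaces X E \<longleftrightarrow>
    (\<exists>p. linear_family X p \<and> (\<forall>x\<in>X. subspace (E x) \<and> (\<forall>v. p x v \<in> E x) \<and> (\<forall>v\<in>E x. p x v = v)))"

lemma continuous_subspaces_null: "continuous_subspaces X (\<lambda>_. {0})"
  unfolding continuous_subspaces_def
  by (intro exI[of _ "\<lambda>x v. 0"]) (simp add: linear_family_def module_hom_zero subspace_0)

text \<open>A Gram-Schmidt step for arbitrary projections: \<open>g\<close> is the part of
  \<open>n\<close> in the kernel of \<open>p\<close>. If \<open>v - k *\<^sub>R n x\<close> lies in
  \<open>E x\<close>, then \<open>v - p x v = k *\<^sub>R g x\<close>, so pairing with
  \<open>g x\<close> recovers \<open>k\<close>.\<close>

lemma continuous_subspaces_insert:
  fixes E :: "'b::topological_space \<Rightarrow> 'v::euclidean_space set"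
  assumes E: "continuous_subspaces X E" and n: "continuous_on X n"
    and nE: "\<And>x. x \<in> X \<Longrightarrow> n x \<notin> E x"
  shows "continuous_subspaces X (\<lambda>x. span (insert (n x) (E x)))"
proof -
  obtain p where p: "linear_family X p" and sub: "\<And>x. x \<in> X \<Longrightarrow> subspace (E x)"
    and pE: "\<And>x v. x \<in> X \<Longrightarrow> p x v \<in> E x" and pid: "\<And>x v. x \<in> X \<Longrightarrow> v \<in> E x \<Longrightarrow> p x v = v"
    using E unfolding continuous_subspaces_def by blast
  define g where "g = (\<lambda>x. n x - p x (n x))"
  have g0: "g x \<noteq> 0" if "x \<in> X" for x
    using nE[OF that] pE[OF that, of "n x"] by (auto simp: g_def)
  have cg: "continuous_on X g"
    unfolding g_def by (intro continuous_intros n linear_family_apply'[OF p])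
  let ?q = "\<lambda>x v. p x v + ((v - p x v) \<bullet> g x) *\<^sub>R ((1 / (g x \<bullet> g x)) *\<^sub>R g x)"
  have "linear_family X ?q"
    by (intro linear_family_add p linear_family_rank1 linear_family_diff linear_family_id cg continuous_intros)
       (use g0 in auto)
  moreover have "?q x v \<in> span (insert (n x) (E x))" if x: "x \<in> X" for x v
  proof -
    have "n x \<in> span (insert (n x) (E x))" "p x w \<in> span (insert (n x) (E x))" for w
      using pE[OF x, of w] by (auto intro: span_base)
    then show ?thesis unfolding g_def
      by (intro span_add span_scale span_diff) auto
  qed
  moreover have "?q x v = v" if x: "x \<in> X" and v: "v \<in> span (insert (n x) (E x))" for x v
  proof -
    obtain k where k: "v - k *\<^sub>R n x \<in> E x"
      using v sub[OF x] by (metis span_breakdown_eq span_eq_iff)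
    interpret linear "p x" using linear_family_linear[OF p x] .
    have "p x v - k *\<^sub>R p x (n x) = v - k *\<^sub>R n x"
      using pid[OF x k] by (simp add: diff scale)
    then have "v - p x v = k *\<^sub>R g x"
      by (simp add: g_def algebra_simps)
    moreover have "(k *\<^sub>R g x \<bullet> g x) *\<^sub>R ((1 / (g x \<bullet> g x)) *\<^sub>R g x) = k *\<^sub>R g x"
      using g0[OF x] by simp
    ultimately show ?thesis by (metis add.commute diff_add_cancel)
  qed
  ultimately show ?thesis
    unfolding continuous_subspaces_def by (intro exI[of _ ?q]) auto
qed

lemma continuous_subspaces_span:
  fixes f :: "nat \<Rightarrow> 'b::topological_space \<Rightarrow> 'v::euclidean_space"
  assumes "\<And>i. i < k \<Longrightarrow> continuous_on X (f i)"
    and "\<And>i x. i < k \<Longrightarrow> x \<in> X \<Longrightarrow> f i x \<notin> span ((\<lambda>j. f j x) ` {..<i})"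
  shows "continuous_subspaces X (\<lambda>x. span ((\<lambda>i. f i x) ` {..<k}))"
  using assms
proof (induction k)
  case 0
  then show ?case by (simp add: continuous_subspaces_null)
next
  case (Suc k)
  then have "continuous_subspaces X (\<lambda>x. span (insert (f k x) (span ((\<lambda>i. f i x) ` {..<k}))))"
    by (intro continuous_subspaces_insert) auto
  then show ?case
    by (simp add: lessThan_Suc span_insert_span)
qed

lemma independent_family_of_basis:
  assumes "subspace K"
  obtains b :: "nat \<Rightarrow> 'v::euclidean_space" where "\<And>i. i < dim K \<Longrightarrow> b i \<notin> span (b ` {..<i})"
    "span (b ` {..<dim K}) = K" "\<And>i. i < dim K \<Longrightarrow> b i \<in> K"
proof -
  obtain B where B: "B \<subseteq> K" "independent B" "card B = dim K" "span B = K"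
    using basis_exists[of K] assms by (metis span_subspace)
  have fB: "finite B" using B(2) by (simp add: independent_imp_finite)
  then obtain b where b: "bij_betw b {..<dim K} B"
    using B(3) by (metis bij_betw_from_nat_into_finite bij_betw_iff_card finite_lessThan card_lessThan)
  show thesis
  proof
    fix i assume i: "i < dim K"
    have "b ` {..<i} \<subseteq> B - {b i}"
      using i b unfolding bij_betw_def inj_on_def by fastforce
    moreover have "b i \<in> B" using i b by (auto simp: bij_betw_def)
    ultimately show "b i \<notin> span (b ` {..<i})"
      using B(2) unfolding dependent_def by (meson span_mono subsetD)
    show "b i \<in> K" using \<open>b i \<in> B\<close> B(1) by blast
  next
    show "span (b ` {..<dim K}) = K" using b B(4) by (simp add: bij_betw_def)
  qed
qed

lemma continuous_subspaces_const:
  assumes "subspace (K :: 'v::euclidean_space set)"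
  shows "continuous_subspaces X (\<lambda>_. K)"
proof -
  obtain b :: "nat \<Rightarrow> 'v" where b: "\<And>i. i < dim K \<Longrightarrow> b i \<notin> span (b ` {..<i})" "span (b ` {..<dim K}) = K"
    using independent_family_of_basis[OF assms] by metis
  show ?thesis
    using continuous_subspaces_span[of "dim K" X "\<lambda>i _. b i"] b by auto
qed

text \<open>
  For nearby parameters \<open>s\<close>, \<open>s'\<close> the map \<open>p\<^sub>s\<^sub>' p\<^sub>s + (1 - p\<^sub>s\<^sub>')(1 - p\<^sub>s)\<close> is close to the identity and
  carries the image of the projection \<open>p\<^sub>s\<close> to that of \<open>p\<^sub>s\<^sub>'\<close>.
\<close>
lemma gl_equivalent_homotopy:
  fixes E :: "real \<Rightarrow> 'b::metric_space \<Rightarrow> 'v::euclidean_space set"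
  assumes X: "compact X" and E: "continuous_subspaces ({0..1} \<times> X) (\<lambda>z. E (fst z) (snd z))"
  shows "gl_equivalent X (E 0) (E 1)"
proof -
  let ?I = "{0..1::real}"
  obtain p where p: "linear_family (?I \<times> X) p"
    and pE: "\<And>s x v. s \<in> ?I \<Longrightarrow> x \<in> X \<Longrightarrow> p (s, x) v \<in> E s x"
    and pid: "\<And>s x v. s \<in> ?I \<Longrightarrow> x \<in> X \<Longrightarrow> v \<in> E s x \<Longrightarrow> p (s, x) v = v"
    and sub: "\<And>s x v. s \<in> ?I \<Longrightarrow> x \<in> X \<Longrightarrow> subspace (E s x)"
    using E unfolding continuous_subspaces_def by fastforce
  have lin: "linear (p (s, x))" if "s \<in> ?I" "x \<in> X" for s x
    using linear_family_linear[OF p] that by simp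
  define A where "A = (\<lambda>s s' x v. p (s', x) (p (s, x) v) + ((v - p (s, x) v) - p (s', x) (v - p (s, x) v)))"
  have A_self: "A s s x v = v" if "s \<in> ?I" "x \<in> X" for s x v
  proof -
    have pp: "p (s, x) (p (s, x) v) = p (s, x) v" using pid[OF that pE[OF that]] .
    then show ?thesis by (simp add: A_def linear_diff[OF lin[OF that]])
  qed
  have A_lin: "linear_family X (A s s')" if s: "s \<in> ?I" "s' \<in> ?I" for s s'
  proof -
    have q: "linear_family X (\<lambda>x. p (t, x))" if "t \<in> ?I" for t
      by (rule linear_family_pullback[OF p]) (use that in \<open>auto intro!: continuous_intros\<close>)
    show ?thesis unfolding A_def
      by (intro linear_family_add linear_family_diff linear_family_id
          linear_family_compose[OF q[OF s(1)] q[OF s(2)]] q s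
          linear_family_compose[OF linear_family_diff[OF linear_family_id q[OF s(1)]] q[OF s(2)]])
  qed
  have step: "gl_equivalent X (E s) (E s')"
    if s: "s \<in> ?I" "s' \<in> ?I" and close: "\<And>x v. x \<in> X \<Longrightarrow> norm v = 1 \<Longrightarrow> norm (A s s' x v - v) < 1" for s s'
  proof (rule gl_equivalentI[OF A_lin[OF s]])
    fix x assume x: "x \<in> X"
    interpret A: linear "A s s' x" using linear_family_linear[OF A_lin[OF s] x] .
    \<comment> \<open>A unit vector in the kernel would be displaced by exactly 1, against the
      strict bound.\<close>
    show inj: "inj (A s s' x)"
      unfolding A.inj_iff_eq_0
    proof (intro allI impI, rule ccontr)
      fix v assume v: "A s s' x v = 0" "v \<noteq> 0"
      have "norm (A s s' x ((1 / norm v) *\<^sub>R v) - (1 / norm v) *\<^sub>R v) < 1"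
        by (rule close[OF x]) (use v in auto)
      then show False using v by (simp add: A.scale)
    qed
    have surj: "surj (A s s' x)"
      using linear_inj_imp_surj[OF A.linear_axioms inj] .
    \<comment> \<open>The map intertwines the two projections: composing it with either of them, on
      the proper side, gives the same product.\<close>
    have p'A: "p (s', x) (A s s' x v) = p (s', x) (p (s, x) v)" for v
      using pid[OF s(2) x pE[OF s(2) x]] lin[OF s(2) x]
      by (simp add: A_def linear_add linear_diff)
    have Ap: "A s s' x (p (s, x) v) = p (s', x) (p (s, x) v)" for v
      using pid[OF s(1) x pE[OF s(1) x]] linear_0[OF lin[OF s(2) x]] by (simp add: A_def)
    show "A s s' x ` E s x = E s' x"
    proof (intro set_eqI iffI)
      fix y assume "y \<in> A s s' x ` E s x"
      then obtain v where "v \<in> E s x" "y = A s s' x v" by blast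
      then have "y = p (s', x) (p (s, x) v)" using Ap[of v] pid[OF s(1) x] by simp
      then show "y \<in> E s' x" using pE[OF s(2) x] by simp
    next
      fix y assume y: "y \<in> E s' x"
      obtain v where "y = A s s' x v" using surj by (metis surjD)
      then have "y = p (s', x) (p (s, x) v)" using pid[OF s(2) x y] p'A by simp
      then have "y = A s s' x (p (s, x) v)" using Ap by simp
      then show "y \<in> A s s' x ` E s x" using pE[OF s(1) x] by blast
    qed
  qed
  \<comment> \<open>As \<open>A s s\<close> is the identity, uniform continuity on this compact set
    bounds the deviation from the identity uniformly in \<open>x\<close> for \<open>s'\<close> near
    \<open>s\<close>. Finitely many steps of this size join 0 to 1.\<close>
  let ?K = "?I \<times> ?I \<times> X \<times> sphere (0::'v) 1"
  have comp: "compact ?K" by (intro compact_Times X) auto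
  have "continuous_on ?K (\<lambda>z. A (fst z) (fst (snd z)) (fst (snd (snd z))) (snd (snd (snd z))) - snd (snd (snd z)))"
    unfolding A_def by (intro continuous_intros linear_family_apply[OF p]) auto
  then have "uniformly_continuous_on ?K (\<lambda>z. A (fst z) (fst (snd z)) (fst (snd (snd z))) (snd (snd (snd z))) - snd (snd (snd z)))"
    using comp compact_uniformly_continuous by blast
  then obtain d where d: "d > 0" and dd: "\<And>z z'. z \<in> ?K \<Longrightarrow> z' \<in> ?K \<Longrightarrow> dist z' z < d \<Longrightarrow>
      dist (A (fst z') (fst (snd z')) (fst (snd (snd z'))) (snd (snd (snd z'))) - snd (snd (snd z')))
           (A (fst z) (fst (snd z)) (fst (snd (snd z))) (snd (snd (snd z))) - snd (snd (snd z))) < 1"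
    unfolding uniformly_continuous_on_def using zero_less_one by metis
  have near: "gl_equivalent X (E s) (E s')" if s: "s \<in> ?I" "s' \<in> ?I" "\<bar>s - s'\<bar> < d" for s s'
  proof (rule step[OF s(1,2)])
    fix x and v :: 'v assume x: "x \<in> X" "norm v = 1"
    have "dist (s, s', x, v) (s, s, x, v) < d"
      using s(3) by (simp add: dist_Pair_Pair dist_real_def abs_minus_commute)
    then show "norm (A s s' x v - v) < 1"
      using dd[of "(s, s, x, v)" "(s, s', x, v)"] s x by (simp add: A_self)
  qed
  obtain n where n: "1 / real (Suc n) < d" using d nat_approx_posE by blast
  have "gl_equivalent X (E 0) (E (real k / real (Suc n)))" if "k \<le> Suc n" for k
    using that
  proof (induction k)
    case 0
    then show ?case by (simp add: gl_equivalent_refl)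
  next
    case (Suc k)
    have "gl_equivalent X (E (real k / real (Suc n))) (E (real (Suc k) / real (Suc n)))"
    proof (rule near)
      show "\<bar>real k / real (Suc n) - real (Suc k) / real (Suc n)\<bar> < d"
        using n by (simp add: diff_divide_distrib[symmetric] add_divide_distrib)
    qed (use Suc.prems in \<open>auto simp: field_simps\<close>)
    then show ?case using Suc gl_equivalent_trans by (metis Suc_leD)
  qed
  from this[of "Suc n"] show ?thesis by simp
qed

lemma gl_equivalent_frame_homotopy:
  fixes f :: "nat \<Rightarrow> real \<Rightarrow> 'b::metric_space \<Rightarrow> 'v::euclidean_space"
  assumes X: "compact X"
    and f: "\<And>i. i < k \<Longrightarrow> continuous_on ({0..1} \<times> X) (\<lambda>z. f i (fst z) (snd z))"
    and ind: "\<And>i s x. i < k \<Longrightarrow> s \<in> {0..1} \<Longrightarrow> x \<in> X \<Longrightarrow> f i s x \<notin> span ((\<lambda>j. f j s x) ` {..<i})"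
  shows "gl_equivalent X (\<lambda>x. span ((\<lambda>i. f i 0 x) ` {..<k})) (\<lambda>x. span ((\<lambda>i. f i 1 x) ` {..<k}))"
  using gl_equivalent_homotopy[OF X, of "\<lambda>s x. span ((\<lambda>i. f i s x) ` {..<k})"]
    continuous_subspaces_span[of k "{0..1} \<times> X" "\<lambda>i z. f i (fst z) (snd z)"] f ind by fastforce

lemma gl_equivalent_insert_homotopy:
  fixes n :: "real \<Rightarrow> 'b::metric_space \<Rightarrow> 'v::euclidean_space"
  assumes X: "compact X" and K: "subspace K"
    and n: "continuous_on ({0..1} \<times> X) (\<lambda>z. n (fst z) (snd z))"
    and ind: "\<And>s x. s \<in> {0..1} \<Longrightarrow> x \<in> X \<Longrightarrow> n s x \<notin> K"
  shows "gl_equivalent X (\<lambda>x. span (insert (n 0 x) K)) (\<lambda>x. span (insert (n 1 x) K))"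
  using gl_equivalent_homotopy[OF X, of "\<lambda>s x. span (insert (n s x) K)"]
    continuous_subspaces_insert[OF continuous_subspaces_const[OF K] n] ind by fastforce

text \<open>Presents the unit sphere of a subspace as the relative boundary of a convex body, the
  form in which maps into spheres of larger dimension are known to be inessential.\<close>

lemma sphere_Int_subspace_rel_frontier:
  assumes "subspace (U :: 'b::euclidean_space set)"
  shows "rel_frontier (cball 0 1 \<inter> U) = sphere 0 1 \<inter> U" "aff_dim (cball 0 1 \<inter> U) = int (dim U)"
proof -
  have ne: "interior (cball 0 1) \<inter> U \<noteq> {}" using subspace_0[OF assms] by force
  show "rel_frontier (cball 0 1 \<inter> U) = sphere 0 1 \<inter> U"
    using convex_affine_rel_frontier_Int[OF convex_cball subspace_imp_affine[OF assms] ne]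
    by (simp add: frontier_cball)
  have "aff_dim (U \<inter> cball 0 1) = aff_dim U"
    using aff_dim_convex_Int_nonempty_interior[OF subspace_imp_convex[OF assms]] ne
    by (metis inf_commute)
  then show "aff_dim (cball 0 1 \<inter> U) = int (dim U)"
    using aff_dim_subspace[OF assms] by (simp add: inf_commute)
qed

lemma sphere_map_inessential:
  fixes U :: "'b::euclidean_space set" and V :: "'v::euclidean_space set"
  assumes "subspace U" "subspace V" "dim U < dim V"
    and "continuous_on (sphere 0 1 \<inter> U) f" "f \<in> sphere 0 1 \<inter> U \<rightarrow> sphere 0 1 \<inter> V"
  obtains c where "homotopic_with_canon (\<lambda>_. True) (sphere 0 1 \<inter> U) (sphere 0 1 \<inter> V) f (\<lambda>_. c)"
  using inessential_spheremap_lowdim_gen[of "cball 0 1 \<inter> U" "cball 0 1 \<inter> V" f] assms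
  by (auto simp: sphere_Int_subspace_rel_frontier convex_Int subspace_imp_convex bounded_Int)

text \<open>
  In the stable range, that is as long as the orthogonal complement has larger dimension than the
  sphere, the vectors of a frame can be made constant one after the other.
\<close>
lemma gl_equivalent_frame_const:
  fixes f :: "nat \<Rightarrow> 'b::euclidean_space \<Rightarrow> 'v::euclidean_space" and U :: "'b set"
  assumes U: "subspace U" and dim: "dim U + k \<le> DIM('v)"
    and f: "\<And>i. i < k \<Longrightarrow> continuous_on (sphere 0 1 \<inter> U) (f i)"
    and ind: "\<And>i x. i < k \<Longrightarrow> x \<in> sphere 0 1 \<inter> U \<Longrightarrow> f i x \<notin> span ((\<lambda>j. f j x) ` {..<i})"
  shows "\<exists>C. subspace C \<and> dim C \<le> k \<and>
    gl_equivalent (sphere 0 1 \<inter> U) (\<lambda>x. span ((\<lambda>i. f i x) ` {..<k})) (\<lambda>_. C)"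
  using dim f ind
proof (induction k)
  case 0
  show ?case
    by (intro exI[of _ "{0}"]) (simp add: gl_equivalent_refl)
next
  case (Suc k)
  let ?X = "sphere 0 1 \<inter> U"
  have X: "compact ?X" by (intro compact_Int_closed closed_subspace U compact_sphere)
  obtain C where C: "subspace C" "dim C \<le> k"
    and eq: "gl_equivalent ?X (\<lambda>x. span ((\<lambda>i. f i x) ` {..<k})) (\<lambda>_. C)"
    using Suc.IH Suc.prems by fastforce
  obtain A where A: "linear_family ?X A" and inj: "\<And>x. x \<in> ?X \<Longrightarrow> inj (A x)"
    and im: "\<And>x. x \<in> ?X \<Longrightarrow> A x ` span ((\<lambda>i. f i x) ` {..<k}) = C"
    using eq unfolding gl_equivalent_def by blast
  define g where "g = (\<lambda>x. A x (f k x))"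
  have gC: "g x \<notin> C" if "x \<in> ?X" for x
    using im[OF that] inj[OF that] Suc.prems(3)[of k x] that unfolding g_def
    by (metis inj_image_mem_iff lessI)
  have cg: "continuous_on ?X g"
    unfolding g_def by (intro linear_family_apply'[OF A] Suc.prems) simp
  have image: "A x ` span ((\<lambda>i. f i x) ` {..<Suc k}) = span (insert (g x) C)" if x: "x \<in> ?X" for x
  proof -
    have "A x ` span (insert (f k x) ((\<lambda>i. f i x) ` {..<k})) = span (insert (g x) (A x ` span ((\<lambda>i. f i x) ` {..<k})))"
      using linear_span_image[OF linear_family_linear[OF A x]] unfolding g_def
      by (metis image_insert span_insert_span)
    then show ?thesis by (simp add: lessThan_Suc im[OF x])
  qed
  obtain B where B: "B \<subseteq> C" "pairwise orthogonal B" "\<And>b. b \<in> B \<Longrightarrow> norm b = 1" "independent B"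
      "card B = dim C" "span B = C"
    using orthonormal_basis_subspace[OF C(1)] by metis
  have fB: "finite B" using B(4) by (simp add: independent_imp_finite)
  define r where "r = (\<lambda>v. \<Sum>b\<in>B. (v \<bullet> b) *\<^sub>R b)"
  have rC: "r v \<in> C" for v unfolding r_def using B(1) C(1) by (auto intro!: subspace_sum subspace_scale)
  have rorth: "v - r v \<in> orthogonal_comp C" for v
  proof -
    have "orthogonal (v - r v) b" if "b \<in> B" for b
    proof -
      have "r v \<bullet> b = (\<Sum>c\<in>B. (v \<bullet> c) * (c \<bullet> b))" by (simp add: r_def inner_sum_left)
      also have "\<dots> = (\<Sum>c\<in>B. if c = b then v \<bullet> b else 0)"
      proof (rule sum.cong[OF refl])
        fix c assume "c \<in> B"
        then show "(v \<bullet> c) * (c \<bullet> b) = (if c = b then v \<bullet> b else 0)"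
          using B(2) B(3)[OF that] \<open>b \<in> B\<close> by (auto simp: pairwise_def orthogonal_def norm_eq_1)
      qed
      also have "\<dots> = v \<bullet> b" using that fB by simp
      finally show ?thesis by (simp add: orthogonal_def inner_diff_left)
    qed
    then show ?thesis
      using orthogonal_to_span[of _ B "v - r v"] B(6) by (auto simp: orthogonal_comp_def orthogonal_commute)
  qed
  \<comment> \<open>Only \<open>g x\<close> modulo \<open>C\<close> and up to scale affects the
    span. Its normalized part orthogonal to \<open>C\<close> is a map between spheres.\<close>
  define h where "h = (\<lambda>x. (1 / norm (g x - r (g x))) *\<^sub>R (g x - r (g x)))"
  have ne: "g x - r (g x) \<noteq> 0" if "x \<in> ?X" for x using gC[OF that] rC[of "g x"] by auto
  have ch: "continuous_on ?X h"
    unfolding h_def r_def by (intro continuous_intros cg) (use ne in \<open>auto simp: r_def\<close>)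
  have him: "h \<in> ?X \<rightarrow> sphere 0 1 \<inter> orthogonal_comp C"
    using ne rorth by (auto simp: h_def subspace_orthogonal_comp subspace_scale)
  \<comment> \<open>The room for one more vector: \<open>dim U + Suc k\<close> is at most the
    ambient dimension, while \<open>dim C \<le> k\<close>.\<close>
  have "dim U < dim (orthogonal_comp C)"
  proof -
    have "dim (UNIV :: 'v set) \<le> dim C + dim (orthogonal_comp C)"
    proof -
      have "{x + y |x y. x \<in> C \<and> y \<in> orthogonal_comp C} = UNIV"
        using subspace_sum_orthogonal_comp[OF C(1)] unfolding set_plus_def by blast
      then show ?thesis
        using dim_sums_Int[OF C(1) subspace_orthogonal_comp[of C]] by simp
    qed
    then show ?thesis using Suc.prems(1) C(2) by simp
  qed
  then obtain c where "homotopic_with_canon (\<lambda>_. True) ?X (sphere 0 1 \<inter> orthogonal_comp C) h (\<lambda>_. c)"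
    using sphere_map_inessential[OF U subspace_orthogonal_comp _ ch him] by blast
  then obtain H :: "real \<times> 'b \<Rightarrow> 'v" where H: "continuous_on ({0..1} \<times> ?X) H" "H ` ({0..1} \<times> ?X) \<subseteq> sphere 0 1 \<inter> orthogonal_comp C"
      "\<And>x. H (0, x) = h x" "\<And>x. H (1, x) = c"
    unfolding homotopic_with_def by (auto simp: prod_topology_subtopology_eu)
  have "gl_equivalent ?X (\<lambda>x. span (insert (H (0, x)) C)) (\<lambda>x. span (insert (H (1, x)) C))"
  proof (rule gl_equivalent_insert_homotopy[OF X C(1), of "\<lambda>s x. H (s, x)"])
    show "continuous_on ({0..1} \<times> ?X) (\<lambda>z. H (fst z, snd z))" using H(1) by simp
    fix s :: real and x assume "s \<in> {0..1}" "x \<in> ?X"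
    then have "H (s, x) \<in> orthogonal_comp C" "norm (H (s, x)) = 1"
      using H(2) by (auto simp: image_subset_iff)
    then show "H (s, x) \<notin> C" by (auto simp: orthogonal_comp_def orthogonal_self)
  qed
  then have 2: "gl_equivalent ?X (\<lambda>x. span (insert (h x) C)) (\<lambda>_. span (insert c C))"
    by (simp add: H)
  have "span (insert (h x) C) = span (insert (g x) C)" if x: "x \<in> ?X" for x
  proof -
    let ?n = "1 / norm (g x - r (g x))"
    have "?n \<noteq> 0" using ne[OF x] by simp
    moreover have "h x \<in> span (insert (g x) C)"
      unfolding h_def using rC by (intro span_scale span_diff) (auto intro: span_base)
    moreover have "g x \<in> span (insert (h x) C)"
    proof -
      have "g x = norm (g x - r (g x)) *\<^sub>R h x + r (g x)" using ne[OF x] by (simp add: h_def)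
      then show ?thesis using rC[of "g x"] by (metis insertCI span_add span_base span_scale)
    qed
    ultimately show ?thesis
      by (intro antisym span_minimal) (auto intro: span_base)
  qed
  with 2 have "gl_equivalent ?X (\<lambda>x. span (insert (g x) C)) (\<lambda>_. span (insert c C))"
    by (intro gl_equivalent_trans[OF gl_equivalent_refl 2]) simp
  moreover have "gl_equivalent ?X (\<lambda>x. span ((\<lambda>i. f i x) ` {..<Suc k})) (\<lambda>x. span (insert (g x) C))"
    by (rule gl_equivalentI[OF A inj image])
  ultimately have "gl_equivalent ?X (\<lambda>x. span ((\<lambda>i. f i x) ` {..<Suc k})) (\<lambda>_. span (insert c C))"
    by (rule gl_equivalent_trans[rotated])
  moreover have "dim (span (insert c C)) \<le> Suc k"
    using C(2) by (simp add: dim_insert)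
  ultimately show ?case by blast
qed

section \<open>Tangent spaces of level sets\<close>

text \<open>The values of \<open>G\<close> lie in the image of the projection
  \<open>D = G' x\<close>. Hence \<open>F z = (z - x) - D (z - x) + G z\<close> has the identity as
  derivative at \<open>x\<close>, and \<open>D (F z) = G z\<close>. The preimage under
  \<open>F\<close> of the line of a vector \<open>y\<close> with \<open>D y = 0\<close> is
  therefore, near \<open>x\<close>, a curve of zeros of \<open>G\<close> with velocity
  \<open>y\<close>.\<close>

lemma tangent_space_level_set:
  fixes G :: "'v::euclidean_space \<Rightarrow> 'v" and G' :: "'v \<Rightarrow> 'v \<Rightarrow> 'v"
  assumes G: "\<And>z. (G has_derivative G' z) (at z)"
    and cont: "linear_family UNIV G'"
    and idem: "\<And>v. G' x (G' x v) = G' x v" and range: "\<And>z. G' x (G z) = G z"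
    and Gx: "G x = 0" and y: "G' x y = 0" and X: "\<And>z. G z = 0 \<Longrightarrow> z \<in> X"
  shows "y \<in> tangent_space X x"
proof -
  define D where "D = G' x"
  have linG: "linear (G' z)" for z using cont by (simp add: linear_family_def)
  have linD: "linear D" unfolding D_def by (rule linG)
  define F where "F = (\<lambda>z. (z - x) - D (z - x) + G z)"
  define F' where "F' = (\<lambda>z v. v - D v + G' z v)"
  have famF': "linear_family UNIV F'"
    unfolding F'_def
    by (rule linear_family_add[OF linear_family_diff[OF linear_family_id linear_family_const[OF linD]] cont])
  have linF': "linear (F' z)" for z using linear_family_linear[OF famF'] by simp
  have blF': "bounded_linear (F' z)" for z using linF' by (simp add: linear_conv_bounded_linear)
  have derF: "(F has_derivative F' z) (at z)" for z
  proof -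
    have D: "(D has_derivative D) (at (z - x))"
      using linD by (simp add: linear_conv_bounded_linear bounded_linear_imp_has_derivative)
    have id: "((\<lambda>z. z - x) has_derivative (\<lambda>v. v)) (at z)"
      using has_derivative_diff[OF has_derivative_ident has_derivative_const[of x]] by simp
    show ?thesis
      unfolding F_def F'_def
      by (rule has_derivative_add[OF has_derivative_diff[OF id has_derivative_compose[OF id D]] G])
  qed
  define B where "B = (\<lambda>z. Blinfun (F' z))"
  have B: "blinfun_apply (B z) = F' z" for z
    unfolding B_def using blF' by (simp add: bounded_linear_Blinfun_apply)
  have contB: "continuous_on UNIV B"
    by (rule continuous_on_blinfun_componentwise) (use famF' in \<open>simp add: B linear_family_def\<close>)
  have F'x: "F' x v = v" for v by (simp add: F'_def D_def)
  have id: "id_blinfun o\<^sub>L B x = id_blinfun"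
    by (rule blinfun_eqI) (simp add: B F'x)
  have derF': "(F has_derivative blinfun_apply (B z)) (at z)" if "z \<in> UNIV" for z
    using derF by (simp add: B)
  obtain U V g g' where UV: "open U" "x \<in> U" "open V" "F x \<in> V" and hom: "homeomorphism U V F g"
    and g: "\<And>w. w \<in> V \<Longrightarrow> (g has_derivative g' w) (at w)"
    and g': "\<And>w. w \<in> V \<Longrightarrow> g' w = inv (blinfun_apply (B (g w)))"
    and bij: "\<And>w. w \<in> V \<Longrightarrow> bij (blinfun_apply (B (g w)))"
  proof (rule inverse_function_theorem[OF open_UNIV derF' contB UNIV_I id])
    fix U V g g'
    assume "open U" "x \<in> U" "open V" "F x \<in> V" "homeomorphism U V F g"
      "\<And>w. w \<in> V \<Longrightarrow> (g has_derivative g' w) (at w)"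
      "\<And>w. w \<in> V \<Longrightarrow> g' w = inv (blinfun_apply (B (g w)))"
      "\<And>w. w \<in> V \<Longrightarrow> bij (blinfun_apply (B (g w)))"
    then show thesis by (rule that)
  qed
  have Fx: "F x = 0" using linear_0[OF linD] by (simp add: F_def Gx)
  have contg: "continuous_on V g" using hom by (simp add: homeomorphism_def)
  have gx: "g 0 = x" using homeomorphism_apply1[OF hom \<open>x \<in> U\<close>] Fx by simp
  \<comment> \<open>A closed ball has a compact image under \<open>g\<close>, over which the
    derivatives of \<open>F\<close> are uniformly invertible. This gives the continuity of the
    velocity of the curve.\<close>
  obtain r where r: "r > 0" "cball 0 r \<subseteq> V" using open_contains_cball_eq[OF \<open>open V\<close>] \<open>F x \<in> V\<close> Fx by auto
  let ?K = "g ` cball 0 r"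
  have K: "compact ?K" by (rule compact_continuous_image[OF continuous_on_subset[OF contg r(2)] compact_cball])
  have injF': "inj_on (F' z) UNIV" if z: "z \<in> ?K" for z
  proof -
    obtain w where "w \<in> cball 0 r" "z = g w" using z by blast
    then have "bij (F' z)" using bij[of w] r(2) by (auto simp: B)
    then show ?thesis by (rule bij_is_inj)
  qed
  obtain c where c: "c > 0" "\<And>z v. z \<in> ?K \<Longrightarrow> v \<in> UNIV \<Longrightarrow> c * norm v \<le> norm (F' z v)"
  proof (rule linear_family_lower_bound[OF linear_family_subset[OF famF' subset_UNIV] K subspace_UNIV injF'])
    fix c assume "0 < c" "\<And>z v. z \<in> ?K \<Longrightarrow> v \<in> UNIV \<Longrightarrow> c * norm v \<le> norm (F' z v)"
    then show thesis by (rule that)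
  qed
  \<comment> \<open>Keeps \<open>t *\<^sub>R y\<close> in the ball; the added 1 covers
    \<open>y = 0\<close>.\<close>
  define e where "e = r / (norm y + 1)"
  have e: "e > 0" using r(1) by (simp add: e_def add_nonneg_pos)
  let ?J = "{-e<..<e}"
  have tV: "t *\<^sub>R y \<in> cball 0 r" if "t \<in> ?J" for t
  proof -
    have "\<bar>t\<bar> * norm y \<le> e * (norm y + 1)" using that by (intro mult_mono) auto
    also have "\<dots> = r" by (simp add: e_def add_nonneg_eq_0_iff)
    finally show ?thesis by simp
  qed
  define \<gamma> where "\<gamma> = (\<lambda>t. g (t *\<^sub>R y))"
  define d where "d = (\<lambda>t. g' (t *\<^sub>R y) y)"
  have der: "(\<gamma> has_vector_derivative d t) (at t)" if "t \<in> ?J" for t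
  proof -
    have "((\<lambda>t. t *\<^sub>R y) has_derivative (\<lambda>h. h *\<^sub>R y)) (at t)" by (auto intro!: derivative_eq_intros)
    moreover have gd: "(g has_derivative g' (t *\<^sub>R y)) (at (t *\<^sub>R y))" using g tV[OF that] r(2) by blast
    ultimately have "(\<gamma> has_derivative (\<lambda>h. g' (t *\<^sub>R y) (h *\<^sub>R y))) (at t)"
      unfolding \<gamma>_def by (rule has_derivative_compose)
    then show ?thesis
      unfolding has_vector_derivative_def d_def
      using linear_scale[OF has_derivative_linear[OF gd]] by simp
  qed
  have F'd: "F' (\<gamma> t) (d t) = y" if "t \<in> ?J" for t
  proof -
    have tv: "t *\<^sub>R y \<in> V" using tV[OF that] r(2) by blast
    then show ?thesis
      using g'[OF tv] bij[OF tv] unfolding d_def \<gamma>_def B by (metis bij_inv_eq_iff)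
  qed
  have \<gamma>K: "\<gamma> \<in> ?J \<rightarrow> ?K" using tV by (auto simp: \<gamma>_def)
  have cont\<gamma>: "continuous_on ?J \<gamma>"
    unfolding \<gamma>_def by (rule continuous_on_compose2[OF contg]) (use tV r(2) in \<open>auto intro!: continuous_intros\<close>)
  have contd: "continuous_on ?J d"
  proof (rule linear_family_inverse_continuous[OF linear_family_subset[OF famF'] subspace_UNIV c cont\<gamma> \<gamma>K])
    show "continuous_on ?J (\<lambda>t. F' (\<gamma> t) (d t))"
      by (rule continuous_on_eq[of _ "\<lambda>_. y"]) (simp_all add: F'd)
  qed auto
  have G\<gamma>: "G (\<gamma> t) = 0" if "t \<in> ?J" for t
  proof -
    have "F (\<gamma> t) = t *\<^sub>R y"
      using hom tV[OF that] r(2) unfolding \<gamma>_def by (metis homeomorphism_apply2 subsetD)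
    then have "D (F (\<gamma> t)) = 0" using y linear_scale[OF linD] by (simp add: D_def)
    moreover have "D (F (\<gamma> t)) = G (\<gamma> t)"
      using idem range by (simp add: F_def linear_add[OF linD] linear_diff[OF linD]) (simp add: D_def)
    ultimately show ?thesis by simp
  qed
  have d0: "d 0 = y" using F'd[of 0] e F'x by (simp add: \<gamma>_def gx)
  show ?thesis
    unfolding tangent_space_def mem_Collect_eq
  proof (intro exI[of _ \<gamma>] exI[of _ e] conjI e)
    show "\<gamma> C1_differentiable_on ?J"
      unfolding C1_differentiable_on_def using der contd by blast
    show "\<gamma> ` ?J \<subseteq> X" using G\<gamma> X by blast
    show "\<gamma> 0 = x" by (simp add: \<gamma>_def gx)
    show "(\<gamma> has_vector_derivative y) (at 0)" using der[of 0] e d0 by simp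
  qed
qed

text \<open>Chain rule along a curve in \<open>X\<close>, on which \<open>h\<close> is constant. It
  bounds tangent spaces from above, as \<open>tangent_space_level_set\<close> does from
  below.\<close>

lemma tangent_space_derivative_eq_0:
  fixes X :: "'v::euclidean_space set" and h :: "'v \<Rightarrow> 'w::real_normed_vector"
  assumes v: "v \<in> tangent_space X x" and h: "(h has_derivative h') (at x)"
    and const: "\<And>z. z \<in> X \<Longrightarrow> h z = c"
  shows "h' v = 0"
proof -
  obtain \<gamma> e where e: "e > 0" "\<gamma> ` {-e<..<e} \<subseteq> X" "\<gamma> 0 = x" and der: "(\<gamma> has_vector_derivative v) (at (0::real))"
    using v unfolding tangent_space_def by blast
  have "(h has_derivative h') (at (\<gamma> 0))" using h e by simp
  from has_derivative_compose[OF der[unfolded has_vector_derivative_def] this]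
  have 1: "((\<lambda>t. h (\<gamma> t)) has_derivative (\<lambda>t. h' (t *\<^sub>R v))) (at 0)" .
  have "((\<lambda>t. h (\<gamma> t)) has_derivative (\<lambda>t. 0)) (at 0)"
  proof (rule has_derivative_transform_within_open[of "\<lambda>_. c"])
    show "open {-e<..<e}" "0 \<in> {-e<..<e}" using e by auto
    show "c = h (\<gamma> t)" if "t \<in> {-e<..<e}" for t using const e(2) that by (metis image_subset_iff)
  qed simp
  from has_derivative_unique[OF 1 this] have "h' (1 *\<^sub>R v) = 0" by meson
  then show ?thesis by simp
qed

lemma notin_span_orthogonal:
  assumes "v \<noteq> 0" "\<And>b. b \<in> B \<Longrightarrow> v \<bullet> b = 0"
  shows "v \<notin> span B"
proof
  assume "v \<in> span B"
  then have "orthogonal v v"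
    by (rule orthogonal_to_span) (use assms in \<open>simp add: orthogonal_def\<close>)
  then show False using assms(1) by (simp add: orthogonal_self)
qed

lemma orthogonal_comp_span: "orthogonal_comp (span B) = {v. \<forall>b\<in>B. v \<bullet> b = 0}"
proof -
  have "v \<bullet> y = 0" if "\<forall>b\<in>B. v \<bullet> b = 0" "y \<in> span B" for v y
    using orthogonal_to_span[OF that(2), of v] that(1) by (simp add: orthogonal_def)
  then show ?thesis
    unfolding orthogonal_comp_def orthogonal_def by (auto simp: inner_commute intro: span_base)
qed

section \<open>Algebra of a Clifford system\<close>

locale clifford_system =
  fixes P :: "nat \<Rightarrow> real^'n^'n" and m l :: nat
  assumes card: "CARD('n) = 2 * l" and m_pos: "m > 0" and l_gt: "l > m + 1"
    and sys: "symmetric_Clifford_system m P"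
begin

abbreviation p :: "nat \<Rightarrow> real^'n \<Rightarrow> real^'n" where "p \<alpha> x \<equiv> P \<alpha> *v x"

lemma p_linear [simp, intro]: "linear (p \<alpha>)" by (rule matrix_vector_mul_linear)

lemma p_continuous [continuous_intros]: "continuous_on X f \<Longrightarrow> continuous_on X (\<lambda>x. p \<alpha> (f x))"
  by (rule bounded_linear.continuous_on) (simp_all add: linear_conv_bounded_linear[symmetric])

lemmas p_simps = linear_add[OF p_linear] linear_diff[OF p_linear] linear_neg[OF p_linear]
  linear_scale[OF p_linear] linear_0[OF p_linear]

lemma p_sym: "\<alpha> \<le> m \<Longrightarrow> p \<alpha> x \<bullet> y = x \<bullet> p \<alpha> y"
  using sys unfolding symmetric_Clifford_system_def
  by (metis dot_lmul_matrix transpose_matrix_vector)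

lemma p_p: 
  assumes "\<alpha> \<le> m" "\<beta> \<le> m"
  shows "p \<alpha> (p \<beta> x) + p \<beta> (p \<alpha> x) = (if \<alpha> = \<beta> then 2 else 0) *\<^sub>R x"
proof -
  have "(P \<alpha> ** P \<beta> + P \<beta> ** P \<alpha>) *v x = ((if \<alpha> = \<beta> then 2 else 0) *\<^sub>R mat 1) *v x"
    using sys assms unfolding symmetric_Clifford_system_def by simp
  then show ?thesis
    by (simp add: matrix_vector_mult_add_rdistrib matrix_vector_mul_assoc scaleR_matrix_vector_assoc[symmetric])
qed

lemma p_sq: assumes "\<alpha> \<le> m" shows "p \<alpha> (p \<alpha> x) = x"
proof -
  have "2 *\<^sub>R p \<alpha> (p \<alpha> x) = 2 *\<^sub>R x" using p_p[OF assms assms, of x] by (simp add: scaleR_2)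
  then show ?thesis by simp
qed

lemma p_anti: "\<alpha> \<le> m \<Longrightarrow> \<beta> \<le> m \<Longrightarrow> \<alpha> \<noteq> \<beta> \<Longrightarrow> p \<alpha> (p \<beta> x) = - p \<beta> (p \<alpha> x)"
  using p_p[of \<alpha> \<beta> x] by (simp add: eq_neg_iff_add_eq_0)

lemma p_inner: "\<alpha> \<le> m \<Longrightarrow> p \<alpha> x \<bullet> p \<alpha> y = x \<bullet> y"
  by (simp add: p_sym p_sq)

lemma p_orth: 
  assumes "\<alpha> \<le> m" "\<beta> \<le> m" "\<alpha> \<noteq> \<beta>" shows "p \<alpha> x \<bullet> p \<beta> x = 0"
proof -
  have "p \<alpha> x \<bullet> p \<beta> x = x \<bullet> p \<alpha> (p \<beta> x)" using assms by (simp add: p_sym)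
  also have "\<dots> = - (x \<bullet> p \<beta> (p \<alpha> x))" using assms by (simp add: p_anti[of \<alpha> \<beta>])
  also have "\<dots> = - (p \<beta> x \<bullet> p \<alpha> x)" using assms by (simp add: p_sym)
  finally show ?thesis by (simp add: inner_commute)
qed

lemma p_orth': "\<alpha> \<le> m \<Longrightarrow> \<beta> \<le> m \<Longrightarrow> p \<alpha> x \<bullet> p \<beta> x = (if \<alpha> = \<beta> then x \<bullet> x else 0)"
  by (simp add: p_orth p_inner)

text \<open>Coefficient functions on \<open>nat\<close> stand for elements of the span of the
  system; only their values up to \<open>m\<close> matter.\<close>

definition op :: "(nat \<Rightarrow> real) \<Rightarrow> real^'n \<Rightarrow> real^'n"
  where "op c x = (\<Sum>\<alpha>\<le>m. c \<alpha> *\<^sub>R p \<alpha> x)"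

lemma op_linear: "linear (op c)"
  unfolding op_def by (intro linear_compose_sum ballI linear_compose_scale_right) simp_all

lemma op_scale_coeff: "op (\<lambda>\<alpha>. r * c \<alpha>) x = r *\<^sub>R op c x"
  by (simp add: op_def scaleR_sum_right)

lemma op_add_coeff: "op (\<lambda>\<alpha>. c \<alpha> + d \<alpha>) x = op c x + op d x"
  by (simp add: op_def scaleR_add_left sum.distrib)

lemma op_cong: "(\<And>\<alpha>. \<alpha> \<le> m \<Longrightarrow> c \<alpha> = d \<alpha>) \<Longrightarrow> op c x = op d x"
  by (simp add: op_def)

lemma op_sym: "op c x \<bullet> y = x \<bullet> op c y"
  by (simp add: op_def inner_sum_left inner_sum_right p_sym)

lemma op_inner_p: "\<alpha> \<le> m \<Longrightarrow> op c x \<bullet> p \<alpha> x = c \<alpha> * (x \<bullet> x)"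
proof -
  assume a: "\<alpha> \<le> m"
  have "op c x \<bullet> p \<alpha> x = (\<Sum>\<beta>\<le>m. c \<beta> * (p \<beta> x \<bullet> p \<alpha> x))" by (simp add: op_def inner_sum_left)
  also have "\<dots> = (\<Sum>\<beta>\<le>m. if \<beta> = \<alpha> then c \<alpha> * (x \<bullet> x) else 0)"
    using a by (intro sum.cong refl) (simp add: p_orth')
  finally show ?thesis using a by simp
qed

lemma op_inner_op: "op c x \<bullet> op d x = (\<Sum>\<alpha>\<le>m. c \<alpha> * d \<alpha>) * (x \<bullet> x)"
proof -
  have "op c x \<bullet> op d x = (\<Sum>\<alpha>\<le>m. d \<alpha> * (op c x \<bullet> p \<alpha> x))"
    by (simp add: op_def[of d] inner_sum_right)
  then show ?thesis by (simp add: op_inner_p sum_distrib_left mult_ac)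
qed

text \<open>The Clifford relations extended bilinearly to the span: orthogonal elements anticommute
  and unit elements are involutions.\<close>

lemma op_anticommutator: "op c (op d x) + op d (op c x) = (2 * (\<Sum>\<alpha>\<le>m. c \<alpha> * d \<alpha>)) *\<^sub>R x"
proof -
  have expand: "op a (op b x) = (\<Sum>\<alpha>\<le>m. \<Sum>\<beta>\<le>m. (a \<alpha> * b \<beta>) *\<^sub>R p \<alpha> (p \<beta> x))" for a b
    by (simp add: op_def linear_sum[OF p_linear] linear_scale[OF p_linear] scaleR_sum_right)
  have "op d (op c x) = (\<Sum>\<alpha>\<le>m. \<Sum>\<beta>\<le>m. (c \<alpha> * d \<beta>) *\<^sub>R p \<beta> (p \<alpha> x))"
    unfolding expand by (subst sum.swap) (simp add: mult.commute)
  then have "op c (op d x) + op d (op c x) =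
      (\<Sum>\<alpha>\<le>m. \<Sum>\<beta>\<le>m. (c \<alpha> * d \<beta>) *\<^sub>R (p \<alpha> (p \<beta> x) + p \<beta> (p \<alpha> x)))"
    unfolding expand by (simp add: sum.distrib scaleR_add_right)
  also have "\<dots> = (\<Sum>\<alpha>\<le>m. \<Sum>\<beta>\<le>m. if \<alpha> = \<beta> then (2 * (c \<alpha> * d \<alpha>)) *\<^sub>R x else 0)"
    by (intro sum.cong refl) (simp add: p_p)
  also have "\<dots> = (\<Sum>\<alpha>\<le>m. (2 * (c \<alpha> * d \<alpha>)) *\<^sub>R x)"
    by (intro sum.cong refl) simp
  finally show ?thesis by (simp add: scaleR_sum_left sum_distrib_left)
qed

lemma op_sq: "op c (op c x) = (\<Sum>\<alpha>\<le>m. (c \<alpha>)\<^sup>2) *\<^sub>R x"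
proof -
  have "2 *\<^sub>R op c (op c x) = 2 *\<^sub>R ((\<Sum>\<alpha>\<le>m. (c \<alpha>)\<^sup>2) *\<^sub>R x)"
    using op_anticommutator[of c c x] by (simp only: scaleR_2[symmetric] scaleR_scaleR power2_eq_square)
  then show ?thesis by (simp only: scaleR_cancel_left) auto
qed

text \<open>For \<open>x\<close> in \<open>M\<^sub>-\<close> these are the coefficients of the
  unique element of the Clifford sphere fixing \<open>x\<close>. On \<open>M\<close> the vectors
  \<open>x\<close> and \<open>op (coeff x) x\<close> span the normal plane.\<close>

definition coeff :: "real^'n \<Rightarrow> nat \<Rightarrow> real"
  where "coeff x \<alpha> = p \<alpha> x \<bullet> x"

lemma sum_coeff_sq: "(\<Sum>\<alpha>\<le>m. (coeff x \<alpha>)\<^sup>2) = op (coeff x) x \<bullet> x"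
  by (simp add: op_def coeff_def inner_sum_left power2_eq_square)

lemma level_iff: "x \<in> OT_FKM_level m P t \<longleftrightarrow> norm x = 1 \<and> (\<Sum>\<alpha>\<le>m. (coeff x \<alpha>)\<^sup>2) = (1 - t) / 2"
  by (auto simp: OT_FKM_level_def OT_FKM_poly_def coeff_def)

lemma focal_plus_iff: "x \<in> focal_plus m P \<longleftrightarrow> norm x = 1 \<and> (\<forall>\<alpha>\<le>m. coeff x \<alpha> = 0)"
  unfolding level_iff by (auto simp: sum_nonneg_eq_0_iff)

text \<open>Equality in the Cauchy-Schwarz inequality: if the squares of the coefficients sum to 1,
  then \<open>op (coeff x) x\<close> and \<open>x\<close> are unit vectors with inner product
  1.\<close>

lemma focal_minus_iff: 
  "x \<in> focal_minus m P \<longleftrightarrow> norm x = 1 \<and> op (coeff x) x = x"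
proof -
  have "op (coeff x) x = x" if x: "norm x = 1" and s: "(\<Sum>\<alpha>\<le>m. (coeff x \<alpha>)\<^sup>2) = 1"
  proof -
    have "op (coeff x) x \<bullet> x = 1" "op (coeff x) x \<bullet> op (coeff x) x = 1" "x \<bullet> x = 1"
      using s x sum_coeff_sq[of x] op_inner_op[of "coeff x" x "coeff x"] by (simp_all add: norm_eq_1 power2_eq_square)
    then have "(op (coeff x) x - x) \<bullet> (op (coeff x) x - x) = 0"
      by (simp add: inner_diff_left inner_diff_right inner_commute)
    then show ?thesis by simp
  qed
  moreover have "(\<Sum>\<alpha>\<le>m. (coeff x \<alpha>)\<^sup>2) = 1" if "norm x = 1" "op (coeff x) x = x"
    using that sum_coeff_sq[of x] by (simp add: norm_eq_1)
  ultimately show ?thesis unfolding level_iff by auto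
qed

text \<open>The vectors \<open>p \<alpha> x\<close> are orthonormal, so pairing
  \<open>op c x\<close> with \<open>p \<alpha> x\<close> isolates \<open>c \<alpha>\<close>. This is
  the uniqueness of the element fixing \<open>x\<close>.\<close>

lemma coeff_eqI:
  assumes "norm x = 1" "op c x = x" "\<alpha> \<le> m"
  shows "coeff x \<alpha> = c \<alpha>"
  using op_inner_p[OF assms(3), of c x] assms by (simp add: coeff_def norm_eq_1 inner_commute)

lemma focal_minusI:
  assumes "norm x = 1" "op c x = x"
  shows "x \<in> focal_minus m P"
  using assms op_cong[of "coeff x" c x] coeff_eqI[OF assms] by (simp add: focal_minus_iff)

lemma coeff_continuous [continuous_intros]: "continuous_on X f \<Longrightarrow> continuous_on X (\<lambda>x. coeff (f x) \<alpha>)"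
  unfolding coeff_def by (intro continuous_intros)

lemma level_compact: "compact (OT_FKM_level m P t)"
proof -
  have "OT_FKM_level m P t = sphere 0 1 \<inter> {x. (\<Sum>\<alpha>\<le>m. (coeff x \<alpha>)\<^sup>2) = (1 - t) / 2}"
    by (auto simp: level_iff)
  moreover have "closed {x. (\<Sum>\<alpha>\<le>m. (coeff x \<alpha>)\<^sup>2) = (1 - t) / 2}"
    by (intro closed_Collect_eq continuous_intros)
  ultimately show ?thesis by (simp add: compact_Int_closed)
qed

section \<open>Tangent spaces of the levels and of the focal submanifolds\<close>

lemma coeff_derivative:
  assumes "\<alpha> \<le> m"
  shows "((\<lambda>x. coeff x \<alpha>) has_derivative (\<lambda>v. 2 * (p \<alpha> z \<bullet> v))) (at z)"
proof -
  have "(p \<alpha> has_derivative p \<alpha>) (at z)"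
    by (simp add: bounded_linear_imp_has_derivative linear_conv_bounded_linear[symmetric])
  then have "((\<lambda>x. coeff x \<alpha>) has_derivative (\<lambda>v. p \<alpha> z \<bullet> v + p \<alpha> v \<bullet> z)) (at z)"
    unfolding coeff_def by (auto intro!: derivative_eq_intros)
  moreover have "p \<alpha> v \<bullet> z = p \<alpha> z \<bullet> v" for v using p_sym[OF assms] by (simp add: inner_commute)
  ultimately show ?thesis by simp
qed

lemma op_coeff_inner: "op c x \<bullet> x = (\<Sum>\<alpha>\<le>m. c \<alpha> * coeff x \<alpha>)"
  by (simp add: op_def coeff_def inner_sum_left)

lemma op_derivative:
  "((\<lambda>z. op (coeff z) x) has_derivative (\<lambda>v. op (\<lambda>\<alpha>. 2 * (p \<alpha> z \<bullet> v)) x)) (at z)"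
  unfolding op_def by (intro has_derivative_sum has_derivative_scaleR_left coeff_derivative) simp

lemma inner_self_derivative: "((\<lambda>z. z \<bullet> z) has_derivative (\<lambda>v. 2 * (z \<bullet> v))) (at (z :: real^'n))"
  by (auto intro!: derivative_eq_intros simp: inner_commute)

lemma op_coeff_family:
  assumes "\<And>v w \<alpha>. c (v + w) \<alpha> = c v \<alpha> + c w \<alpha>" "\<And>r v \<alpha>. c (r *\<^sub>R v) \<alpha> = r * c v \<alpha>"
  shows "linear (\<lambda>v. op (c v) x)"
  by (rule linearI) (simp_all add: op_def assms scaleR_add_left sum.distrib scaleR_sum_right)

text \<open>On \<open>M\<^sub>+\<close> the vectors \<open>x, p 0 x, ..., p m x\<close> are
  orthonormal. The halved defining equations, used as coefficients of these vectors, form a map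
  \<open>G\<close> whose derivative at \<open>x\<close> is the orthogonal projection to their
  span.\<close>

lemma tangent_space_focal_plus:
  assumes x: "x \<in> focal_plus m P"
  shows "tangent_space (focal_plus m P) x = orthogonal_comp (span (insert x ((\<lambda>\<alpha>. p \<alpha> x) ` {..m})))"
    (is "?T = ?N")
proof
  have x1: "x \<bullet> x = 1" and xc: "\<And>\<alpha>. \<alpha> \<le> m \<Longrightarrow> coeff x \<alpha> = 0"
    using x by (simp_all add: focal_plus_iff norm_eq_1)
  show "?T \<subseteq> ?N"
  proof
    fix v assume v: "v \<in> ?T"
    have "2 * (x \<bullet> v) = 0"
      by (rule tangent_space_derivative_eq_0[OF v inner_self_derivative])
         (auto simp: focal_plus_iff norm_eq_1)
    moreover have "2 * (p \<alpha> x \<bullet> v) = 0" if "\<alpha> \<le> m" for \<alpha>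
      by (rule tangent_space_derivative_eq_0[OF v coeff_derivative[OF that]])
         (use that in \<open>auto simp: focal_plus_iff\<close>)
    ultimately show "v \<in> ?N" by (auto simp: orthogonal_comp_span inner_commute)
  qed
  show "?N \<subseteq> ?T"
  proof
    fix v assume v: "v \<in> ?N"
    then have vx: "x \<bullet> v = 0" and vp: "\<And>\<alpha>. \<alpha> \<le> m \<Longrightarrow> p \<alpha> x \<bullet> v = 0"
      by (auto simp: orthogonal_comp_span inner_commute)
    define G where "G = (\<lambda>z. ((z \<bullet> z - 1) / 2) *\<^sub>R x + (1/2) *\<^sub>R op (coeff z) x)"
    define G' where "G' = (\<lambda>z v. (z \<bullet> v) *\<^sub>R x + op (\<lambda>\<alpha>. p \<alpha> z \<bullet> v) x)"
    have fixed: "G' x (a *\<^sub>R x + op c x) = a *\<^sub>R x + op c x" for a c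
    proof -
      have "x \<bullet> op c x = 0"
        using op_coeff_inner[of c x] xc by (simp add: inner_commute)
      moreover have "p \<alpha> x \<bullet> (a *\<^sub>R x + op c x) = c \<alpha>" if "\<alpha> \<le> m" for \<alpha>
        using op_inner_p[OF that, of c x] xc[OF that] x1 by (simp add: inner_add_right coeff_def inner_commute)
      ultimately show ?thesis
        using x1 op_cong[of "\<lambda>\<alpha>. p \<alpha> x \<bullet> (a *\<^sub>R x + op c x)" c] by (simp add: G'_def inner_add_right)
    qed
    show "v \<in> ?T"
    proof (rule tangent_space_level_set[of G G'])
      fix z
      have "(G has_derivative (\<lambda>v. ((2 * (z \<bullet> v)) / 2) *\<^sub>R x + (1/2) *\<^sub>R op (\<lambda>\<alpha>. 2 * (p \<alpha> z \<bullet> v)) x)) (at z)"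
        unfolding G_def
        by (intro has_derivative_add has_derivative_scaleR_left has_derivative_scaleR_right op_derivative)
           (auto intro!: derivative_eq_intros simp: inner_commute)
      moreover have "(\<lambda>v. ((2 * (z \<bullet> v)) / 2) *\<^sub>R x + (1/2) *\<^sub>R op (\<lambda>\<alpha>. 2 * (p \<alpha> z \<bullet> v)) x) = G' z"
        by (simp add: G'_def op_scale_coeff)
      ultimately show "(G has_derivative G' z) (at z)" by simp
    next
      show "linear_family UNIV G'"
        unfolding G'_def
      proof (intro linear_family_add linear_familyI)
        show "linear (\<lambda>v. (z \<bullet> v) *\<^sub>R x)" for z
          by (rule linearI) (simp_all add: inner_add_right scaleR_add_left)
        show "linear (\<lambda>v. op (\<lambda>\<alpha>. p \<alpha> z \<bullet> v) x)" for z
          by (rule op_coeff_family) (simp_all add: inner_add_right)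
      qed (auto simp: op_def intro!: continuous_intros)
    next
      show "G' x (G' x w) = G' x w" for w
        using fixed[of "x \<bullet> w" "\<lambda>\<alpha>. p \<alpha> x \<bullet> w"] by (simp add: G'_def)
      show "G' x (G z) = G z" for z
        using fixed[of "(z \<bullet> z - 1) / 2" "\<lambda>\<alpha>. (1/2) * coeff z \<alpha>"] by (simp only: G_def op_scale_coeff)
      show "G x = 0" using xc x1 by (simp add: G_def op_def)
      show "G' x v = 0" using vx vp by (simp add: G'_def op_def)
      fix z assume z: "G z = 0"
      have "G z \<bullet> x = (z \<bullet> z - 1) / 2"
        using x1 xc by (simp add: G_def inner_add_left op_coeff_inner)
      then have "z \<bullet> z = 1" using z by simp
      moreover have "coeff z \<alpha> = 0" if "\<alpha> \<le> m" for \<alpha>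
      proof -
        have "x \<bullet> p \<alpha> x = 0" using xc[OF that] by (simp add: coeff_def inner_commute)
        then have "G z \<bullet> p \<alpha> x = (1/2) * coeff z \<alpha>"
          using op_inner_p[OF that, of "coeff z" x] x1 by (simp add: G_def inner_add_left)
        then show ?thesis using z by simp
      qed
      ultimately show "z \<in> focal_plus m P" by (simp add: focal_plus_iff norm_eq_1)
    qed
  qed
qed

lemma tangent_space_level:
  assumes x: "x \<in> OT_FKM_level m P t" and t: "-1 < t" "t < 1"
  shows "tangent_space (OT_FKM_level m P t) x = orthogonal_comp (span {x, op (coeff x) x})"
    (is "?T = ?N")
proof
  define a where "a = (1 - t) / 2"
  have a: "0 < a" "a < 1" using t by (auto simp: a_def)
  let ?B = "op (coeff x) x"
  have x1: "x \<bullet> x = 1" and xR: "(\<Sum>\<alpha>\<le>m. (coeff x \<alpha>)\<^sup>2) = a"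
    using x by (simp_all add: level_iff norm_eq_1 a_def)
  have xB: "x \<bullet> ?B = a" "?B \<bullet> x = a" and BB: "?B \<bullet> ?B = a"
    using xR sum_coeff_sq[of x] op_inner_op[of "coeff x" x "coeff x"] x1
    by (simp_all add: inner_commute power2_eq_square)
  define R where "R = (\<lambda>z. \<Sum>\<alpha>\<le>m. (coeff z \<alpha>)\<^sup>2)"
  have derR: "(R has_derivative (\<lambda>v. 4 * (op (coeff z) z \<bullet> v))) (at z)" for z
  proof -
    have "(R has_derivative (\<lambda>v. \<Sum>\<alpha>\<le>m. 2 * (2 * (p \<alpha> z \<bullet> v)) * coeff z \<alpha>)) (at z)"
      unfolding R_def
      by (intro has_derivative_sum) (auto intro!: derivative_eq_intros coeff_derivative)
    moreover have "(\<lambda>v. \<Sum>\<alpha>\<le>m. 2 * (2 * (p \<alpha> z \<bullet> v)) * coeff z \<alpha>) = (\<lambda>v. 4 * (op (coeff z) z \<bullet> v))"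
      by (auto simp: op_def inner_sum_left sum_distrib_left algebra_simps intro!: sum.cong)
    ultimately show ?thesis by simp
  qed
  have memb: "z \<in> OT_FKM_level m P t \<longleftrightarrow> z \<bullet> z = 1 \<and> R z = a" for z
    by (simp add: level_iff norm_eq_1 R_def a_def)
  show "?T \<subseteq> ?N"
  proof
    fix v assume v: "v \<in> ?T"
    have "2 * (x \<bullet> v) = 0"
      by (rule tangent_space_derivative_eq_0[OF v inner_self_derivative]) (auto simp: memb)
    moreover have "4 * (?B \<bullet> v) = 0"
      by (rule tangent_space_derivative_eq_0[OF v derR]) (auto simp: memb)
    ultimately show "v \<in> ?N" by (simp add: orthogonal_comp_span inner_commute)
  qed
  show "?N \<subseteq> ?T"
  proof
    fix v assume v: "v \<in> ?N"
    then have vx: "x \<bullet> v = 0" and vB: "?B \<bullet> v = 0"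
      by (auto simp: orthogonal_comp_span inner_commute)
    \<comment> \<open>\<open>b\<close> and \<open>b'\<close> form the dual basis of \<open>x\<close>
      and \<open>?B\<close> in their plane, whose Gram determinant is \<open>a * (1 - a)\<close>.
      With them the derivative of \<open>G\<close> at \<open>x\<close> is a projection, although the
      two normal vectors are not orthogonal.\<close>
    define b where "b = (1 / (1 - a)) *\<^sub>R (x - ?B)"
    define b' where "b' = (1 / (a * (1 - a))) *\<^sub>R (?B - a *\<^sub>R x)"
    have dual: "x \<bullet> b = 1" "?B \<bullet> b = 0" "x \<bullet> b' = 0" "?B \<bullet> b' = 1"
      using a x1 xB BB by (simp_all add: b_def b'_def inner_diff_right) (simp add: field_simps)
    define G where "G = (\<lambda>z. ((z \<bullet> z - 1) / 2) *\<^sub>R b + ((R z - a) / 4) *\<^sub>R b')"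
    define G' where "G' = (\<lambda>z v. (z \<bullet> v) *\<^sub>R b + (op (coeff z) z \<bullet> v) *\<^sub>R b')"
    have fixed: "G' x (r *\<^sub>R b + s *\<^sub>R b') = r *\<^sub>R b + s *\<^sub>R b'" for r s
      by (simp add: G'_def inner_add_right dual)
    show "v \<in> ?T"
    proof (rule tangent_space_level_set[of G G'])
      fix z
      have "(G has_derivative (\<lambda>v. ((2 * (z \<bullet> v)) / 2) *\<^sub>R b + ((4 * (op (coeff z) z \<bullet> v)) / 4) *\<^sub>R b')) (at z)"
        unfolding G_def
        by (intro has_derivative_add has_derivative_scaleR_left)
           (auto intro!: derivative_eq_intros derR simp: inner_commute)
      then show "(G has_derivative G' z) (at z)" by (simp add: G'_def)
    next
      show "linear_family UNIV G'"
        unfolding G'_def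
      proof (intro linear_family_add linear_familyI)
        show "linear (\<lambda>v. (w \<bullet> v) *\<^sub>R u)" for w u :: "real^'n"
          by (rule linearI) (simp_all add: inner_add_right scaleR_add_left)
        show "linear (\<lambda>v. (w \<bullet> v) *\<^sub>R u)" for w u :: "real^'n"
          by (rule linearI) (simp_all add: inner_add_right scaleR_add_left)
      qed (auto simp: op_def intro!: continuous_intros)
    next
      show "G' x (G' x w) = G' x w" for w
        using fixed by (simp add: G'_def)
      show "G' x (G z) = G z" for z
        using fixed by (simp add: G_def)
      show "G x = 0" using xR x1 by (simp add: G_def R_def)
      show "G' x v = 0" using vx vB by (simp add: G'_def)
      fix z assume z: "G z = 0"
      have "x \<bullet> G z = (z \<bullet> z - 1) / 2" "?B \<bullet> G z = (R z - a) / 4"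
        by (simp_all add: G_def inner_add_right dual)
      then show "z \<in> OT_FKM_level m P t" using z by (simp add: memb)
    qed
  qed
qed

lemma has_vector_derivative_scaleR_const:
  "(f has_real_derivative f') (at t) \<Longrightarrow> ((\<lambda>t. f t *\<^sub>R w) has_vector_derivative f' *\<^sub>R w) (at t)"
  using has_vector_derivative_scaleR[of f f' t UNIV "\<lambda>_. w" 0] by simp

text \<open>
  The curve rotates \<open>x\<close> inside its eigenspace towards the component of \<open>v\<close> there, and simultaneously
  rotates the eigenspace itself in the direction of the other component.
\<close>
lemma tangent_space_focal_minus:
  assumes x: "x \<in> focal_minus m P"
  shows "tangent_space (focal_minus m P) x =
    {v. v \<bullet> x = 0 \<and> v - op (coeff x) v = 2 *\<^sub>R op (\<lambda>\<alpha>. p \<alpha> x \<bullet> v) x}" (is "?T = ?N")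
proof
  have x1: "x \<bullet> x = 1" and Qx: "op (coeff x) x = x"
    using x by (simp_all add: focal_minus_iff norm_eq_1)
  have qq: "(\<Sum>\<alpha>\<le>m. (coeff x \<alpha>)\<^sup>2) = 1" using sum_coeff_sq[of x] x1 Qx by simp
  show "?T \<subseteq> ?N"
  proof
    fix v assume v: "v \<in> ?T"
    have "2 * (x \<bullet> v) = 0"
      by (rule tangent_space_derivative_eq_0[OF v inner_self_derivative])
         (auto simp: focal_minus_iff norm_eq_1)
    moreover have "op (coeff x) v + op (\<lambda>\<alpha>. 2 * (p \<alpha> x \<bullet> v)) x - v = 0"
    proof (rule tangent_space_derivative_eq_0[OF v])
      have "((\<lambda>z. op (coeff z) z) has_derivative
          (\<lambda>v. \<Sum>\<alpha>\<le>m. coeff x \<alpha> *\<^sub>R p \<alpha> v + (2 * (p \<alpha> x \<bullet> v)) *\<^sub>R p \<alpha> x)) (at x)"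
        unfolding op_def
      proof (intro has_derivative_sum has_derivative_scaleR coeff_derivative)
        show "(p \<alpha> has_derivative p \<alpha>) (at x)" for \<alpha>
          by (simp add: bounded_linear_imp_has_derivative linear_conv_bounded_linear[symmetric])
      qed simp
      then have "((\<lambda>z. op (coeff z) z) has_derivative
          (\<lambda>v. op (coeff x) v + op (\<lambda>\<alpha>. 2 * (p \<alpha> x \<bullet> v)) x)) (at x)"
        by (simp add: op_def sum.distrib)
      then show "((\<lambda>z. op (coeff z) z - z) has_derivative
          (\<lambda>v. op (coeff x) v + op (\<lambda>\<alpha>. 2 * (p \<alpha> x \<bullet> v)) x - v)) (at x)"
        by (rule has_derivative_diff[OF _ has_derivative_ident])
      show "op (coeff z) z - z = 0" if "z \<in> focal_minus m P" for z
        using that by (simp add: focal_minus_iff)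
    qed
    ultimately show "v \<in> ?N"
      by (simp add: op_scale_coeff inner_commute algebra_simps)
  qed
  show "?N \<subseteq> ?T"
  proof
    fix v assume "v \<in> ?N"
    then have vx: "v \<bullet> x = 0" and vQ: "v - op (coeff x) v = 2 *\<^sub>R op (\<lambda>\<alpha>. p \<alpha> x \<bullet> v) x" by auto
    let ?q = "coeff x"
    interpret Q: linear "op ?q" by (rule op_linear)
    have QQ: "op ?q (op ?q w) = w" for w using qq by (simp add: op_sq)
    \<comment> \<open>The derivative of \<open>coeff\<close> along \<open>v\<close>, that is the
      velocity of the base point. It is orthogonal to \<open>coeff x\<close>, so the two operators
      anticommute.\<close>
    define k where "k = (\<lambda>\<alpha>. 2 * (p \<alpha> x \<bullet> v))"
    define \<eta> where "\<eta> = sqrt (\<Sum>\<alpha>\<le>m. (k \<alpha>)\<^sup>2)"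
    \<comment> \<open>If \<open>\<eta> = 0\<close>, division by zero makes \<open>K\<close> vanish,
      which is harmless because the sine in front of it in the curve is then 0. The same applies to
      \<open>\<zeta>\<close> and \<open>z'\<close>.\<close>
    define K where "K = (\<lambda>\<alpha>. (1 / \<eta>) * k \<alpha>)"
    interpret K: linear "op K" by (rule op_linear)
    have \<eta>2: "\<eta>\<^sup>2 = (\<Sum>\<alpha>\<le>m. (k \<alpha>)\<^sup>2)" unfolding \<eta>_def by (simp add: sum_nonneg)
    have KK: "(\<Sum>\<alpha>\<le>m. (K \<alpha>)\<^sup>2) = 1" if "\<eta> \<noteq> 0"
    proof -
      have "(\<Sum>\<alpha>\<le>m. (K \<alpha>)\<^sup>2) = (1 / \<eta>)\<^sup>2 * (\<Sum>\<alpha>\<le>m. (k \<alpha>)\<^sup>2)"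
        by (simp add: K_def power_mult_distrib power_divide sum_distrib_left)
      then show ?thesis using that by (simp add: \<eta>2[symmetric] power_divide)
    qed
    have \<eta>K: "\<eta> *\<^sub>R op K w = op k w" for w
    proof (cases "\<eta> = 0")
      case True
      then have "k \<alpha> = 0" if "\<alpha> \<le> m" for \<alpha>
        using \<eta>2 that by (auto simp: sum_nonneg_eq_0_iff)
      then show ?thesis using True by (simp add: op_def)
    next
      case False
      then show ?thesis unfolding K_def op_scale_coeff by simp
    qed
    have "(\<Sum>\<alpha>\<le>m. k \<alpha> * ?q \<alpha>) = 2 * (op ?q x \<bullet> v)"
      by (simp add: k_def op_def inner_sum_left sum_distrib_left mult_ac)
    then have "(\<Sum>\<alpha>\<le>m. k \<alpha> * ?q \<alpha>) = 0" using vx Qx by (simp add: inner_commute)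
    then have "(\<Sum>\<alpha>\<le>m. ?q \<alpha> * K \<alpha>) = 0"
    proof -
      have "(\<Sum>\<alpha>\<le>m. ?q \<alpha> * K \<alpha>) = (1 / \<eta>) * (\<Sum>\<alpha>\<le>m. k \<alpha> * ?q \<alpha>)"
        by (simp add: K_def sum_distrib_left mult_ac)
      then show ?thesis using \<open>(\<Sum>\<alpha>\<le>m. k \<alpha> * ?q \<alpha>) = 0\<close> by simp
    qed
    then have anti: "op ?q (op K w) = - op K (op ?q w)" for w
      using op_anticommutator[of ?q K w] by (simp add: eq_neg_iff_add_eq_0)
    define z where "z = (1/2) *\<^sub>R (v + op ?q v)"
    define \<zeta> where "\<zeta> = norm z"
    define z' where "z' = (1 / \<zeta>) *\<^sub>R z"
    have \<zeta>z: "\<zeta> *\<^sub>R z' = z" by (simp add: z'_def \<zeta>_def)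
    have "op ?q z = z" by (simp add: z_def Q.scale Q.add QQ add.commute)
    then have Qz': "op ?q z' = z'" by (simp add: z'_def Q.scale)
    have "z \<bullet> x = 0"
      using vx Qx op_sym[of ?q v x] by (simp add: z_def inner_add_left)
    then have z'x: "x \<bullet> z' = 0" "z' \<bullet> x = 0" by (simp_all add: z'_def inner_commute)
    have z'1: "z' \<bullet> z' = 1" if "\<zeta> \<noteq> 0"
      using that by (simp add: z'_def \<zeta>_def dot_square_norm power2_eq_square)
    have v_eq: "v = z + (1/2) *\<^sub>R op k x"
    proof -
      have "op k x = v - op ?q v" using vQ by (simp add: k_def op_scale_coeff)
      then show ?thesis by (simp add: z_def scaleR_add_right[symmetric] scaleR_2[symmetric])
    qed
    define c where "c = (\<lambda>t. cos (\<zeta> * t) *\<^sub>R x + sin (\<zeta> * t) *\<^sub>R z')"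
    have Qc: "op ?q (c t) = c t" for t by (simp add: c_def Q.add Q.scale Qx Qz')
    have c1: "c t \<bullet> c t = 1" for t
    proof (cases "\<zeta> = 0")
      case False
      then show ?thesis
        using z'x z'1 x1 sin_cos_squared_add[of "\<zeta> * t"]
        by (simp add: c_def inner_add_left inner_add_right power2_eq_square add.commute)
    qed (simp add: c_def x1)
    have cK: "c t \<bullet> op K (c t) = 0" for t
    proof -
      have "c t \<bullet> op K (c t) = - (c t \<bullet> op K (c t))"
        using op_sym[of ?q "c t" "op K (c t)"] by (simp only: anti Qc inner_minus_right)
      then show ?thesis by linarith
    qed
    \<comment> \<open>Half angles, because turning a vector in the plane of \<open>c t\<close> and
      \<open>op K (c t)\<close> turns the element that fixes it by twice the angle.\<close>
    define \<gamma> where "\<gamma> = (\<lambda>t. cos (\<eta> / 2 * t) *\<^sub>R c t + sin (\<eta> / 2 * t) *\<^sub>R op K (c t))"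
    have mem: "\<gamma> t \<in> focal_minus m P" for t
    proof (rule focal_minusI)
      let ?a = "\<eta> / 2 * t"
      show "norm (\<gamma> t) = 1"
      proof (cases "\<eta> = 0")
        case False
        then have "op K (c t) \<bullet> op K (c t) = 1"
          using op_inner_op[of K "c t" K] KK c1 by (simp add: power2_eq_square)
        then have "\<gamma> t \<bullet> \<gamma> t = 1"
          using c1[of t] cK[of t] sin_cos_squared_add[of ?a]
          by (simp add: \<gamma>_def inner_add_left inner_add_right inner_commute power2_eq_square add.commute)
        then show ?thesis by (simp add: norm_eq_1)
      qed (simp add: \<gamma>_def c1 norm_eq_1)
      show "op (\<lambda>\<alpha>. cos (2 * ?a) * ?q \<alpha> + sin (2 * ?a) * K \<alpha>) (\<gamma> t) = \<gamma> t"
      proof (cases "\<eta> = 0")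
        case False
        have KKc: "op K (op K (c t)) = c t" using KK[OF False] by (simp add: op_sq)
        have "op (\<lambda>\<alpha>. cos (2 * ?a) * ?q \<alpha> + sin (2 * ?a) * K \<alpha>) (\<gamma> t) =
            cos (2 * ?a) *\<^sub>R op ?q (\<gamma> t) + sin (2 * ?a) *\<^sub>R op K (\<gamma> t)"
          by (simp add: op_add_coeff op_scale_coeff)
        also have "\<dots> = (cos (2 * ?a) * cos ?a + sin (2 * ?a) * sin ?a) *\<^sub>R c t +
            (sin (2 * ?a) * cos ?a - cos (2 * ?a) * sin ?a) *\<^sub>R op K (c t)"
          unfolding \<gamma>_def Q.add Q.scale K.add K.scale anti Qc KKc
          by (simp add: scaleR_add_left scaleR_diff_left scaleR_add_right scaleR_diff_right)
        also have "\<dots> = \<gamma> t"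
          unfolding cos_diff[symmetric] sin_diff[symmetric] by (simp add: \<gamma>_def)
        finally show ?thesis .
      qed (simp add: \<gamma>_def op_add_coeff op_scale_coeff Qc op_def[of "\<lambda>_. 0"])
    qed
    define D where "D = (\<lambda>t.
      (- (\<eta>/2) * sin (\<eta>/2 * t) * cos (\<zeta> * t) - \<zeta> * cos (\<eta>/2 * t) * sin (\<zeta> * t)) *\<^sub>R x +
      (- (\<eta>/2) * sin (\<eta>/2 * t) * sin (\<zeta> * t) + \<zeta> * cos (\<eta>/2 * t) * cos (\<zeta> * t)) *\<^sub>R z' +
      ((\<eta>/2) * cos (\<eta>/2 * t) * cos (\<zeta> * t) - \<zeta> * sin (\<eta>/2 * t) * sin (\<zeta> * t)) *\<^sub>R op K x +
      ((\<eta>/2) * cos (\<eta>/2 * t) * sin (\<zeta> * t) + \<zeta> * sin (\<eta>/2 * t) * cos (\<zeta> * t)) *\<^sub>R op K z')"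
    have \<gamma>_eq: "\<gamma> = (\<lambda>t. (cos (\<eta>/2 * t) * cos (\<zeta> * t)) *\<^sub>R x + (cos (\<eta>/2 * t) * sin (\<zeta> * t)) *\<^sub>R z' +
      (sin (\<eta>/2 * t) * cos (\<zeta> * t)) *\<^sub>R op K x + (sin (\<eta>/2 * t) * sin (\<zeta> * t)) *\<^sub>R op K z')"
      by (simp add: \<gamma>_def c_def K.add K.scale scaleR_add_right fun_eq_iff)
    have der: "(\<gamma> has_vector_derivative D t) (at t)" for t
    proof -
      have C: "((\<lambda>t. cos (r * t)) has_real_derivative - r * sin (r * t)) (at t)"
        and S: "((\<lambda>t. sin (r * t)) has_real_derivative r * cos (r * t)) (at t)" for r :: real
        by (auto intro!: derivative_eq_intros)
      show ?thesis
        unfolding \<gamma>_eq D_def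
        by (intro has_vector_derivative_add has_vector_derivative_scaleR_const)
           (rule DERIV_cong, rule DERIV_mult[OF C C] DERIV_mult[OF C S] DERIV_mult[OF S C] DERIV_mult[OF S S],
            simp add: algebra_simps)+
    qed
    have "D 0 = \<zeta> *\<^sub>R z' + (1/2) *\<^sub>R (\<eta> *\<^sub>R op K x)" by (simp add: D_def)
    then have D0: "D 0 = v" using v_eq \<zeta>z \<eta>K by simp
    show "v \<in> ?T"
      unfolding tangent_space_def mem_Collect_eq
    proof (intro exI[of _ \<gamma>] exI[of _ "1::real"] conjI)
      have "continuous_on {-1<..<1} D" unfolding D_def by (intro continuous_intros)
      then show "\<gamma> C1_differentiable_on {-1<..<1}"
        unfolding C1_differentiable_on_def using der by blast
      show "\<gamma> ` {-1<..<1} \<subseteq> focal_minus m P" using mem by blast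
      show "\<gamma> 0 = x" by (simp add: \<gamma>_def c_def)
      show "(\<gamma> has_vector_derivative v) (at 0)" using der[of 0] D0 by simp
    qed simp
  qed
qed

end

section \<open>The isoparametric hypersurface\<close>

lemma continuous_subspaces_insert_span:
  fixes B :: "'b::topological_space \<Rightarrow> 'v::euclidean_space set"
  assumes "continuous_subspaces X (\<lambda>x. span (B x))" "continuous_on X n"
    and "\<And>x. x \<in> X \<Longrightarrow> n x \<notin> span (B x)"
  shows "continuous_subspaces X (\<lambda>x. span (insert (n x) (B x)))"
  using continuous_subspaces_insert[OF assms] by (simp add: span_insert_span)

lemma gl_equivalent_pair_homotopy:
  fixes a b :: "real \<Rightarrow> 'b::metric_space \<Rightarrow> 'v::euclidean_space"
  assumes X: "compact X"
    and a: "continuous_on ({0..1} \<times> X) (\<lambda>z. a (fst z) (snd z))"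
      "\<And>s x. s \<in> {0..1} \<Longrightarrow> x \<in> X \<Longrightarrow> a s x \<noteq> 0"
    and b: "continuous_on ({0..1} \<times> X) (\<lambda>z. b (fst z) (snd z))"
      "\<And>s x. s \<in> {0..1} \<Longrightarrow> x \<in> X \<Longrightarrow> b s x \<notin> span {a s x}"
  shows "gl_equivalent X (\<lambda>x. span {b 0 x, a 0 x}) (\<lambda>x. span {b 1 x, a 1 x})"
proof -
  have "continuous_subspaces ({0..1} \<times> X) (\<lambda>z. span {b (fst z) (snd z), a (fst z) (snd z)})"
    by (intro continuous_subspaces_insert_span a b) (use a b in \<open>auto simp: continuous_subspaces_null\<close>)
  from gl_equivalent_homotopy[OF X this] show ?thesis .
qed

lemma gl_equivalent_triple_homotopy:
  fixes a b c :: "real \<Rightarrow> 'b::metric_space \<Rightarrow> 'v::euclidean_space"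
  assumes X: "compact X"
    and a: "continuous_on ({0..1} \<times> X) (\<lambda>z. a (fst z) (snd z))"
      "\<And>s x. s \<in> {0..1} \<Longrightarrow> x \<in> X \<Longrightarrow> a s x \<noteq> 0"
    and b: "continuous_on ({0..1} \<times> X) (\<lambda>z. b (fst z) (snd z))"
      "\<And>s x. s \<in> {0..1} \<Longrightarrow> x \<in> X \<Longrightarrow> b s x \<notin> span {a s x}"
    and c: "continuous_on ({0..1} \<times> X) (\<lambda>z. c (fst z) (snd z))"
      "\<And>s x. s \<in> {0..1} \<Longrightarrow> x \<in> X \<Longrightarrow> c s x \<notin> span {b s x, a s x}"
  shows "gl_equivalent X (\<lambda>x. span {c 0 x, b 0 x, a 0 x}) (\<lambda>x. span {c 1 x, b 1 x, a 1 x})"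
proof -
  have "continuous_subspaces ({0..1} \<times> X)
      (\<lambda>z. span {c (fst z) (snd z), b (fst z) (snd z), a (fst z) (snd z)})"
    by (intro continuous_subspaces_insert_span a b c) (use a b c in \<open>auto simp: continuous_subspaces_null\<close>)
  from gl_equivalent_homotopy[OF X this] show ?thesis .
qed

section \<open>Orthonormal vectors and complex structures\<close>

lemma orthonormal_in_subspace:
  assumes W: "subspace (W :: 'v::euclidean_space set)" and n: "n \<le> dim W"
  obtains T where "T \<subseteq> W" "card T = n" "finite T" "\<And>a. a \<in> T \<Longrightarrow> a \<bullet> a = 1"
    "\<And>a b. a \<in> T \<Longrightarrow> b \<in> T \<Longrightarrow> a \<noteq> b \<Longrightarrow> a \<bullet> b = 0"
proof -
  obtain B where B: "B \<subseteq> W" "pairwise orthogonal B" "\<And>b. b \<in> B \<Longrightarrow> norm b = 1" "card B = dim W"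
    using orthonormal_basis_subspace[OF W] by metis
  obtain T where T: "T \<subseteq> B" "card T = n" "finite T"
    using obtain_subset_with_card_n[of n B] n B(4) by metis
  show thesis
  proof (rule that[of T])
    show "T \<subseteq> W" using T(1) B(1) by blast
    show "a \<bullet> a = 1" if "a \<in> T" for a using B(3) T(1) that by (metis norm_eq_1 subsetD)
    show "a \<bullet> b = 0" if "a \<in> T" "b \<in> T" "a \<noteq> b" for a b
      using B(2) T(1) that unfolding pairwise_def orthogonal_def by blast
  qed (use T in auto)
qed

text \<open>A plane with orthonormal basis \<open>a\<close>, \<open>b\<close> is split off and
  turned by a right angle; induction covers its orthogonal complement in \<open>W\<close>. Only the
  values on \<open>W\<close> matter.\<close>

lemma even_dim_complex_structure:
  assumes "subspace (W :: 'v::euclidean_space set)" "dim W = 2 * k"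
  shows "\<exists>J. linear J \<and> (\<forall>w\<in>W. J w \<in> W \<and> J w \<bullet> w = 0 \<and> J w \<bullet> J w = w \<bullet> w)"
  using assms
proof (induction k arbitrary: W)
  case 0
  then have "W = {0}" using dim_eq_0[of W] subspace_0[of W] by auto
  then show ?case
    by (intro exI[of _ "\<lambda>x. 0"]) (simp add: module_hom_zero)
next
  case (Suc k)
  obtain T where T: "T \<subseteq> W" "card T = 2" "\<And>a. a \<in> T \<Longrightarrow> a \<bullet> a = 1"
      "\<And>a b. a \<in> T \<Longrightarrow> b \<in> T \<Longrightarrow> a \<noteq> b \<Longrightarrow> a \<bullet> b = 0"
  proof (rule orthonormal_in_subspace[OF Suc.prems(1), of 2])
    show "2 \<le> dim W" using Suc.prems(2) by simp
  qed (rule that)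
  obtain a b where ab: "T = {a, b}" "a \<noteq> b" using T(2) by (meson card_2_iff)
  have a: "a \<in> W" "a \<bullet> a = 1" and b: "b \<in> W" "b \<bullet> b = 1" and o: "a \<bullet> b = 0" "b \<bullet> a = 0"
    using T ab by auto
  define W' where "W' = {y \<in> W. \<forall>x\<in>span {a, b}. orthogonal x y}"
  have W'_iff: "y \<in> W' \<longleftrightarrow> y \<in> W \<and> y \<bullet> a = 0 \<and> y \<bullet> b = 0" for y
  proof -
    have "(\<forall>x\<in>span {a, b}. orthogonal x y) \<longleftrightarrow> y \<in> orthogonal_comp (span {a, b})"
      by (simp add: orthogonal_comp_def)
    then show ?thesis by (simp add: W'_def orthogonal_comp_span)
  qed
  have W': "subspace W'"
    by (rule subspaceI)
       (use Suc.prems(1) in \<open>auto simp: W'_iff subspace_add subspace_scale subspace_0 inner_add_left\<close>)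
  have "independent {a, b}"
    using a b o by (intro pairwise_orthogonal_independent)
      (auto simp: pairwise_def orthogonal_def)
  then have "dim (span {a, b}) = 2" using ab(2) by (simp add: dim_eq_card_independent)
  moreover have "span {a, b} \<subseteq> W" using a b Suc.prems(1) by (simp add: span_minimal)
  ultimately have "dim W' = 2 * k"
    using dim_subspace_orthogonal_to_vectors[of "span {a, b}" W] Suc.prems by (simp add: W'_def)
  then obtain J where J: "linear J" "\<And>w. w \<in> W' \<Longrightarrow> J w \<in> W' \<and> J w \<bullet> w = 0 \<and> J w \<bullet> J w = w \<bullet> w"
    using Suc.IH[OF W'] by blast
  define r where "r = (\<lambda>x. x - (x \<bullet> a) *\<^sub>R a - (x \<bullet> b) *\<^sub>R b)"
  define K where "K = (\<lambda>x. (x \<bullet> a) *\<^sub>R b - (x \<bullet> b) *\<^sub>R a + J (r x))"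
  have "linear r"
    unfolding r_def by (rule linearI) (simp_all add: inner_add_left scaleR_add_left algebra_simps)
  then have linJr: "linear (\<lambda>x. J (r x))" using linear_compose[OF _ J(1)] by (simp add: o_def)
  have "linear K"
    unfolding K_def
    by (intro linear_compose_add linear_compose_sub linJr)
       (auto intro!: linearI simp: inner_add_left scaleR_add_left)
  moreover have "K w \<in> W \<and> K w \<bullet> w = 0 \<and> K w \<bullet> K w = w \<bullet> w" if w: "w \<in> W" for w
  proof -
    have rW: "r w \<in> W'"
      unfolding W'_iff using w a b o Suc.prems(1)
      by (simp add: r_def subspace_diff subspace_scale inner_diff_left)
    note Jr = J(2)[OF rW]
    have JW: "J (r w) \<in> W" "J (r w) \<bullet> a = 0" "J (r w) \<bullet> b = 0" "a \<bullet> J (r w) = 0" "b \<bullet> J (r w) = 0"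
      using Jr by (auto simp: W'_iff inner_commute)
    have w_eq: "w = r w + (w \<bullet> a) *\<^sub>R a + (w \<bullet> b) *\<^sub>R b" by (simp add: r_def)
    have rab: "r w \<bullet> a = 0" "r w \<bullet> b = 0" "a \<bullet> r w = 0" "b \<bullet> r w = 0"
      using rW by (auto simp: W'_iff inner_commute)
    have "K w \<in> W"
      unfolding K_def using a b JW Suc.prems(1) by (intro subspace_add subspace_diff subspace_scale)
    moreover have "K w \<bullet> w = K w \<bullet> (r w + (w \<bullet> a) *\<^sub>R a + (w \<bullet> b) *\<^sub>R b)"
      by (rule arg_cong[OF w_eq])
    then have "K w \<bullet> w = 0"
      using Jr JW rab a b o
      by (simp add: K_def inner_add_left inner_add_right inner_diff_left)
    moreover have "w \<bullet> w = r w \<bullet> r w + (w \<bullet> a) * (w \<bullet> a) + (w \<bullet> b) * (w \<bullet> b)"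
    proof -
      have "w \<bullet> w = (r w + (w \<bullet> a) *\<^sub>R a + (w \<bullet> b) *\<^sub>R b) \<bullet> (r w + (w \<bullet> a) *\<^sub>R a + (w \<bullet> b) *\<^sub>R b)"
        by (rule arg_cong2[OF w_eq w_eq])
      then show ?thesis using rab a b o by (simp add: inner_add_left inner_add_right)
    qed
    moreover have "K w \<bullet> K w = J (r w) \<bullet> J (r w) + (w \<bullet> a) * (w \<bullet> a) + (w \<bullet> b) * (w \<bullet> b)"
      using JW a b o
      by (simp add: K_def inner_add_left inner_add_right inner_diff_left inner_diff_right)
    ultimately show ?thesis using Jr by simp
  qed
  ultimately show ?case by blast
qed

section \<open>Eigenspaces of \<open>P 0\<close> and the deformation on \<open>M\<close>\<close>

context clifford_system
begin

definition Eplus :: "(real^'n) set" where "Eplus = {x. p 0 x = x}"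
definition Eminus :: "(real^'n) set" where "Eminus = {x. p 0 x = - x}"

lemma subspace_Eplus: "subspace Eplus" and subspace_Eminus: "subspace Eminus"
  by (auto simp: subspace_def Eplus_def Eminus_def p_simps)

lemma Eplus_Eminus_orth: "a \<in> Eplus \<Longrightarrow> b \<in> Eminus \<Longrightarrow> a \<bullet> b = 0" "a \<in> Eplus \<Longrightarrow> b \<in> Eminus \<Longrightarrow> b \<bullet> a = 0"
proof -
  assume "a \<in> Eplus" "b \<in> Eminus"
  then have "a \<bullet> b = - (a \<bullet> b)" using p_sym[of 0 a b] by (simp add: Eplus_def Eminus_def)
  then show "a \<bullet> b = 0" "b \<bullet> a = 0" by (simp_all add: inner_commute)
qed

lemma p_Eplus: "0 < \<alpha> \<Longrightarrow> \<alpha> \<le> m \<Longrightarrow> a \<in> Eplus \<Longrightarrow> p \<alpha> a \<in> Eminus"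
  using p_anti[of 0 \<alpha> a] by (simp add: Eplus_def Eminus_def)

lemma p_Eminus: "0 < \<alpha> \<Longrightarrow> \<alpha> \<le> m \<Longrightarrow> a \<in> Eminus \<Longrightarrow> p \<alpha> a \<in> Eplus"
  using p_anti[of 0 \<alpha> a] by (simp add: Eplus_def Eminus_def p_simps)

text \<open>\<open>p 1\<close> anticommutes with \<open>p 0\<close> and so exchanges its two
  eigenspaces, which together span the space of dimension \<open>2 * l\<close>.\<close>

lemma dim_Eplus: "dim Eplus = l" and dim_Eminus: "dim Eminus = l"
proof -
  have m1: "1 \<le> m" using m_pos by simp
  have "p 1 ` Eplus = Eminus"
  proof
    show "Eminus \<subseteq> p 1 ` Eplus"
      using p_Eminus[of 1] p_sq[OF m1] m1 by (metis image_eqI subsetI zero_less_one)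
  qed (use p_Eplus[of 1] m1 in auto)
  moreover have "inj (p 1)" by (metis injI p_sq[OF m1])
  ultimately have d: "dim Eminus = dim Eplus"
    using dim_image_eq[OF p_linear, of 1 Eplus] by (metis inj_on_subset subset_UNIV)
  have "\<exists>a b. x = a + b \<and> a \<in> Eplus \<and> b \<in> Eminus" for x
  proof (intro exI conjI)
    show "x = (1/2) *\<^sub>R (x + p 0 x) + (1/2) *\<^sub>R (x - p 0 x)"
      by (simp add: scaleR_add_right[symmetric] scaleR_2[symmetric])
    show "(1/2) *\<^sub>R (x + p 0 x) \<in> Eplus" "(1/2) *\<^sub>R (x - p 0 x) \<in> Eminus"
      by (simp_all add: Eplus_def Eminus_def p_simps p_sq add.commute scaleR_diff_right)
  qed
  then have "{a + b |a b. a \<in> Eplus \<and> b \<in> Eminus} = UNIV" by blast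
  moreover have "Eplus \<inter> Eminus = {0}"
  proof -
    have "x = 0" if "x \<in> Eplus" "x \<in> Eminus" for x
      using Eplus_Eminus_orth(1)[OF that] by simp
    then show ?thesis using subspace_0 subspace_Eplus subspace_Eminus by blast
  qed
  ultimately have "DIM(real^'n) = dim Eplus + dim Eminus"
    using dim_sums_Int[OF subspace_Eplus subspace_Eminus] by simp
  then show "dim Eplus = l" "dim Eminus = l" using d card by simp_all
qed

lemma Eplus_unit: obtains e where "e \<in> Eplus" "e \<bullet> e = 1"
proof (rule orthonormal_in_subspace[OF subspace_Eplus, of 1])
  show "1 \<le> dim Eplus" using dim_Eplus l_gt by simp
  fix T assume T: "T \<subseteq> Eplus" "card T = 1" "\<And>a. a \<in> T \<Longrightarrow> a \<bullet> a = 1"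
  obtain a where "T = {a}" using T(2) card_1_singletonE by blast
  then show thesis using T(1) T(3)[of a] by (intro that[of a]) auto
qed

text \<open>The product of \<open>p 0\<close> and \<open>p 1\<close> is skew and orthogonal. In its
  pairing with \<open>op (coeff x) x\<close> each term with \<open>\<alpha> > 1\<close> vanishes,
  since the product of three anticommuting symmetric maps is skew, and the terms for 0 and 1
  cancel.\<close>

lemma
  shows p0_p1_orth: "p 0 (p 1 x) \<bullet> x = 0" and p0_p1_norm: "p 0 (p 1 x) \<bullet> p 0 (p 1 x) = x \<bullet> x"
    and p0_p1_op: "p 0 (p 1 x) \<bullet> op (coeff x) x = 0"
proof -
  have m1: "1 \<le> m" using m_pos by simp
  show "p 0 (p 1 x) \<bullet> x = 0" using p_orth[OF m1, of 0 x] by (simp add: p_sym)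
  show "p 0 (p 1 x) \<bullet> p 0 (p 1 x) = x \<bullet> x" using m1 by (simp add: p_inner)
  let ?A = "coeff x 0 * coeff x 1"
  have "coeff x \<alpha> * (p 0 (p 1 x) \<bullet> p \<alpha> x) = (if \<alpha> = 0 then ?A else 0) + (if \<alpha> = 1 then - ?A else 0)"
    if "\<alpha> \<le> m" for \<alpha>
  proof -
    consider "\<alpha> = 0" | "\<alpha> = 1" | "\<alpha> \<noteq> 0" "\<alpha> \<noteq> 1" by blast
    then show ?thesis
    proof cases
      case 1
      then show ?thesis using p_inner[of 0 "p 1 x" x] by (simp add: coeff_def)
    next
      case 2
      have "p 0 (p 1 x) \<bullet> p 1 x = - (p 1 (p 0 x) \<bullet> p 1 x)" using p_anti[of 0 1 x] m1 by simp
      then show ?thesis using 2 p_inner[OF m1, of "p 0 x" x] by (simp add: coeff_def)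
    next
      case 3
      have "p 0 (p 1 x) \<bullet> p \<alpha> x = p \<alpha> (p 0 (p 1 x)) \<bullet> x" using that by (simp add: p_sym)
      also have "p \<alpha> (p 0 (p 1 x)) = p 0 (p 1 (p \<alpha> x))"
        using 3 that m1 p_anti[of \<alpha> 0 "p 1 x"] p_anti[of \<alpha> 1 x] by (simp add: p_simps)
      also have "p 0 (p 1 (p \<alpha> x)) \<bullet> x = p \<alpha> x \<bullet> p 1 (p 0 x)" using m1 by (simp add: p_sym)
      also have "\<dots> = - (p 0 (p 1 x) \<bullet> p \<alpha> x)" using p_anti[of 0 1 x] m1 by (simp add: inner_commute)
      finally show ?thesis using 3 by simp
    qed
  qed
  then have "(\<Sum>\<alpha>\<le>m. coeff x \<alpha> * (p 0 (p 1 x) \<bullet> p \<alpha> x)) =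
      (\<Sum>\<alpha>\<le>m. (if \<alpha> = 0 then ?A else 0) + (if \<alpha> = 1 then - ?A else 0))"
    by (intro sum.cong) auto
  also have "\<dots> = 0" using m1 by (simp add: sum.distrib)
  finally show "p 0 (p 1 x) \<bullet> op (coeff x) x = 0"
    by (simp add: op_def inner_sum_right)
qed

theorem parallelizable_level:
  assumes t: "-1 < t" "t < 1"
  shows "parallelizable (OT_FKM_level m P t)"
proof -
  let ?M = "OT_FKM_level m P t"
  define J where "J = (\<lambda>x. p 0 (p 1 x))"
  have J_orth: "J x \<bullet> x = 0" and J_norm: "J x \<bullet> J x = x \<bullet> x" and J_op: "J x \<bullet> op (coeff x) x = 0" for x
    unfolding J_def by (rule p0_p1_orth p0_p1_norm p0_p1_op)+
  define a where "a = (1 - t) / 2"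
  have a: "0 < a" "a < 1" using t by (auto simp: a_def)
  have cJ [continuous_intros]: "continuous_on X f \<Longrightarrow> continuous_on X (\<lambda>x. J (f x))" for X :: "(real \<times> (real^'n)) set" and f
    unfolding J_def by (intro continuous_intros)
  have mem: "x \<bullet> x = 1" "op (coeff x) x \<bullet> x = a" "op (coeff x) x \<bullet> op (coeff x) x = a" if "x \<in> ?M" for x
    using that sum_coeff_sq[of x] op_inner_op[of "coeff x" x "coeff x"]
    by (simp_all add: level_iff norm_eq_1 a_def power2_eq_square)
  have 1: "gl_equivalent ?M (\<lambda>x. span {op (coeff x) x, x}) (\<lambda>x. span {J x, x})"
  proof -
    have "gl_equivalent ?M (\<lambda>x. span {(1 - 0) *\<^sub>R op (coeff x) x + 0 *\<^sub>R J x, x})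
        (\<lambda>x. span {(1 - 1) *\<^sub>R op (coeff x) x + 1 *\<^sub>R J x, x})"
    proof (rule gl_equivalent_pair_homotopy[OF level_compact,
          of _ "\<lambda>s x. x" "\<lambda>s x. (1 - s) *\<^sub>R op (coeff x) x + s *\<^sub>R J x"])
      fix s :: real and x assume s: "s \<in> {0..1}" and x: "x \<in> ?M"
      show "x \<noteq> 0" using mem[OF x] by auto
      show "(1 - s) *\<^sub>R op (coeff x) x + s *\<^sub>R J x \<notin> span {x}"
      proof
        assume "(1 - s) *\<^sub>R op (coeff x) x + s *\<^sub>R J x \<in> span {x}"
        then obtain k where k: "(1 - s) *\<^sub>R op (coeff x) x + s *\<^sub>R J x = k *\<^sub>R x"
          by (auto simp: span_singleton)
        \<comment> \<open>Pairing with \<open>J x\<close> leaves only \<open>s = 0\<close>. There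
          \<open>k\<close> and its square would both be \<open>a\<close>, which is neither 0 nor
          1.\<close>
        have "((1 - s) *\<^sub>R op (coeff x) x + s *\<^sub>R J x) \<bullet> J x = s"
          using J_op[of x] J_norm[of x] mem[OF x] by (simp add: inner_add_left inner_add_right inner_commute)
        then have s0: "s = 0" using k J_orth[of x] by (simp add: inner_commute)
        then have Bx: "op (coeff x) x = k *\<^sub>R x" using k by simp
        have "k = a" "k * k = a" using mem[OF x] unfolding Bx by simp_all
        then show False using a by simp
      qed
    qed (auto simp: op_def intro!: continuous_intros)
    then show ?thesis by simp
  qed
  \<comment> \<open>Unit eigenvectors of \<open>p 0\<close> lie in \<open>M\<^sub>-\<close>. Hence
    \<open>- e\<close> is not in \<open>M\<close>, and the segment from a point of \<open>M\<close>
    to \<open>e\<close> avoids 0.\<close>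
  obtain e where e: "e \<in> Eplus" "e \<bullet> e = 1" by (rule Eplus_unit)
  have eM: "x \<noteq> - e" if x: "x \<in> ?M" for x
  proof
    assume "x = - e"
    then have "coeff x 0 = 1" using e by (simp add: coeff_def Eplus_def p_simps)
    then have "1 \<le> (\<Sum>\<alpha>\<le>m. (coeff x \<alpha>)\<^sup>2)"
      using member_le_sum[of 0 "{..m}" "\<lambda>\<alpha>. (coeff x \<alpha>)\<^sup>2"] by simp
    then show False using x a by (simp add: level_iff a_def)
  qed
  have 2: "gl_equivalent ?M (\<lambda>x. span {J x, x}) (\<lambda>x. span {J e, e})"
  proof -
    let ?z = "\<lambda>s x. (1 - s) *\<^sub>R x + s *\<^sub>R e"
    have "gl_equivalent ?M (\<lambda>x. span {J (?z 0 x), ?z 0 x}) (\<lambda>x. span {J (?z 1 x), ?z 1 x})"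
    proof (rule gl_equivalent_pair_homotopy[OF level_compact, of _ ?z "\<lambda>s x. J (?z s x)"])
      fix s :: real and x assume s: "s \<in> {0..1}" and x: "x \<in> ?M"
      show z: "?z s x \<noteq> 0"
      proof
        assume z0: "?z s x = 0"
        then have xe: "(1 - s) *\<^sub>R x = - (s *\<^sub>R e)" by (simp add: eq_neg_iff_add_eq_0)
        have "norm ((1 - s) *\<^sub>R x) = 1 - s" "norm (- (s *\<^sub>R e)) = s"
          using s mem(1)[OF x] e(2) by (simp_all add: norm_eq_1[symmetric])
        then have half: "s = 1/2" using xe by simp
        have "(1/2) *\<^sub>R x = (1/2) *\<^sub>R (- e)" using xe unfolding half by simp
        then show False using eM[OF x] unfolding scaleR_cancel_left by simp
      qed
      have "J (?z s x) \<noteq> 0" using J_norm[of "?z s x"] z by (metis inner_eq_zero_iff)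
      then show "J (?z s x) \<notin> span {?z s x}"
        by (rule notin_span_orthogonal) (use J_orth in auto)
    qed (auto intro!: continuous_intros)
    then show ?thesis by simp
  qed
  have "trivialized ?M (\<lambda>x. orthogonal_comp (span {op (coeff x) x, x}))"
    by (rule orthogonal_comp_trivialized[OF gl_equivalent_trans[OF 1 2]])
  then have "trivialized ?M (tangent_space ?M)"
    using trivialized_cong[of ?M "tangent_space ?M" "\<lambda>x. orthogonal_comp (span {op (coeff x) x, x})"]
      tangent_space_level[OF _ t] by (simp add: insert_commute)
  then show ?thesis
    unfolding parallelizable_def by (rule trivialized_imp_trivial_bundle[OF level_compact])
qed

end

section \<open>Two-frames in a totally real subspace\<close>

lemma span_insert_add:
  assumes "z \<in> span S" shows "span (insert (y + z) S) = span (insert y S)"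
proof -
  have "v - k *\<^sub>R (y + z) \<in> span S \<longleftrightarrow> v - k *\<^sub>R y \<in> span S" for v k
  proof -
    have "v - k *\<^sub>R y = (v - k *\<^sub>R (y + z)) + k *\<^sub>R z" by (simp add: algebra_simps)
    moreover have "k *\<^sub>R z \<in> span S" using assms by (rule span_scale)
    ultimately show ?thesis by (metis span_add_eq2)
  qed
  then show ?thesis by (auto simp: span_breakdown_eq)
qed

lemma span_insert_scale:
  assumes "k \<noteq> 0" shows "span (insert (k *\<^sub>R y) S) = span (insert y S)"
proof -
  have "y = (1 / k) *\<^sub>R (k *\<^sub>R y)" using assms by simp
  then have "y \<in> span (insert (k *\<^sub>R y) S)" by (metis insertI1 span_base span_scale)
  moreover have "k *\<^sub>R y \<in> span (insert y S)" by (simp add: span_base span_scale)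
  ultimately show ?thesis
    by (intro antisym span_minimal) (auto intro: span_base)
qed

text \<open>
  Under the identification of \<open>E + I E\<close> with the complexification of \<open>E\<close>, the normal space of \<open>M\<^sub>+\<close> for
  \<open>m = 1\<close> is spanned by the complex line of \<open>u\<close> and the real line of \<open>I v\<close>, for an orthonormal pair \<open>u\<close>, \<open>v\<close>
  in \<open>E\<close>. The complex line deforms to that of \<open>e\<close>, which turns \<open>I v\<close> into \<open>k0 u v\<close>. For a deformation of
  maps of the form \<open>a + I (pr v)\<close> only the values of \<open>a\<close> at the poles \<open>v = e\<close> and \<open>v = - e\<close> matter: the
  reflection at \<open>w u v\<close> alters them such that, after \<open>pr v\<close> is moved to \<open>J (pr v)\<close>, they are those of
  \<open>- Phi u v\<close>, and \<open>- Phi u v + I (J (pr v))\<close> misses the direction of \<open>e1 + 2 I (J e0)\<close>.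
\<close>
locale totally_real =
  fixes E :: "'v::euclidean_space set" and I J :: "'v \<Rightarrow> 'v" and e e0 e1 :: 'v
  assumes E: "subspace E" and I_lin: "linear I" and II: "\<And>x. I (I x) = - x"
    and I_skew: "\<And>a b. I a \<bullet> b = - (a \<bullet> I b)" and E_I: "\<And>a b. a \<in> E \<Longrightarrow> b \<in> E \<Longrightarrow> a \<bullet> I b = 0"
    and e: "e \<in> E" "e0 \<in> E" "e1 \<in> E" "e \<bullet> e = 1" "e0 \<bullet> e0 = 1" "e1 \<bullet> e1 = 1"
      "e \<bullet> e0 = 0" "e \<bullet> e1 = 0" "e0 \<bullet> e1 = 0"
    and J_lin: "linear J"
    and J: "\<And>w. w \<in> E \<Longrightarrow> w \<bullet> e = 0 \<Longrightarrow> J w \<in> E \<and> J w \<bullet> e = 0 \<and> J w \<bullet> w = 0 \<and> J w \<bullet> J w = w \<bullet> w"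
begin

lemma I_I: "I a \<bullet> I b = a \<bullet> b" by (simp add: I_skew II)

lemma E_I': "a \<in> E \<Longrightarrow> b \<in> E \<Longrightarrow> I a \<bullet> b = 0" by (simp add: I_skew E_I)

lemmas I_simps = linear_add[OF I_lin] linear_diff[OF I_lin] linear_neg[OF I_lin]
  linear_scale[OF I_lin] linear_0[OF I_lin]

lemmas J_simps = linear_add[OF J_lin] linear_diff[OF J_lin] linear_neg[OF J_lin]
  linear_scale[OF J_lin] linear_0[OF J_lin]

lemma e': "e0 \<bullet> e = 0" "e1 \<bullet> e = 0" "e1 \<bullet> e0 = 0"
  using e by (simp_all add: inner_commute)

lemma I_continuous [continuous_intros]: "continuous_on X f \<Longrightarrow> continuous_on X (\<lambda>x. I (f x))"
  by (rule bounded_linear.continuous_on) (use I_lin in \<open>simp_all add: linear_conv_bounded_linear\<close>)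

lemma J_continuous [continuous_intros]: "continuous_on X f \<Longrightarrow> continuous_on X (\<lambda>x. J (f x))"
  by (rule bounded_linear.continuous_on) (use J_lin in \<open>simp_all add: linear_conv_bounded_linear\<close>)

lemma split_zero: assumes "a \<in> E" "b \<in> E" "a + I b = 0" shows "a = 0" "b = 0"
proof -
  have "(a + I b) \<bullet> a = a \<bullet> a" using assms(1,2) by (simp add: inner_add_left E_I')
  then show a: "a = 0" using assms(3) by simp
  then have "I (I b) = 0" using assms(3) by (simp add: I_simps)
  then show "b = 0" by (simp add: II)
qed

abbreviation K :: "'v set" where "K \<equiv> span {e, I e}"

text \<open>Such a vector is orthogonal to \<open>K\<close>, so independence from \<open>K\<close>
  reduces to not vanishing.\<close>

lemma notin_K:
  assumes "a \<in> E" "b \<in> E" "a \<bullet> e = 0" "b \<bullet> e = 0" "a + I b \<noteq> 0"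
  shows "a + I b \<notin> K"
  by (rule notin_span_orthogonal[OF assms(5)])
     (use assms e in \<open>auto simp: inner_add_left E_I E_I' I_I\<close>)

definition pr :: "'v \<Rightarrow> 'v" where "pr a = a - (a \<bullet> e) *\<^sub>R e"
definition k0 :: "'v \<Rightarrow> 'v \<Rightarrow> 'v" where "k0 u v = (v \<bullet> e) *\<^sub>R pr u + I (pr v)"
text \<open>Interpolates between the reflection vectors wanted at the poles:
  \<open>2 *\<^sub>R u\<close> at \<open>v = e\<close> and \<open>2 *\<^sub>R e0\<close> at
  \<open>v = - e\<close>.\<close>

definition A :: "'v \<Rightarrow> 'v \<Rightarrow> 'v" where "A u v = (1 + v \<bullet> e) *\<^sub>R pr u + (1 - v \<bullet> e) *\<^sub>R e0"
definition w :: "'v \<Rightarrow> 'v \<Rightarrow> 'v" where "w u v = A u v + I (pr v)"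
text \<open>Equals \<open>u\<close> at the pole \<open>v = e\<close> and the reflection of
  \<open>u\<close> in \<open>e0\<close> at \<open>v = - e\<close>. In between, the coefficient of
  \<open>e0\<close> is the determinant of the projections of \<open>v\<close> and \<open>u\<close>
  to the plane of \<open>e\<close> and \<open>e0\<close>.\<close>

definition Phi :: "'v \<Rightarrow> 'v \<Rightarrow> 'v"
  where "Phi u v = ((v \<bullet> e) * (u \<bullet> e0) - (u \<bullet> e) * (v \<bullet> e0)) *\<^sub>R e0 + (pr u - (u \<bullet> e0) *\<^sub>R e0)"
definition refl :: "'v \<Rightarrow> 'v \<Rightarrow> 'v" where "refl r y = y - (y \<bullet> r) *\<^sub>R ((2 / (r \<bullet> r)) *\<^sub>R r)"

lemma pr_E: "a \<in> E \<Longrightarrow> pr a \<in> E" using E e(1) by (simp add: pr_def subspace_diff subspace_scale)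
lemma pr_e: "pr a \<bullet> e = 0" "e \<bullet> pr a = 0" using e by (simp_all add: pr_def inner_diff_left inner_diff_right inner_commute)
lemma A_E: "u \<in> E \<Longrightarrow> A u v \<in> E"
  using E e pr_E by (simp add: A_def subspace_add subspace_scale)
lemma A_e: "A u v \<bullet> e = 0" using e' by (simp add: A_def inner_add_left pr_e)
lemma Phi_E: "u \<in> E \<Longrightarrow> Phi u v \<in> E"
  using E e pr_E by (simp add: Phi_def subspace_add subspace_scale subspace_diff)
lemma Phi_e: "Phi u v \<bullet> e = 0" using e' by (simp add: Phi_def inner_add_left inner_diff_left pr_e)

lemma refl_refl: "r \<noteq> 0 \<Longrightarrow> refl r (refl r y) = y"
  by (simp add: refl_def inner_diff_left)

lemma refl_inj: "r \<noteq> 0 \<Longrightarrow> inj (refl r)"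
  by (metis injI refl_refl)

context
  fixes u v :: 'v
  assumes uv: "u \<in> E" "v \<in> E" "u \<bullet> u = 1" "v \<bullet> v = 1" "u \<bullet> v = 0"
begin

lemma vu: "v \<bullet> u = 0" using uv(5) by (simp add: inner_commute)

text \<open>A unit vector with \<open>pr v = 0\<close> is one of the two poles; the case
  distinctions below reduce to these.\<close>

lemma pr_v_0:
  assumes "pr v = 0"
  shows "v \<bullet> e = 1 \<or> v \<bullet> e = - 1" "u \<bullet> e = 0" "v \<bullet> e0 = 0" "pr u = u"
proof -
  have v: "v = (v \<bullet> e) *\<^sub>R e" using assms unfolding pr_def by (rule eq_iff_diff_eq_0[THEN iffD2])
  have ip: "v \<bullet> y = (v \<bullet> e) * (e \<bullet> y)" for y
    using arg_cong[OF v, of "\<lambda>x. x \<bullet> y"] by simp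
  have "v \<bullet> v = (v \<bullet> e) * (v \<bullet> e)" using ip[of v] by (simp only: inner_commute[of e v])
  then have 1: "(v \<bullet> e) * (v \<bullet> e) = 1" using uv by simp
  then show "v \<bullet> e = 1 \<or> v \<bullet> e = - 1" by (simp add: square_eq_1_iff)
  have "v \<bullet> u = (v \<bullet> e) * (u \<bullet> e)" using ip[of u] by (simp only: inner_commute[of e u])
  then show ue: "u \<bullet> e = 0" using vu 1 by auto
  show "v \<bullet> e0 = 0" using ip[of e0] e by simp
  show "pr u = u" using ue by (simp add: pr_def)
qed

lemma k0_ne_0: "k0 u v \<noteq> 0"
proof
  assume "k0 u v = 0"
  then have 0: "(v \<bullet> e) *\<^sub>R pr u = 0" "pr v = 0"
    using split_zero[of "(v \<bullet> e) *\<^sub>R pr u" "pr v"] uv E pr_E by (auto simp: k0_def subspace_scale)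
  then show False using pr_v_0[OF 0(2)] uv(3) by auto
qed

lemma w_ne_0: "w u v \<noteq> 0"
proof
  assume "w u v = 0"
  then have 0: "A u v = 0" "pr v = 0"
    using split_zero[OF A_E[OF uv(1), of v] pr_E[OF uv(2)]] by (simp_all add: w_def)
  then show False using pr_v_0[OF 0(2)] uv(3) e(5) by (auto simp: A_def)
qed

text \<open>The vector \<open>w u v\<close> is orthogonal to \<open>K\<close>, so the reflection
  alters only the third vector of the frame.\<close>

lemma refl_w_K: "y \<in> K \<Longrightarrow> refl (w u v) y = y"
proof -
  assume y: "y \<in> K"
  have "w u v \<bullet> e = 0" "w u v \<bullet> I e = 0"
    using uv e A_E pr_E by (simp_all add: w_def inner_add_left A_e E_I E_I' I_I pr_e)
  then have "orthogonal (w u v) y"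
    by (intro orthogonal_to_span[OF y]) (auto simp: orthogonal_def)
  then show ?thesis by (simp add: refl_def orthogonal_def inner_commute)
qed

definition \<mu> where "\<mu> = (k0 u v \<bullet> w u v) * (2 / (w u v \<bullet> w u v))"

lemma refl_k0: "refl (w u v) (k0 u v) = ((v \<bullet> e) *\<^sub>R pr u - \<mu> *\<^sub>R A u v) + I ((1 - \<mu>) *\<^sub>R pr v)"
proof -
  have "refl (w u v) (k0 u v) = k0 u v - \<mu> *\<^sub>R w u v" by (simp add: refl_def \<mu>_def)
  then show ?thesis by (simp add: k0_def w_def I_simps algebra_simps)
qed

lemma refl_k0_ne_0: "refl (w u v) (k0 u v) \<noteq> 0"
  using refl_refl[OF w_ne_0, of "k0 u v"] k0_ne_0 by (auto simp: refl_def)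

text \<open>The purpose of \<open>w\<close>: at \<open>v = e\<close> the reflection in
  \<open>u\<close> takes \<open>k0 u v = u\<close> to \<open>- u\<close>; at \<open>v = - e\<close>
  the reflection in \<open>e0\<close> takes \<open>- u\<close> to minus the mirror image of
  \<open>u\<close>.\<close>

lemma refl_k0_pole:
  assumes "pr v = 0"
  shows "refl (w u v) (k0 u v) = - Phi u v" "Phi u v \<noteq> 0"
proof -
  note v0 = pr_v_0[OF assms]
  have "u \<noteq> 0" using uv by auto
  from v0(1) have "refl (w u v) (k0 u v) = - Phi u v \<and> Phi u v \<noteq> 0"
  proof
    assume d: "v \<bullet> e = 1"
    then have k: "k0 u v = u" "w u v = 2 *\<^sub>R u" "Phi u v = u"
      using v0 assms by (simp_all add: k0_def w_def A_def Phi_def I_simps)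
    have "refl (2 *\<^sub>R u) u = u - 2 *\<^sub>R u" using uv(3) by (simp add: refl_def)
    then have "refl (2 *\<^sub>R u) u = - u" by (simp add: scaleR_2)
    then show ?thesis unfolding k using \<open>u \<noteq> 0\<close> by blast
  next
    assume d: "v \<bullet> e = - 1"
    then have k: "k0 u v = - u" "w u v = 2 *\<^sub>R e0"
      using v0 assms by (simp_all add: k0_def w_def A_def I_simps)
    have "Phi u v = - ((u \<bullet> e0) *\<^sub>R e0) + (u - (u \<bullet> e0) *\<^sub>R e0)"
      using v0 d by (simp add: Phi_def)
    also have "\<dots> = u - (2 * (u \<bullet> e0)) *\<^sub>R e0"
      unfolding mult_2 scaleR_add_left by simp
    finally have P: "Phi u v = u - (2 * (u \<bullet> e0)) *\<^sub>R e0" .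
    have "e0 \<bullet> u = u \<bullet> e0" by (rule inner_commute)
    then have "Phi u v \<bullet> Phi u v = 1"
      unfolding P using uv(3) e(5) by (simp add: inner_diff_left inner_diff_right)
    then have "Phi u v \<noteq> 0" by auto
    moreover have "refl (w u v) (k0 u v) = - Phi u v"
      unfolding P k refl_def using e(5) by simp
    ultimately show ?thesis by blast
  qed
  then show "refl (w u v) (k0 u v) = - Phi u v" "Phi u v \<noteq> 0" by auto
qed

text \<open>As \<open>b = I a\<close>, the first two vectors always span a complex line. The summand
  \<open>(v \<bullet> e) *\<^sub>R u\<close>, which does not change the span at
  \<open>s = 0\<close>, and the sign of \<open>s *\<^sub>R I e\<close> are chosen such that a linear
  dependence would force \<open>\<alpha>\<^sup>2 * s * (1 - s) = - 1\<close>.\<close>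

lemma notin_frame:
  assumes s: "0 \<le> s" "s \<le> 1"
  defines "a \<equiv> (1 - s) *\<^sub>R u - s *\<^sub>R I e" and "b \<equiv> (1 - s) *\<^sub>R I u + s *\<^sub>R e"
  shows "a \<noteq> 0" "b \<notin> span {a}" "(v \<bullet> e) *\<^sub>R u + I v \<notin> span {b, a}"
proof -
  have ip: "a \<bullet> u = 1 - s" "a \<bullet> v = 0" "a \<bullet> I u = - (s * (u \<bullet> e))" "a \<bullet> I v = - (s * (v \<bullet> e))"
    "b \<bullet> u = s * (u \<bullet> e)" "b \<bullet> v = s * (v \<bullet> e)" "b \<bullet> I u = 1 - s" "b \<bullet> I v = 0"
    using uv e vu by (simp_all add: a_def b_def inner_add_left inner_diff_left E_I E_I' I_I
        inner_commute[of e u] inner_commute[of e v])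
  have ba: "b = I a" by (simp add: a_def b_def I_simps II)
  have aa: "a \<bullet> a = (1 - s)\<^sup>2 + s\<^sup>2"
    using uv e by (simp add: a_def inner_diff_left inner_diff_right E_I E_I' I_I power2_eq_square)
  have "a \<bullet> a \<noteq> 0" unfolding aa using s by (simp add: sum_power2_eq_zero_iff)
  then show a0: "a \<noteq> 0" by auto
  have "I a \<bullet> a = 0" using I_skew[of a a] by (simp add: inner_commute)
  moreover have "I a \<noteq> 0" using a0 I_I[of a a] by (metis inner_eq_zero_iff)
  ultimately show "b \<notin> span {a}" unfolding ba by (intro notin_span_orthogonal) auto
  show "(v \<bullet> e) *\<^sub>R u + I v \<notin> span {b, a}"
  proof
    assume "(v \<bullet> e) *\<^sub>R u + I v \<in> span {b, a}"
    then obtain \<beta> \<alpha> where "((v \<bullet> e) *\<^sub>R u + I v) - \<beta> *\<^sub>R b = \<alpha> *\<^sub>R a"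
      by (auto simp: span_breakdown_eq)
    then have n: "(v \<bullet> e) *\<^sub>R u + I v = \<alpha> *\<^sub>R a + \<beta> *\<^sub>R b" by (simp add: algebra_simps)
    define d where "d = v \<bullet> e"
    define c where "c = u \<bullet> e"
    have "((v \<bullet> e) *\<^sub>R u + I v) \<bullet> u = d" "((v \<bullet> e) *\<^sub>R u + I v) \<bullet> v = 0"
      "((v \<bullet> e) *\<^sub>R u + I v) \<bullet> I u = 0" "((v \<bullet> e) *\<^sub>R u + I v) \<bullet> I v = 1"
      using uv vu by (simp_all add: inner_add_left E_I E_I' I_I d_def)
    then have 1: "\<alpha> * (1 - s) + \<beta> * (s * c) = d" "\<beta> * (s * d) = 0"
        "\<beta> * (1 - s) = \<alpha> * (s * c)" "- (\<alpha> * (s * d)) = 1"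
      unfolding n by (simp_all add: inner_add_left ip d_def c_def)
    then have "\<alpha> \<noteq> 0" "s \<noteq> 0" "d \<noteq> 0" by auto
    then have "\<beta> = 0" using 1(2) by simp
    then have D: "d = \<alpha> * (1 - s)" using 1(1) by simp
    have "\<alpha> * (s * d) = \<alpha> * \<alpha> * (s * (1 - s))" unfolding D by (simp add: mult_ac)
    then have "- (\<alpha> * \<alpha> * (s * (1 - s))) = 1" using 1(4) by linarith
    moreover have "0 \<le> \<alpha> * \<alpha> * (s * (1 - s))" using s by simp
    ultimately show False by linarith
  qed
qed

text \<open>Away from the poles \<open>pr v\<close> and \<open>J (pr v)\<close> are independent, so
  the second component can vanish only for \<open>s = 0\<close>, where the vector is the reflected
  \<open>k0 u v\<close>. The turn by \<open>J\<close> makes the uncontrolled sign of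
  \<open>1 - \<mu>\<close> irrelevant. At the poles both ends of the segment are
  \<open>- Phi u v\<close>.\<close>

lemma notin_K_refl:
  assumes s: "0 \<le> s" "s \<le> 1"
  shows "(1 - s) *\<^sub>R refl (w u v) (k0 u v) + s *\<^sub>R (- Phi u v + I (J (pr v))) \<notin> K"
proof -
  let ?X = "(1 - s) *\<^sub>R ((v \<bullet> e) *\<^sub>R pr u - \<mu> *\<^sub>R A u v) + s *\<^sub>R (- Phi u v)"
  let ?Y = "((1 - s) * (1 - \<mu>)) *\<^sub>R pr v + s *\<^sub>R J (pr v)"
  have prv: "pr v \<in> E" "pr v \<bullet> e = 0" using uv pr_E pr_e by auto
  note Jv = J[OF prv]
  have eq: "(1 - s) *\<^sub>R refl (w u v) (k0 u v) + s *\<^sub>R (- Phi u v + I (J (pr v))) = ?X + I ?Y"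
    unfolding refl_k0 by (simp add: I_simps algebra_simps)
  have X: "?X \<in> E" "?X \<bullet> e = 0"
    using E uv A_E[OF uv(1)] Phi_E[OF uv(1)] pr_E
    by (simp_all add: subspace_add subspace_scale subspace_diff subspace_neg inner_add_left inner_diff_left pr_e A_e Phi_e)
  have Y: "?Y \<in> E" "?Y \<bullet> e = 0"
    using E prv Jv by (simp_all add: subspace_add subspace_scale inner_add_left)
  have "?X + I ?Y \<noteq> 0"
  proof
    assume 0: "?X + I ?Y = 0"
    have Y0: "?Y = 0" using split_zero(2)[OF X(1) Y(1) 0] .
    show False
    proof (cases "pr v = 0")
      case True
      have "(1 - s) *\<^sub>R refl (w u v) (k0 u v) + s *\<^sub>R (- Phi u v + I (J (pr v))) = - Phi u v"
        using True by (simp add: refl_k0_pole[OF True] I_simps J_simps algebra_simps)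
      then show False using 0 refl_k0_pole(2)[OF True] unfolding eq by simp
    next
      case False
      have "?Y \<bullet> J (pr v) = s * (pr v \<bullet> pr v)" using Jv by (simp add: inner_add_left inner_commute[of "pr v" "J (pr v)"])
      then have "s = 0" using Y0 False by simp
      then show False using 0 refl_k0_ne_0 unfolding eq[symmetric] by simp
    qed
  qed
  then show ?thesis unfolding eq using notin_K[OF X(1) Y(1) X(2) Y(2)] by blast
qed

text \<open>A zero would make \<open>Phi u v\<close> equal to \<open>\<tau> *\<^sub>R e1\<close> and
  \<open>pr v\<close> equal to \<open>(- 2 * \<tau>) *\<^sub>R e0\<close>, and then
  \<open>u = \<tau> *\<^sub>R e1\<close>. So \<open>\<tau>\<^sup>2 = 1\<close>, while the unit
  vector \<open>v\<close> requires \<open>4 * \<tau>\<^sup>2 \<le> 1\<close>. The factor 2 in the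
  constant vector produces this contradiction.\<close>

lemma notin_K_const:
  assumes s: "0 \<le> s" "s \<le> 1"
  shows "(1 - s) *\<^sub>R (- Phi u v + I (J (pr v))) + s *\<^sub>R (e1 + 2 *\<^sub>R I (J e0)) \<notin> K"
proof -
  let ?X = "(1 - s) *\<^sub>R (- Phi u v) + s *\<^sub>R e1"
  let ?Y = "J ((1 - s) *\<^sub>R pr v + (2 * s) *\<^sub>R e0)"
  have eq: "(1 - s) *\<^sub>R (- Phi u v + I (J (pr v))) + s *\<^sub>R (e1 + 2 *\<^sub>R I (J e0)) = ?X + I ?Y"
    by (simp add: I_simps J_simps algebra_simps)
  have y: "(1 - s) *\<^sub>R pr v + (2 * s) *\<^sub>R e0 \<in> E" "((1 - s) *\<^sub>R pr v + (2 * s) *\<^sub>R e0) \<bullet> e = 0"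
    using E e e' uv pr_E by (simp_all add: subspace_add subspace_scale inner_add_left pr_e)
  note Y = J[OF y]
  have X: "?X \<in> E" "?X \<bullet> e = 0"
    using E e e' uv Phi_E[OF uv(1), of v]
    by (simp_all add: subspace_add subspace_diff subspace_scale subspace_neg inner_add_left inner_diff_left Phi_e)
  have "?X + I ?Y \<noteq> 0"
  proof
    assume 0: "?X + I ?Y = 0"
    have X0: "?X = 0" and "?Y = 0" using split_zero[OF X(1) _ 0] Y by auto
    then have "((1 - s) *\<^sub>R pr v + (2 * s) *\<^sub>R e0) \<bullet> ((1 - s) *\<^sub>R pr v + (2 * s) *\<^sub>R e0) = 0"
      using Y by simp
    then have Y0: "(1 - s) *\<^sub>R pr v + (2 * s) *\<^sub>R e0 = 0" by simp
    have s1: "s \<noteq> 1" using X0 e by auto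
    define \<tau> where "\<tau> = s / (1 - s)"
    have s\<tau>: "(1 - s) * \<tau> = s" using s1 by (simp add: \<tau>_def)
    have "(1 - s) *\<^sub>R Phi u v = s *\<^sub>R e1" using X0 by simp
    then have "(1 - s) *\<^sub>R Phi u v = (1 - s) *\<^sub>R (\<tau> *\<^sub>R e1)" by (simp add: s\<tau>)
    then have Phi: "Phi u v = \<tau> *\<^sub>R e1" using s1 by (simp only: scaleR_cancel_left) simp
    have "(1 - s) *\<^sub>R pr v = (1 - s) *\<^sub>R ((- 2 * \<tau>) *\<^sub>R e0)"
    proof -
      have "(1 - s) *\<^sub>R pr v = - ((2 * s) *\<^sub>R e0)" using Y0 by (simp add: eq_neg_iff_add_eq_0)
      also have "2 * s = (1 - s) * (2 * \<tau>)" using s\<tau> by linarith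
      finally show ?thesis by simp
    qed
    then have prv: "pr v = (- 2 * \<tau>) *\<^sub>R e0" using s1 by (simp only: scaleR_cancel_left) simp
    define c where "c = u \<bullet> e"
    define d where "d = v \<bullet> e"
    define p where "p = u \<bullet> e0"
    have v_eq: "v = d *\<^sub>R e + (- 2 * \<tau>) *\<^sub>R e0"
      unfolding prv[symmetric] by (simp add: pr_def d_def)
    have q: "v \<bullet> e0 = - 2 * \<tau>" using e by (subst v_eq) (simp add: inner_diff_left)
    have "Phi u v \<bullet> e0 = d * p - c * (v \<bullet> e0)"
      using e e' by (simp add: Phi_def inner_add_left inner_diff_left pr_def c_def d_def p_def)
    then have 1: "d * p + 2 * \<tau> * c = 0" using Phi q e' by (simp add: mult_ac)
    have "u \<bullet> v = d * c - 2 * \<tau> * p" by (subst v_eq) (simp add: inner_diff_right c_def p_def)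
    then have 2: "d * c - 2 * \<tau> * p = 0" using uv by simp
    have "v \<bullet> v = d * d + 4 * \<tau> * \<tau>"
      using e e' unfolding v_eq by (simp add: inner_diff_left inner_diff_right)
    then have 3: "d * d + 4 * \<tau> * \<tau> = 1" using uv by simp
    \<comment> \<open>Facts 1 and 2 are a homogeneous linear system for \<open>c\<close> and
      \<open>p\<close> with the matrix of a rotation, by fact 3; this is the identity for products
      of sums of two squares.\<close>
    have "(c * c + p * p) * (d * d + 4 * \<tau> * \<tau>) = (d * c - 2 * \<tau> * p)\<^sup>2 + (d * p + 2 * \<tau> * c)\<^sup>2"
      by (simp add: power2_eq_square algebra_simps)
    then have "c * c + p * p = 0" using 1 2 3 by simp
    then have cp: "c = 0" "p = 0" by (auto simp: sum_squares_eq_zero_iff)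
    have "Phi u v = u" using cp q by (simp add: Phi_def pr_def c_def[symmetric] p_def[symmetric])
    then have "u = \<tau> *\<^sub>R e1" using Phi by simp
    then have "\<tau> * \<tau> = 1" using uv(3) e by simp
    then have "d * d = - 3" using 3 by simp
    then show False by (metis neg_0_le_iff_le not_numeral_le_zero zero_le_square)
  qed
  then show ?thesis
    unfolding eq using notin_K[OF X(1) _ X(2)] Y by blast
qed

end

lemma pr_continuous [continuous_intros]:
  "continuous_on Y f \<Longrightarrow> continuous_on Y (\<lambda>z. pr (f z))"
  unfolding pr_def by (intro continuous_intros)

lemma frame_continuous [continuous_intros]:
  assumes "continuous_on Y f" "continuous_on Y g"
  shows "continuous_on Y (\<lambda>z. k0 (f z) (g z))" "continuous_on Y (\<lambda>z. w (f z) (g z))"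
    "continuous_on Y (\<lambda>z. Phi (f z) (g z))"
  unfolding k0_def w_def Phi_def A_def by (intro continuous_intros assms)+

lemma gl_equivalent_two_frame:
  fixes u v :: "'b::metric_space \<Rightarrow> 'v"
  assumes X: "compact X" and cu: "continuous_on X u" and cv: "continuous_on X v"
    and uv: "\<And>x. x \<in> X \<Longrightarrow> u x \<in> E" "\<And>x. x \<in> X \<Longrightarrow> v x \<in> E" "\<And>x. x \<in> X \<Longrightarrow> u x \<bullet> u x = 1"
      "\<And>x. x \<in> X \<Longrightarrow> v x \<bullet> v x = 1" "\<And>x. x \<in> X \<Longrightarrow> u x \<bullet> v x = 0"
  shows "gl_equivalent X (\<lambda>x. span {I (v x), I (u x), u x}) (\<lambda>_. span (insert (e1 + 2 *\<^sub>R I (J e0)) K))"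
proof -
  have snd [continuous_intros]: "continuous_on ({0..1::real} \<times> X) (\<lambda>z. u (snd z))"
    "continuous_on ({0..1::real} \<times> X) (\<lambda>z. v (snd z))"
    by (auto intro!: continuous_on_compose2[OF cu] continuous_on_compose2[OF cv] continuous_intros)
  have 1: "gl_equivalent X (\<lambda>x. span {I (v x), I (u x), u x}) (\<lambda>x. span (insert (k0 (u x) (v x)) K))"
  proof -
    let ?a = "\<lambda>s x. (1 - s) *\<^sub>R u x - s *\<^sub>R I e" and ?b = "\<lambda>s x. (1 - s) *\<^sub>R I (u x) + s *\<^sub>R e"
    let ?c = "\<lambda>s x. (v x \<bullet> e) *\<^sub>R u x + I (v x)"
    have h: "gl_equivalent X (\<lambda>x. span {?c 0 x, ?b 0 x, ?a 0 x}) (\<lambda>x. span {?c 1 x, ?b 1 x, ?a 1 x})"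
    proof (rule gl_equivalent_triple_homotopy[OF X])
      fix s :: real and x assume s: "s \<in> {0..1}" and x: "x \<in> X"
      note nf = notin_frame[OF uv(1)[OF x] uv(2)[OF x] uv(3)[OF x] uv(4)[OF x] uv(5)[OF x], of s]
      show "?a s x \<noteq> 0" "?b s x \<notin> span {?a s x}" "?c s x \<notin> span {?b s x, ?a s x}"
        using nf s by auto
    qed (auto intro!: continuous_intros)
    have s0: "span {?c 0 x, ?b 0 x, ?a 0 x} = span {I (v x), I (u x), u x}" for x
      using span_insert_add[of "(v x \<bullet> e) *\<^sub>R u x" "{I (u x), u x}" "I (v x)"]
      by (simp add: add.commute span_base span_scale)
    have s1: "span {?c 1 x, ?b 1 x, ?a 1 x} = span (insert (k0 (u x) (v x)) K)" for x
    proof -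
      have n: "span {e, - I e} = K"
        using span_insert_scale[of "-1" "I e" "{e}"] by (simp add: insert_commute)
      have "k0 (u x) (v x) + ((v x \<bullet> e) * (u x \<bullet> e)) *\<^sub>R e + (v x \<bullet> e) *\<^sub>R I e = ?c 1 x"
        by (simp add: k0_def pr_def I_simps algebra_simps)
      moreover have "((v x \<bullet> e) * (u x \<bullet> e)) *\<^sub>R e + (v x \<bullet> e) *\<^sub>R I e \<in> span K"
        by (intro span_add span_scale) (auto intro: span_base)
      ultimately have "span (insert (?c 1 x) K) = span (insert (k0 (u x) (v x)) K)"
        by (metis (no_types, lifting) add.assoc span_insert_add)
      then show ?thesis using span_insert_span[of "?c 1 x" "{e, - I e}"] n by simp
    qed
    show ?thesis using h unfolding s0 s1 .
  qed
  have 2: "gl_equivalent X (\<lambda>x. span (insert (k0 (u x) (v x)) K))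
      (\<lambda>x. span (insert (refl (w (u x) (v x)) (k0 (u x) (v x))) K))"
  proof (rule gl_equivalentI)
    have w0: "w (u x) (v x) \<noteq> 0" if "x \<in> X" for x using w_ne_0 uv that by blast
    show fam: "linear_family X (\<lambda>x. refl (w (u x) (v x)))"
      unfolding refl_def
      by (intro linear_family_diff linear_family_id linear_family_rank1 continuous_intros cu cv)
         (use w0 in auto)
    fix x assume x: "x \<in> X"
    show "inj (refl (w (u x) (v x)))" using refl_inj w0[OF x] by blast
    have "refl (w (u x) (v x)) ` K = K"
      using refl_w_K[OF uv(1)[OF x] uv(2)[OF x] uv(3)[OF x] uv(4)[OF x] uv(5)[OF x]] by simp
    then show "refl (w (u x) (v x)) ` span (insert (k0 (u x) (v x)) K) =
        span (insert (refl (w (u x) (v x)) (k0 (u x) (v x))) K)"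
      using linear_span_image[OF linear_family_linear[OF fam x]] by (metis image_insert)
  qed
  have 3: "gl_equivalent X (\<lambda>x. span (insert (refl (w (u x) (v x)) (k0 (u x) (v x))) K))
      (\<lambda>x. span (insert (- Phi (u x) (v x) + I (J (pr (v x)))) K))"
  proof -
    have w0: "w (u (snd z)) (v (snd z)) \<noteq> 0" if "z \<in> {0..1::real} \<times> X" for z
      using w_ne_0 uv that by auto
    let ?n = "\<lambda>s x. (1 - s) *\<^sub>R refl (w (u x) (v x)) (k0 (u x) (v x)) + s *\<^sub>R (- Phi (u x) (v x) + I (J (pr (v x))))"
    have "gl_equivalent X (\<lambda>x. span (insert (?n 0 x) K)) (\<lambda>x. span (insert (?n 1 x) K))"
    proof (rule gl_equivalent_insert_homotopy[OF X subspace_span])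
      show "continuous_on ({0..1} \<times> X) (\<lambda>z. ?n (fst z) (snd z))"
        unfolding refl_def by (intro continuous_intros) (use w0 in auto)
      show "?n s x \<notin> K" if "s \<in> {0..1}" "x \<in> X" for s x
        using notin_K_refl uv that by auto
    qed
    then show ?thesis by simp
  qed
  have 4: "gl_equivalent X (\<lambda>x. span (insert (- Phi (u x) (v x) + I (J (pr (v x)))) K))
      (\<lambda>x. span (insert (e1 + 2 *\<^sub>R I (J e0)) K))"
  proof -
    let ?n = "\<lambda>s x. (1 - s) *\<^sub>R (- Phi (u x) (v x) + I (J (pr (v x)))) + s *\<^sub>R (e1 + 2 *\<^sub>R I (J e0))"
    have "gl_equivalent X (\<lambda>x. span (insert (?n 0 x) K)) (\<lambda>x. span (insert (?n 1 x) K))"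
    proof (rule gl_equivalent_insert_homotopy[OF X subspace_span])
      show "continuous_on ({0..1} \<times> X) (\<lambda>z. ?n (fst z) (snd z))"
        by (intro continuous_intros)
      show "?n s x \<notin> K" if "s \<in> {0..1}" "x \<in> X" for s x
        using notin_K_const uv that by auto
    qed
    then show ?thesis by simp
  qed
  show ?thesis
    by (rule gl_equivalent_trans[OF gl_equivalent_trans[OF gl_equivalent_trans[OF 1 2] 3] 4])
qed

end

section \<open>The focal submanifold \<open>M\<^sub>+\<close>\<close>

text \<open>The argument \<open>c\<close> is read from index 1 on, and \<open>c \<alpha>\<close>
  stands in place \<open>\<alpha> + 1\<close>. A frame on \<open>p 1, ..., p m\<close> thus has
  \<open>m + 2\<close> places.\<close>

definition frame :: "'v \<Rightarrow> 'v \<Rightarrow> (nat \<Rightarrow> 'v) \<Rightarrow> nat \<Rightarrow> 'v"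
  where "frame a b c i = (if i = 0 then a else if i = 1 then b else c (i - 1))"

lemma frame_image: "frame a b c ` {..<m + 2} = insert a (insert b (c ` {1..m}))"
proof -
  have "{..<m + 2} = insert 0 (insert 1 (Suc ` {1..m}))"
  proof
    show "{..<m + 2} \<subseteq> insert 0 (insert 1 (Suc ` {1..m}))"
    proof
      fix i assume "i \<in> {..<m + 2}"
      then have "i = 0 \<or> i = 1 \<or> i = Suc (i - 1) \<and> i - 1 \<in> {1..m}" by auto
      then show "i \<in> insert 0 (insert 1 (Suc ` {1..m}))" by blast
    qed
  qed auto
  then have "frame a b c ` {..<m + 2} = insert (frame a b c 0) (insert (frame a b c 1) ((\<lambda>i. frame a b c (Suc i)) ` {1..m}))"
    by (simp only: image_insert image_image)
  also have "(\<lambda>i. frame a b c (Suc i)) ` {1..m} = c ` {1..m}"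
    by (intro image_cong) (auto simp: frame_def)
  finally show ?thesis by (simp add: frame_def)
qed

lemma frame_independent:
  fixes a b :: "'v::euclidean_space"
  assumes ne: "a \<noteq> 0" "b \<noteq> 0" "\<And>\<alpha>. 1 \<le> \<alpha> \<Longrightarrow> \<alpha> \<le> m \<Longrightarrow> c \<alpha> \<noteq> 0"
    and orth: "b \<bullet> a = 0" "\<And>\<alpha>. 1 \<le> \<alpha> \<Longrightarrow> \<alpha> \<le> m \<Longrightarrow> c \<alpha> \<bullet> a = 0" "\<And>\<alpha>. 1 \<le> \<alpha> \<Longrightarrow> \<alpha> \<le> m \<Longrightarrow> c \<alpha> \<bullet> b = 0"
      "\<And>\<alpha> \<beta>. 1 \<le> \<alpha> \<Longrightarrow> \<alpha> \<le> m \<Longrightarrow> 1 \<le> \<beta> \<Longrightarrow> \<beta> \<le> m \<Longrightarrow> \<alpha> \<noteq> \<beta> \<Longrightarrow> c \<alpha> \<bullet> c \<beta> = 0"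
    and i: "i < m + 2"
  shows "frame a b c i \<notin> span ((\<lambda>j. frame a b c j) ` {..<i})"
proof (rule notin_span_orthogonal)
  show "frame a b c i \<noteq> 0" using ne i by (auto simp: frame_def)
  fix d assume "d \<in> (\<lambda>j. frame a b c j) ` {..<i}"
  then obtain j where "j < i" "d = frame a b c j" by auto
  then show "frame a b c i \<bullet> d = 0" using i orth by (auto simp: frame_def)
qed

lemma frame_continuous:
  fixes a b :: "'b::topological_space \<Rightarrow> 'v::euclidean_space"
  assumes "continuous_on X a" "continuous_on X b"
    "\<And>\<alpha>. 1 \<le> \<alpha> \<Longrightarrow> \<alpha> \<le> m \<Longrightarrow> continuous_on X (\<lambda>x. c x \<alpha>)" "i < m + 2"
  shows "continuous_on X (\<lambda>x. frame (a x) (b x) (c x) i)"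
proof -
  consider "i = 0" | "i = 1" | "i \<noteq> 0" "i \<noteq> 1" by blast
  then show ?thesis
  proof cases
    case 3
    then have "continuous_on X (\<lambda>x. c x (i - 1))" using assms(4) by (intro assms(3)) auto
    then show ?thesis using 3 by (simp add: frame_def)
  qed (use assms in \<open>simp_all add: frame_def\<close>)
qed

context clifford_system
begin

text \<open>The eigenspace components of \<open>x\<close>, multiplied by the square root of 2; they
  are unit vectors on \<open>M\<^sub>+\<close> because \<open>p 0 x\<close> is orthogonal to
  \<open>x\<close> there.\<close>

definition uu :: "real^'n \<Rightarrow> real^'n" where "uu x = (1 / sqrt 2) *\<^sub>R (x + p 0 x)"
definition ww :: "real^'n \<Rightarrow> real^'n" where "ww x = (1 / sqrt 2) *\<^sub>R (x - p 0 x)"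

lemma uu_continuous [continuous_intros]: "continuous_on X f \<Longrightarrow> continuous_on X (\<lambda>x. uu (f x))"
  and ww_continuous [continuous_intros]: "continuous_on X f \<Longrightarrow> continuous_on X (\<lambda>x. ww (f x))"
  unfolding uu_def ww_def by (intro continuous_intros; assumption)+

lemma uu_Eplus: "uu x \<in> Eplus" and ww_Eminus: "ww x \<in> Eminus"
  by (simp_all add: uu_def ww_def Eplus_def Eminus_def p_simps p_sq add.commute scaleR_diff_right)

lemma uu_ww: "uu x + ww x = sqrt 2 *\<^sub>R x" "uu x - ww x = sqrt 2 *\<^sub>R p 0 x"
proof -
  have s: "2 / sqrt 2 = sqrt (2::real)" by (simp add: real_div_sqrt)
  have "uu x + ww x = (1 / sqrt 2) *\<^sub>R (2 *\<^sub>R x)" "uu x - ww x = (1 / sqrt 2) *\<^sub>R (2 *\<^sub>R p 0 x)"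
    unfolding uu_def ww_def scaleR_2 scaleR_add_right[symmetric] scaleR_diff_right[symmetric] by simp_all
  then show "uu x + ww x = sqrt 2 *\<^sub>R x" "uu x - ww x = sqrt 2 *\<^sub>R p 0 x" by (simp_all add: s)
qed

lemma p_uu_ww: "p \<alpha> (uu x) + p \<alpha> (ww x) = sqrt 2 *\<^sub>R p \<alpha> x"
  using arg_cong[OF uu_ww(1), of "p \<alpha>" x] by (simp add: p_simps)

text \<open>For \<open>\<alpha> \<ge> 1\<close> the map \<open>p \<alpha>\<close> exchanges the
  eigenspaces, so only the cross terms contribute to \<open>p \<alpha> x \<bullet> x\<close>. They
  are equal by symmetry, hence both vanish.\<close>

lemma focal_plus_uu_ww:
  assumes x: "x \<in> focal_plus m P"
  shows "uu x \<bullet> uu x = 1" "ww x \<bullet> ww x = 1"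
    "\<And>\<alpha>. 1 \<le> \<alpha> \<Longrightarrow> \<alpha> \<le> m \<Longrightarrow> p \<alpha> (ww x) \<bullet> uu x = 0"
    "\<And>\<alpha>. 1 \<le> \<alpha> \<Longrightarrow> \<alpha> \<le> m \<Longrightarrow> p \<alpha> (uu x) \<bullet> ww x = 0"
proof -
  have x1: "x \<bullet> x = 1" and c: "\<And>\<alpha>. \<alpha> \<le> m \<Longrightarrow> p \<alpha> x \<bullet> x = 0"
    using x by (auto simp: focal_plus_iff coeff_def norm_eq_1)
  have c0: "p 0 x \<bullet> x = 0" "x \<bullet> p 0 x = 0" using c[of 0] by (simp_all add: inner_commute)
  have p0: "p 0 x \<bullet> p 0 x = 1" using p_inner[of 0 x x] x1 by simp
  show "uu x \<bullet> uu x = 1" "ww x \<bullet> ww x = 1"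
    using x1 p0 c0 by (simp_all add: uu_def ww_def inner_add_left inner_add_right inner_diff_left inner_diff_right)
  fix \<alpha> assume \<alpha>: "1 \<le> \<alpha>" "\<alpha> \<le> m"
  have 0: "p \<alpha> (uu x) \<bullet> uu x = 0" "p \<alpha> (ww x) \<bullet> ww x = 0"
    using p_Eplus[of \<alpha> "uu x"] p_Eminus[of \<alpha> "ww x"] \<alpha> Eplus_Eminus_orth uu_Eplus ww_Eminus by auto
  have e: "p \<alpha> (uu x) \<bullet> ww x = p \<alpha> (ww x) \<bullet> uu x" using p_sym[OF \<alpha>(2)] by (simp add: inner_commute)
  have "(p \<alpha> (uu x) + p \<alpha> (ww x)) \<bullet> (uu x + ww x) = 2 * (p \<alpha> x \<bullet> x)"
    unfolding p_uu_ww uu_ww(1) by simp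
  then have "p \<alpha> (uu x) \<bullet> ww x + p \<alpha> (ww x) \<bullet> uu x = 0"
    using 0 c[OF \<alpha>(2)] by (simp add: inner_add_left inner_add_right)
  then show "p \<alpha> (ww x) \<bullet> uu x = 0" "p \<alpha> (uu x) \<bullet> ww x = 0" using e by simp_all
qed

lemma p_uu_orth:
  assumes "a \<in> Eplus" "1 \<le> \<alpha>" "\<alpha> \<le> m"
  shows "p \<alpha> a \<bullet> a = 0" "b \<in> Eplus \<Longrightarrow> p \<alpha> a \<bullet> b = 0" 
  using p_Eplus[of \<alpha> a] Eplus_Eminus_orth assms by auto

lemma span_normal_eq:
  "span (insert x ((\<lambda>\<alpha>. p \<alpha> x) ` {..m})) =
    span (insert (uu x) (insert (ww x) ((\<lambda>\<alpha>. p \<alpha> (uu x) + p \<alpha> (ww x)) ` {1..m})))"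
  (is "span ?A = span ?B")
proof -
  have s: "(1 / sqrt 2) *\<^sub>R (sqrt 2 *\<^sub>R y) = y" for y :: "real^'n" by simp
  have x: "x = (1 / sqrt 2) *\<^sub>R (uu x + ww x)" unfolding uu_ww s ..
  have p0x: "p 0 x = (1 / sqrt 2) *\<^sub>R (uu x - ww x)" unfolding uu_ww s ..
  have pax: "p \<alpha> x = (1 / sqrt 2) *\<^sub>R (p \<alpha> (uu x) + p \<alpha> (ww x))" for \<alpha> unfolding p_uu_ww s ..
  have B: "uu x \<in> span ?B" "ww x \<in> span ?B" by (auto intro: span_base)
  have "?A \<subseteq> span ?B"
  proof -
    have "x \<in> span ?B" by (subst x) (intro span_scale span_add B)
    moreover have "p \<alpha> x \<in> span ?B" if "\<alpha> \<le> m" for \<alpha>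
    proof (cases "\<alpha> = 0")
      case True
      then show ?thesis unfolding True p0x by (intro span_scale span_diff B)
    next
      case False
      then have "p \<alpha> (uu x) + p \<alpha> (ww x) \<in> ?B" using that by auto
      then show ?thesis unfolding pax by (intro span_scale) (rule span_base)
    qed
    ultimately show ?thesis by auto
  qed
  moreover have "?B \<subseteq> span ?A"
  proof -
    have A: "x \<in> span ?A" "\<And>\<alpha>. \<alpha> \<le> m \<Longrightarrow> p \<alpha> x \<in> span ?A" by (auto intro: span_base)
    have "uu x \<in> span ?A" "ww x \<in> span ?A"
      unfolding uu_def ww_def by (intro span_scale span_add span_diff A; simp)+
    moreover have "p \<alpha> (uu x) + p \<alpha> (ww x) \<in> span ?A" if "\<alpha> \<le> m" for \<alpha>
      unfolding p_uu_ww using A(2)[OF that] by (rule span_scale)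
    ultimately show ?thesis by auto
  qed
  ultimately show ?thesis by (intro antisym span_minimal) auto
qed

text \<open>The terms \<open>p \<alpha> (ww x)\<close> are scaled down to 0. They lie in
  \<open>Eplus\<close> and the terms \<open>p \<alpha> (uu x)\<close> in \<open>Eminus\<close>, so
  the last \<open>m\<close> vectors stay orthogonal, with squared norm
  \<open>1 + (1 - s)\<^sup>2\<close>.\<close>

lemma gl_equivalent_focal_plus:
  "gl_equivalent (focal_plus m P) (\<lambda>x. span (insert x ((\<lambda>\<alpha>. p \<alpha> x) ` {..m})))
    (\<lambda>x. span (insert (uu x) (insert (ww x) ((\<lambda>\<alpha>. p \<alpha> (uu x)) ` {1..m}))))"
proof -
  let ?c = "\<lambda>s x \<alpha>. p \<alpha> (uu x) + (1 - s) *\<^sub>R p \<alpha> (ww x)"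
  have "gl_equivalent (focal_plus m P) (\<lambda>x. span ((\<lambda>i. frame (uu x) (ww x) (?c 0 x) i) ` {..<m + 2}))
      (\<lambda>x. span ((\<lambda>i. frame (uu x) (ww x) (?c 1 x) i) ` {..<m + 2}))"
  proof (rule gl_equivalent_frame_homotopy[OF level_compact])
    show "continuous_on ({0..1} \<times> focal_plus m P)
        (\<lambda>z. frame (uu (snd z)) (ww (snd z)) (?c (fst z) (snd z)) i)" if "i < m + 2" for i
      by (rule frame_continuous[OF _ _ _ that]) (auto intro!: continuous_intros)
    fix i and s :: real and x assume i: "i < m + 2" and s: "s \<in> {0..1}" and x: "x \<in> focal_plus m P"
    note f = focal_plus_uu_ww[OF x]
    show "frame (uu x) (ww x) (?c s x) i \<notin> span ((\<lambda>j. frame (uu x) (ww x) (?c s x) j) ` {..<i})"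
    proof (rule frame_independent[OF _ _ _ _ _ _ _ i])
      show "uu x \<noteq> 0" "ww x \<noteq> 0" using f(1,2) by auto
      show "ww x \<bullet> uu x = 0" using Eplus_Eminus_orth uu_Eplus ww_Eminus by blast
      fix \<alpha> assume \<alpha>: "1 \<le> \<alpha>" "\<alpha> \<le> m"
      have pE: "p \<beta> (uu x) \<in> Eminus" "p \<beta> (ww x) \<in> Eplus" if "1 \<le> \<beta>" "\<beta> \<le> m" for \<beta>
        using that p_Eplus[OF _ _ uu_Eplus, of \<beta>] p_Eminus[OF _ _ ww_Eminus, of \<beta>] by auto
      note o = Eplus_Eminus_orth[OF pE(2) pE(1)]
      have ip: "?c s x \<alpha> \<bullet> ?c s x \<beta> = (if \<alpha> = \<beta> then 1 + (1 - s)\<^sup>2 else 0)" if \<beta>: "1 \<le> \<beta>" "\<beta> \<le> m" for \<beta>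
        using o[OF \<alpha> \<beta>] o[OF \<beta> \<alpha>] f(1,2) \<alpha> \<beta>
        by (simp add: inner_add_left inner_add_right p_orth' power2_eq_square)
      show "?c s x \<alpha> \<bullet> ?c s x \<beta> = 0" if "1 \<le> \<beta>" "\<beta> \<le> m" "\<alpha> \<noteq> \<beta>" for \<beta>
        using ip that by simp
      have "1 + (1 - s)\<^sup>2 \<noteq> 0" by (simp add: add_nonneg_eq_0_iff)
      then have "?c s x \<alpha> \<bullet> ?c s x \<alpha> \<noteq> 0" using ip[OF \<alpha>] by simp
      then show "?c s x \<alpha> \<noteq> 0" by (metis inner_zero_left)
      show "?c s x \<alpha> \<bullet> uu x = 0" "?c s x \<alpha> \<bullet> ww x = 0"
        using f(3,4)[OF \<alpha>] Eplus_Eminus_orth[OF uu_Eplus pE(1)[OF \<alpha>]]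
          Eplus_Eminus_orth[OF pE(2)[OF \<alpha>] ww_Eminus] by (simp_all add: inner_add_left)
    qed
  qed
  then show ?thesis unfolding frame_image by (simp add: span_normal_eq)
qed

lemma trivialized_focal_plus:
  assumes "gl_equivalent (focal_plus m P)
    (\<lambda>x. span (insert (uu x) (insert (ww x) ((\<lambda>\<alpha>. p \<alpha> (uu x)) ` {1..m})))) (\<lambda>_. C)"
  shows "parallelizable (focal_plus m P)"
proof -
  have "trivialized (focal_plus m P) (tangent_space (focal_plus m P))"
    using orthogonal_comp_trivialized[OF gl_equivalent_trans[OF gl_equivalent_focal_plus assms]]
      trivialized_cong[of "focal_plus m P", OF tangent_space_focal_plus] by simp
  then show ?thesis
    unfolding parallelizable_def by (rule trivialized_imp_trivial_bundle[OF level_compact])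
qed

lemma parallelizable_focal_plus_complex:
  assumes J: "linear J" "\<And>a. a \<in> Eplus \<Longrightarrow> J a \<in> Eplus \<and> J a \<bullet> a = 0 \<and> J a \<bullet> J a = a \<bullet> a"
  shows "parallelizable (focal_plus m P)"
proof -
  let ?M = "focal_plus m P"
  have cJ [continuous_intros]: "continuous_on X f \<Longrightarrow> continuous_on X (\<lambda>x. J (f x))"
    for X :: "(real \<times> (real^'n)) set" and f
    by (rule bounded_linear.continuous_on) (use J(1) in \<open>simp_all add: linear_conv_bounded_linear\<close>)
  have cJ' [continuous_intros]: "continuous_on X J" for X
    by (rule linear_continuous_on) (use J(1) in \<open>simp add: linear_conv_bounded_linear\<close>)
  have 1: "gl_equivalent ?M (\<lambda>x. span (insert (uu x) (insert (ww x) ((\<lambda>\<alpha>. p \<alpha> (uu x)) ` {1..m}))))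
      (\<lambda>x. span (insert (uu x) (insert (J (uu x)) ((\<lambda>\<alpha>. p \<alpha> (uu x)) ` {1..m}))))"
  proof -
    \<comment> \<open>The ends of this segment are unit vectors in different eigenspaces, so it
      never meets 0, and both are orthogonal to the rest of the frame. Afterwards the frame depends
      on \<open>uu x\<close> alone.\<close>
    let ?b = "\<lambda>s x. (1 - s) *\<^sub>R ww x + s *\<^sub>R J (uu x)" and ?c = "\<lambda>x \<alpha>. p \<alpha> (uu x)"
    have "gl_equivalent ?M (\<lambda>x. span ((\<lambda>i. frame (uu x) (?b 0 x) (?c x) i) ` {..<m + 2}))
        (\<lambda>x. span ((\<lambda>i. frame (uu x) (?b 1 x) (?c x) i) ` {..<m + 2}))"
    proof (rule gl_equivalent_frame_homotopy[OF level_compact])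
      show "continuous_on ({0..1} \<times> ?M) (\<lambda>z. frame (uu (snd z)) (?b (fst z) (snd z)) (?c (snd z)) i)"
        if "i < m + 2" for i
        by (rule frame_continuous[OF _ _ _ that]) (auto intro!: continuous_intros)
      fix i and s :: real and x assume i: "i < m + 2" and s: "s \<in> {0..1}" and x: "x \<in> ?M"
      note f = focal_plus_uu_ww[OF x] and Ju = J(2)[OF uu_Eplus[of x]]
      have uw: "ww x \<bullet> uu x = 0" "ww x \<bullet> J (uu x) = 0" "J (uu x) \<bullet> ww x = 0"
        using Eplus_Eminus_orth uu_Eplus ww_Eminus Ju by blast+
      show "frame (uu x) (?b s x) (?c x) i \<notin> span ((\<lambda>j. frame (uu x) (?b s x) (?c x) j) ` {..<i})"
      proof (rule frame_independent[OF _ _ _ _ _ _ _ i])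
        show "uu x \<noteq> 0" using f(1) by auto
        have "?b s x \<bullet> ?b s x = (1 - s)\<^sup>2 + s\<^sup>2"
          using uw f(1,2) Ju by (simp add: inner_add_left inner_add_right power2_eq_square)
        also have "\<dots> \<noteq> 0" by (simp add: sum_power2_eq_zero_iff)
        finally show "?b s x \<noteq> 0" by auto
        show "?b s x \<bullet> uu x = 0" using uw Ju by (simp add: inner_add_left)
        fix \<alpha> assume \<alpha>: "1 \<le> \<alpha>" "\<alpha> \<le> m"
        show "p \<alpha> (uu x) \<noteq> 0" using p_inner[OF \<alpha>(2), of "uu x" "uu x"] f(1) by auto
        show "p \<alpha> (uu x) \<bullet> uu x = 0" using p_uu_orth[OF uu_Eplus \<alpha>] by simp
        show "p \<alpha> (uu x) \<bullet> ?b s x = 0"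
          using p_uu_orth(2)[OF uu_Eplus \<alpha>, of "J (uu x)" x] Ju f(4)[OF \<alpha>] by (simp add: inner_add_right)
        show "p \<alpha> (uu x) \<bullet> p \<beta> (uu x) = 0" if "1 \<le> \<beta>" "\<beta> \<le> m" "\<alpha> \<noteq> \<beta>" for \<beta>
          using p_orth \<alpha> that by simp
      qed
    qed
    then show ?thesis unfolding frame_image by simp
  qed
  let ?X = "sphere 0 1 \<inter> Eplus"
  have "\<exists>C. subspace C \<and> dim C \<le> m + 2 \<and>
      gl_equivalent ?X (\<lambda>a. span ((\<lambda>i. frame a (J a) (\<lambda>\<alpha>. p \<alpha> a) i) ` {..<m + 2})) (\<lambda>_. C)"
  proof (rule gl_equivalent_frame_const[OF subspace_Eplus])
    \<comment> \<open>The stable range reads \<open>l + (m + 2) \<le> 2 * l\<close>, which is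
      exactly \<open>l > m + 1\<close>.\<close>
    show "dim Eplus + (m + 2) \<le> DIM(real^'n)" using dim_Eplus card l_gt by simp
    show "continuous_on ?X (\<lambda>a. frame a (J a) (\<lambda>\<alpha>. p \<alpha> a) i)" if "i < m + 2" for i
      by (rule frame_continuous[OF _ _ _ that]) (auto intro!: continuous_intros)
    fix i a assume i: "i < m + 2" and "a \<in> ?X"
    then have a: "a \<in> Eplus" "a \<bullet> a = 1" by (auto simp: norm_eq_1)
    note Ja = J(2)[OF a(1)]
    show "frame a (J a) (\<lambda>\<alpha>. p \<alpha> a) i \<notin> span ((\<lambda>j. frame a (J a) (\<lambda>\<alpha>. p \<alpha> a) j) ` {..<i})"
    proof (rule frame_independent[OF _ _ _ _ _ _ _ i])
      show "a \<noteq> 0" "J a \<noteq> 0" using a Ja by auto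
      show "J a \<bullet> a = 0" using Ja by simp
      fix \<alpha> assume \<alpha>: "1 \<le> \<alpha>" "\<alpha> \<le> m"
      show "p \<alpha> a \<noteq> 0" using p_inner[OF \<alpha>(2), of a a] a(2) by auto
      show "p \<alpha> a \<bullet> a = 0" "p \<alpha> a \<bullet> J a = 0" using p_uu_orth[OF a(1) \<alpha>] Ja by simp_all
      show "p \<alpha> a \<bullet> p \<beta> a = 0" if "1 \<le> \<beta>" "\<beta> \<le> m" "\<alpha> \<noteq> \<beta>" for \<beta>
        using p_orth \<alpha> that by simp
    qed
  qed
  then obtain C where C: "gl_equivalent ?X (\<lambda>a. span (insert a (insert (J a) ((\<lambda>\<alpha>. p \<alpha> a) ` {1..m})))) (\<lambda>_. C)"
    unfolding frame_image by blast
  have "gl_equivalent ?M (\<lambda>x. span (insert (uu x) (insert (J (uu x)) ((\<lambda>\<alpha>. p \<alpha> (uu x)) ` {1..m})))) (\<lambda>_. C)"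
  proof (rule gl_equivalent_pullback[OF C])
    show "continuous_on ?M uu" by (intro continuous_intros)
    show "uu \<in> ?M \<rightarrow> ?X" using uu_Eplus focal_plus_uu_ww(1) by (auto simp: norm_eq_1)
  qed
  then show ?thesis
    by (rule trivialized_focal_plus[OF gl_equivalent_trans[OF 1]])
qed

lemma parallelizable_focal_plus_odd:
  assumes m1: "m = 1" and l: "odd l"
  shows "parallelizable (focal_plus m P)"
proof -
  let ?M = "focal_plus m P"
  \<comment> \<open>Three orthonormal vectors fit into \<open>Eplus\<close>, since \<open>l\<close>
    exceeds \<open>m + 1 = 2\<close>.\<close>
  obtain e e0 e1 where e: "e \<in> Eplus" "e0 \<in> Eplus" "e1 \<in> Eplus" "e \<bullet> e = 1" "e0 \<bullet> e0 = 1" "e1 \<bullet> e1 = 1"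
      "e \<bullet> e0 = 0" "e \<bullet> e1 = 0" "e0 \<bullet> e1 = 0"
  proof (rule orthonormal_in_subspace[OF subspace_Eplus, of 3])
    show "3 \<le> dim Eplus" using dim_Eplus l_gt m1 by simp
    fix T assume T: "T \<subseteq> Eplus" "card T = 3" "\<And>a. a \<in> T \<Longrightarrow> a \<bullet> a = 1"
      "\<And>a b. a \<in> T \<Longrightarrow> b \<in> T \<Longrightarrow> a \<noteq> b \<Longrightarrow> a \<bullet> b = 0"
    obtain a b c where "T = {a, b, c}" "a \<noteq> b" "b \<noteq> c" "a \<noteq> c"
      using T(2) by (auto simp: card_3_iff)
    then show thesis using T(1) T(3) T(4) by (intro that[of a b c]) auto
  qed
  define W where "W = {y \<in> Eplus. \<forall>x\<in>span {e}. orthogonal x y}"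
  have W_iff: "y \<in> W \<longleftrightarrow> y \<in> Eplus \<and> y \<bullet> e = 0" for y
  proof -
    have "(\<forall>x\<in>span {e}. orthogonal x y) \<longleftrightarrow> y \<in> orthogonal_comp (span {e})"
      by (simp add: orthogonal_comp_def)
    then show ?thesis by (simp add: W_def orthogonal_comp_span)
  qed
  have W: "subspace W"
    by (rule subspaceI)
       (use subspace_Eplus in \<open>auto simp: W_iff subspace_add subspace_scale subspace_0 inner_add_left\<close>)
  have "e \<noteq> 0" using e by auto
  then have "dim (span {e}) = 1" by (simp add: dim_insert)
  moreover have "span {e} \<subseteq> Eplus" using e subspace_Eplus by (simp add: span_minimal)
  ultimately have "dim W + 1 = l"
    using dim_subspace_orthogonal_to_vectors[of "span {e}" Eplus] subspace_Eplus dim_Eplus by (simp add: W_def)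
  \<comment> \<open>Here oddness of \<open>l\<close> enters: the complement of \<open>e\<close> has
    even dimension and therefore carries \<open>J\<close>.\<close>
  then have "dim W = 2 * ((l - 1) div 2)" using l by auto
  then obtain J where J: "linear J" "\<And>w. w \<in> W \<Longrightarrow> J w \<in> W \<and> J w \<bullet> w = 0 \<and> J w \<bullet> J w = w \<bullet> w"
    using even_dim_complex_structure[OF W] by blast
  define I where "I = (\<lambda>x. p 1 (p 0 x))"
  have II: "I (I x) = - x" for x
    using p_anti[of 0 1 "p 0 x"] m1 by (simp add: I_def p_simps p_sq)
  have I_Eplus: "I a = p 1 a" "p 1 a \<in> Eminus" if "a \<in> Eplus" for a
    using that p_Eplus[of 1 a] m1 by (simp_all add: I_def Eplus_def)
  interpret T: totally_real Eplus I J e e0 e1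
  proof (rule totally_real.intro)
    show "linear I" unfolding I_def using linear_compose[OF p_linear p_linear] by (simp add: o_def)
    show "I a \<bullet> b = - (a \<bullet> I b)" for a b
    proof -
      have "I a \<bullet> b = a \<bullet> p 0 (p 1 b)" using m1 by (simp add: I_def p_sym)
      also have "p 0 (p 1 b) = - I b" using p_anti[of 0 1 b] m1 by (simp add: I_def)
      finally show ?thesis by simp
    qed
    show "a \<bullet> I b = 0" if "a \<in> Eplus" "b \<in> Eplus" for a b
      using Eplus_Eminus_orth(1)[OF that(1)] I_Eplus[OF that(2)] by simp
    show "J w \<in> Eplus \<and> J w \<bullet> e = 0 \<and> J w \<bullet> w = 0 \<and> J w \<bullet> J w = w \<bullet> w"
      if "w \<in> Eplus" "w \<bullet> e = 0" for w
      using J(2)[of w] that by (simp add: W_iff)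
  qed (use e subspace_Eplus II J(1) in auto)
  \<comment> \<open>On \<open>Eplus\<close> the map \<open>I\<close> is \<open>p 1\<close>, so
    \<open>ww x = I (v x)\<close> with \<open>v x\<close> in \<open>Eplus\<close>: a point of
    \<open>M\<^sub>+\<close> amounts to an orthonormal pair in \<open>Eplus\<close>.\<close>
  define v where "v = (\<lambda>x. p 1 (ww x))"
  have vE: "v x \<in> Eplus" for x using p_Eminus[OF _ _ ww_Eminus, of 1] m1 by (simp add: v_def)
  have Iv: "I (v x) = ww x" for x using I_Eplus(1)[OF vE] p_sq[of 1 "ww x"] m1 by (simp add: v_def)
  have "gl_equivalent ?M (\<lambda>x. span {I (v x), I (uu x), uu x}) (\<lambda>_. span (insert (e1 + 2 *\<^sub>R I (J e0)) T.K))"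
  proof (rule T.gl_equivalent_two_frame[OF level_compact])
    show "continuous_on ?M uu" "continuous_on ?M v" unfolding v_def by (intro continuous_intros)+
    fix x assume x: "x \<in> ?M"
    note f = focal_plus_uu_ww[OF x]
    show "uu x \<in> Eplus" "v x \<in> Eplus" "uu x \<bullet> uu x = 1" by (fact uu_Eplus vE f)+
    show "v x \<bullet> v x = 1" using p_inner[of 1 "ww x" "ww x"] f m1 by (simp add: v_def)
    show "uu x \<bullet> v x = 0" using f(3)[of 1] m1 by (simp add: v_def inner_commute)
  qed
  moreover have "{I (v x), I (uu x), uu x} = insert (uu x) (insert (ww x) ((\<lambda>\<alpha>. p \<alpha> (uu x)) ` {1..m}))" for x
    using Iv I_Eplus(1)[OF uu_Eplus] m1 by auto
  ultimately show ?thesis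
    by (intro trivialized_focal_plus) simp
qed

theorem parallelizable_focal_plus: "parallelizable (focal_plus m P)"
proof (cases "m = 1")
  case True
  show ?thesis
  proof (cases "even l")
    case True
    then have "dim Eplus = 2 * (l div 2)" using dim_Eplus by simp
    then obtain J where "linear J" "\<forall>w\<in>Eplus. J w \<in> Eplus \<and> J w \<bullet> w = 0 \<and> J w \<bullet> J w = w \<bullet> w"
      using even_dim_complex_structure[OF subspace_Eplus] by blast
    then show ?thesis by (intro parallelizable_focal_plus_complex[of J]) auto
  next
    case False
    then show ?thesis using parallelizable_focal_plus_odd[OF \<open>m = 1\<close>] by simp
  qed
next
  case False
  then have m: "1 \<le> m" "2 \<le> m" using m_pos by auto
  show ?thesis
  proof (rule parallelizable_focal_plus_complex[of "\<lambda>x. p 1 (p 2 x)"])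
    show "linear (\<lambda>x. p 1 (p 2 x))" using linear_compose[OF p_linear p_linear] by (simp add: o_def)
    fix a assume a: "a \<in> Eplus"
    have "p 1 (p 2 a) \<in> Eplus" using p_Eminus[OF _ m(1)] p_Eplus[OF _ m(2) a] by simp
    moreover have "p 1 (p 2 a) \<bullet> a = 0" using p_orth[OF m(2) m(1), of a] p_sym[OF m(1), of "p 2 a" a] by simp
    moreover have "p 1 (p 2 a) \<bullet> p 1 (p 2 a) = a \<bullet> a" using m by (simp add: p_inner)
    ultimately show "p 1 (p 2 a) \<in> Eplus \<and> p 1 (p 2 a) \<bullet> a = 0 \<and> p 1 (p 2 a) \<bullet> p 1 (p 2 a) = a \<bullet> a"
      by simp
  qed
qed

end

section \<open>The focal submanifold \<open>M\<^sub>-\<close>\<close>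

lemma trivialized_whitney_sum_line:
  fixes E :: "'b::topological_space \<Rightarrow> 'v::euclidean_space set"
  assumes "trivialized X E"
  shows "trivialized X (whitney_sum E (\<lambda>_. UNIV :: real set))"
proof -
  obtain W :: "'v set" and A where W: "subspace W" and A: "linear_family X A"
    and E: "\<And>x. x \<in> X \<Longrightarrow> inj_on (A x) W" "\<And>x. x \<in> X \<Longrightarrow> A x ` W = E x"
    using assms unfolding trivialized_def by blast
  show ?thesis
  proof (rule trivializedI)
    show "subspace (W \<times> (UNIV :: real set))" using W by (simp add: subspace_Times)
    show "linear_family X (\<lambda>x z. (A x (fst z), snd z :: real))"
    proof (rule linear_familyI)
      fix x assume "x \<in> X"
      then interpret linear "A x" using linear_family_linear[OF A] by blast
      show "linear (\<lambda>z. (A x (fst z), snd z :: real))"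
        by (rule linearI) (simp_all add: add scale)
    next
      show "continuous_on X (\<lambda>x. (A x (fst z), snd z :: real))" for z
        using A by (intro continuous_intros) (simp add: linear_family_def)
    qed
    fix x assume x: "x \<in> X"
    show "inj_on (\<lambda>z. (A x (fst z), snd z :: real)) (W \<times> UNIV)"
      using E(1)[OF x] by (auto simp: inj_on_def)
    show "(\<lambda>z. (A x (fst z), snd z :: real)) ` (W \<times> UNIV) = whitney_sum E (\<lambda>_. UNIV) x"
      unfolding whitney_sum_def E(2)[OF x, symmetric] by force
  qed
qed

lemma linear_family_sum:
  assumes "\<And>i. i \<in> I \<Longrightarrow> linear_family X (A i)"
  shows "linear_family X (\<lambda>x v. \<Sum>i\<in>I. A i x v)"
  using assms by (auto simp: linear_family_def intro!: linear_compose_sum continuous_intros)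

lemma dim_span_frame:
  fixes f :: "nat \<Rightarrow> 'v::euclidean_space"
  assumes "\<And>i. i < k \<Longrightarrow> f i \<notin> span (f ` {..<i})"
  shows "dim (span (f ` {..<k})) = k"
  using assms by (induction k) (simp_all add: lessThan_Suc dim_insert)

lemma notin_span_test:
  assumes "z \<bullet> v \<noteq> 0" "\<And>b. b \<in> B \<Longrightarrow> z \<bullet> b = 0"
  shows "v \<notin> span B"
proof
  assume "v \<in> span B"
  then have "orthogonal z v" by (rule orthogonal_to_span) (use assms in \<open>simp add: orthogonal_def\<close>)
  then show False using assms(1) by (simp add: orthogonal_def)
qed

lemma norm_preserving_inner:
  assumes f: "linear f" and W: "subspace W" "\<And>x. x \<in> W \<Longrightarrow> norm (f x) = norm x" "a \<in> W" "b \<in> W"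
  shows "f a \<bullet> f b = a \<bullet> b"
proof -
  have "norm (f (a + b)) = norm (a + b)" using W by (simp add: subspace_add)
  then show ?thesis using W by (simp add: dot_norm linear_add[OF f])
qed

section \<open>The splitting of the tangent bundle of \<open>M\<^sub>-\<close> and its relation to
  \<open>xi\<close>\<close>

context clifford_system
begin

definition eig :: "real^'n \<Rightarrow> (real^'n) set" where "eig x = {y. op (coeff x) y = y}"

lemma subspace_eig: "subspace (eig x)"
  using linear_0[OF op_linear] linear_add[OF op_linear] linear_scale[OF op_linear]
  by (auto simp: eig_def subspace_def)

lemma coeff_sum_sq_focal_minus: "x \<in> focal_minus m P \<Longrightarrow> (\<Sum>\<alpha>\<le>m. (coeff x \<alpha>)\<^sup>2) = 1"
  by (simp add: level_iff)

lemma focal_minus_simps: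
  assumes "x \<in> focal_minus m P"
  shows "x \<bullet> x = 1" "op (coeff x) x = x" "op (coeff x) (op (coeff x) y) = y" "x \<in> eig x"
  using assms coeff_sum_sq_focal_minus[OF assms] by (simp_all add: focal_minus_iff norm_eq_1 op_sq eig_def)

lemma half_eig: assumes "x \<in> focal_minus m P" shows "(1/2) *\<^sub>R (v + op (coeff x) v) \<in> eig x"
  using focal_minus_simps(3)[OF assms]
  by (simp add: eig_def linear_add[OF op_linear] linear_scale[OF op_linear] add.commute)

lemma op_minus:
  assumes x: "x \<in> focal_minus m P" and h: "(\<Sum>\<alpha>\<le>m. h \<alpha> * coeff x \<alpha>) = 0"
  shows "op (coeff x) (op h x) = - op h x"
proof -
  have "(\<Sum>\<alpha>\<le>m. coeff x \<alpha> * h \<alpha>) = 0" using h by (simp add: mult.commute)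
  then show ?thesis
    using op_anticommutator[of "coeff x" h x] focal_minus_simps(2)[OF x] by (simp add: eq_neg_iff_add_eq_0)
qed

text \<open>The operator \<open>op (coeff x)\<close> is symmetric, fixes \<open>x\<close> and
  \<open>z\<close>, and has anticommutator \<open>2 * coeff x \<alpha>\<close> with
  \<open>p \<alpha>\<close>.\<close>

lemma p_inner_eig:
  assumes x: "x \<in> focal_minus m P" and z: "z \<in> eig x" and \<alpha>: "\<alpha> \<le> m"
  shows "p \<alpha> x \<bullet> z = coeff x \<alpha> * (x \<bullet> z)"
proof -
  let ?d = "\<lambda>\<beta>. if \<beta> = \<alpha> then 1 else 0 :: real"
  have d: "op ?d y = p \<alpha> y" for y
    using \<alpha> by (simp add: op_def if_distrib[of "\<lambda>r. r *\<^sub>R _"] cong: if_cong)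
  have "(\<Sum>\<beta>\<le>m. coeff x \<beta> * ?d \<beta>) = coeff x \<alpha>"
    using \<alpha> by (simp add: if_distrib cong: if_cong)
  then have "op (coeff x) (p \<alpha> x) + p \<alpha> x = (2 * coeff x \<alpha>) *\<^sub>R x"
    using op_anticommutator[of "coeff x" ?d x] focal_minus_simps(2)[OF x] by (simp add: d)
  then have "op (coeff x) (p \<alpha> x) \<bullet> z + p \<alpha> x \<bullet> z = 2 * coeff x \<alpha> * (x \<bullet> z)"
    by (metis inner_add_left inner_scaleR_left)
  moreover have "op (coeff x) (p \<alpha> x) \<bullet> z = p \<alpha> x \<bullet> z" using z by (simp add: op_sym eig_def)
  ultimately show ?thesis by simp
qed

lemma op_inner_eig:
  assumes x: "x \<in> focal_minus m P" and z: "z \<in> eig x" and h: "(\<Sum>\<alpha>\<le>m. h \<alpha> * coeff x \<alpha>) = 0"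
  shows "op h x \<bullet> z = 0"
proof -
  have "op h x \<bullet> z = - (op h x \<bullet> z)"
    using op_sym[of "coeff x" "op h x" z] op_minus[OF x h] z by (simp add: eig_def)
  then show ?thesis by linarith
qed

lemma op_eq_0: assumes "op h x = 0" "x \<bullet> x = 1" "\<alpha> \<le> m" shows "h \<alpha> = 0"
  using op_inner_p[OF assms(3), of h x] assms by simp

text \<open>The splitting into horizontal and vertical parts: \<open>h\<close> is half the velocity
  of the base point in the Clifford sphere, and \<open>z\<close> is tangent to the sphere of the
  fibre. The vector \<open>op h x\<close> lies in the eigenspace for -1, orthogonal to
  \<open>z\<close>.\<close>

lemma tangent_focal_minusI:
  assumes x: "x \<in> focal_minus m P" and h: "(\<Sum>\<alpha>\<le>m. h \<alpha> * coeff x \<alpha>) = 0"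
    and z: "z \<in> eig x" "z \<bullet> x = 0"
  shows "op h x + z \<in> tangent_space (focal_minus m P) x"
proof -
  note xs = focal_minus_simps[OF x]
  have ip: "p \<alpha> x \<bullet> (op h x + z) = h \<alpha>" if "\<alpha> \<le> m" for \<alpha>
    using p_inner_eig[OF x z(1) that] z(2) op_inner_p[OF that, of h x] xs(1)
    by (simp add: inner_add_right inner_commute[of "p \<alpha> x" "op h x"] inner_commute[of x z])
  have "op (coeff x) (op h x + z) = - op h x + z"
    using op_minus[OF x h] z(1) by (simp add: linear_add[OF op_linear] eig_def)
  moreover have "op (\<lambda>\<alpha>. p \<alpha> x \<bullet> (op h x + z)) x = op h x"
    by (rule op_cong) (rule ip)
  moreover have "(op h x + z) \<bullet> x = 0" using op_inner_eig[OF x xs(4) h] z(2) by (simp add: inner_add_left)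
  ultimately show ?thesis
    unfolding tangent_space_focal_minus[OF x] by (simp add: scaleR_2)
qed

lemma tangent_focal_minusE:
  assumes x: "x \<in> focal_minus m P" and v: "v \<in> tangent_space (focal_minus m P) x"
  shows "\<exists>h z. (\<Sum>\<alpha>\<le>m. h \<alpha> * coeff x \<alpha>) = 0 \<and> z \<in> eig x \<and> z \<bullet> x = 0 \<and> v = op h x + z"
proof (intro exI conjI)
  note xs = focal_minus_simps[OF x]
  let ?h = "\<lambda>\<alpha>. p \<alpha> x \<bullet> v" and ?z = "(1/2) *\<^sub>R (v + op (coeff x) v)"
  have vx: "v \<bullet> x = 0" and vQ: "v - op (coeff x) v = 2 *\<^sub>R op ?h x"
    using v unfolding tangent_space_focal_minus[OF x] by auto
  have "(\<Sum>\<alpha>\<le>m. ?h \<alpha> * coeff x \<alpha>) = op (coeff x) x \<bullet> v"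
    by (simp add: op_def inner_sum_left mult.commute)
  then show "(\<Sum>\<alpha>\<le>m. ?h \<alpha> * coeff x \<alpha>) = 0" using vx xs(2) by (simp add: inner_commute)
  show "?z \<in> eig x" by (rule half_eig[OF x])
  show "?z \<bullet> x = 0" using vx op_sym[of "coeff x" v x] xs(2) by (simp add: inner_add_left)
  have "op ?h x = (1/2) *\<^sub>R (v - op (coeff x) v)" using vQ by simp
  then have "op ?h x + ?z = (1/2) *\<^sub>R (v + v)" by (simp add: scaleR_add_right scaleR_diff_right)
  then show "v = op ?h x + ?z" by (simp add: scaleR_2[symmetric])
qed

lemma matrix_sum_op: "(\<Sum>\<alpha>\<le>m. a \<alpha> *\<^sub>R P \<alpha>) *v x = op a x"
proof -
  have l: "linear (\<lambda>M :: real^'n^'n. M *v x)"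
    by (rule linearI) (simp_all add: matrix_vector_mult_add_rdistrib scaleR_matrix_vector_assoc)
  show ?thesis by (simp add: linear_sum[OF l] linear_scale[OF l] op_def)
qed

lemma Clifford_sphere_iff:
  "Q \<in> Clifford_sphere m P \<longleftrightarrow> (\<exists>a. Q = (\<Sum>\<alpha>\<le>m. a \<alpha> *\<^sub>R P \<alpha>) \<and> (\<Sum>\<alpha>\<le>m. (a \<alpha>)\<^sup>2) = 1)"
  by (auto simp: Clifford_sphere_def)

lemma xi_fibre_focal_minus:
  assumes "x \<in> focal_minus m P"
  shows "(\<Sum>\<alpha>\<le>m. coeff x \<alpha> *\<^sub>R P \<alpha>) \<in> Clifford_sphere m P"
    and "xi_fibre (\<Sum>\<alpha>\<le>m. coeff x \<alpha> *\<^sub>R P \<alpha>) = eig x"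
  using coeff_sum_sq_focal_minus[OF assms] by (auto simp: Clifford_sphere_iff xi_fibre_def eig_def matrix_sum_op)

lemma Eplus_focal_minus:
  assumes "x \<in> Eplus" "x \<bullet> x = 1"
  shows "x \<in> focal_minus m P" "eig x = Eplus"
proof -
  let ?d = "\<lambda>\<beta>. if \<beta> = 0 then 1 else 0 :: real"
  have d: "op ?d y = p 0 y" for y
    by (simp add: op_def if_distrib[of "\<lambda>r. r *\<^sub>R _"] cong: if_cong)
  have x: "norm x = 1" "op ?d x = x" using assms d by (simp_all add: Eplus_def norm_eq_1)
  show "x \<in> focal_minus m P" by (rule focal_minusI[OF x])
  have "op (coeff x) y = p 0 y" for y
    using op_cong[of "coeff x" ?d y] coeff_eqI[OF x] d by simp
  then show "eig x = Eplus" by (simp add: eig_def Eplus_def)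
qed

text \<open>
  If \<open>m \<ge> 2\<close>, the coefficients of \<open>w\<close> and \<open>J w\<close> in the model fibre \<open>S \<times> W\<close> become coordinates of a vector
  \<open>a\<close> of \<open>\<real>\<^sup>m\<^sup>+\<^sup>1\<close>. Its part orthogonal to \<open>coeff x\<close> is tangent to the base sphere, and its part along
  \<open>coeff x\<close> takes the place of the coefficient of \<open>J w\<close>.
\<close>
lemma tangent_focal_minus_trivialized:
  fixes W :: "(real^'n) set" and B :: "real^'n \<Rightarrow> real^'n \<Rightarrow> real^'n" and w :: "real^'n \<Rightarrow> real^'n"
  assumes W: "subspace W" and B: "linear_family (focal_minus m P) B"
    and inj: "\<And>x. x \<in> focal_minus m P \<Longrightarrow> inj_on (B x) W"
    and im: "\<And>x. x \<in> focal_minus m P \<Longrightarrow> B x ` W = eig x"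
    and w: "continuous_on (focal_minus m P) w" "\<And>x. x \<in> focal_minus m P \<Longrightarrow> w x \<in> W"
      "\<And>x. x \<in> focal_minus m P \<Longrightarrow> B x (w x) = x"
  shows "trivialized (focal_minus m P) (tangent_space (focal_minus m P))"
proof -
  let ?M = "focal_minus m P"
  have w0: "w x \<bullet> w x \<noteq> 0" "w x \<noteq> 0" if x: "x \<in> ?M" for x
  proof -
    show "w x \<noteq> 0"
      using w(3)[OF x] linear_0[OF linear_family_linear[OF B x]] focal_minus_simps(1)[OF x] by auto
    then show "w x \<bullet> w x \<noteq> 0" by simp
  qed
  have cB: "continuous_on ?M (\<lambda>x. B x (f x))" if "continuous_on ?M f" for f
    by (rule linear_family_apply'[OF B that])
  have proj: "linear_family ?M (\<lambda>x z. C x z - (C x z \<bullet> x) *\<^sub>R x)" if "linear_family ?M C"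
    for C :: "real^'n \<Rightarrow> 'c::euclidean_space \<Rightarrow> real^'n"
    by (intro linear_family_diff linear_family_rank1 that continuous_intros)
  have kerB: "\<exists>k. y = k *\<^sub>R w x" if x: "x \<in> ?M" and y: "y \<in> W" and 0: "B x y - (B x y \<bullet> x) *\<^sub>R x = 0" for x y
  proof -
    have "B x y = B x ((B x y \<bullet> x) *\<^sub>R w x)"
      using 0 w(3)[OF x] linear_scale[OF linear_family_linear[OF B x]] by simp
    then have "y = (B x y \<bullet> x) *\<^sub>R w x"
      using inj[OF x] y w(2)[OF x] W by (meson inj_onD subspace_scale)
    then show ?thesis by blast
  qed
  have perp: "B x y - (B x y \<bullet> x) *\<^sub>R x \<in> eig x" "(B x y - (B x y \<bullet> x) *\<^sub>R x) \<bullet> x = 0"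
    if x: "x \<in> ?M" and y: "y \<in> W" for x y
    using im[OF x] y focal_minus_simps[OF x] subspace_eig[of x]
    by (auto simp: inner_diff_left intro!: subspace_diff subspace_scale)
  have perp_eq: "B x (y + k *\<^sub>R w x) - (B x (y + k *\<^sub>R w x) \<bullet> x) *\<^sub>R x = B x y"
    if x: "x \<in> ?M" and y: "B x y \<bullet> x = 0" for x y k
    using w(3)[OF x] y focal_minus_simps(1)[OF x] linear_family_linear[OF B x]
    by (simp add: linear_add linear_scale inner_add_left)
  have split: "a = 0 \<and> b = 0" if "a + b = 0" "a \<bullet> b = 0" for a b :: "real^'n"
  proof -
    have "a \<bullet> a = (a + b) \<bullet> a" using that(2) inner_commute[of b a] by (simp add: inner_add_left)
    then have "a \<bullet> a = 0" unfolding that(1) by simp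
    then show ?thesis using that(1) by simp
  qed
  show ?thesis
  proof (cases "m = 1")
    case True
    \<comment> \<open>The unit tangent field of the circle: \<open>coeff x\<close> turned by a right
      angle.\<close>
    define H where "H = (\<lambda>x \<alpha>. if \<alpha> = (0::nat) then - coeff x 1 else coeff x 0)"
    have sum2: "(\<Sum>\<alpha>\<le>m. g \<alpha>) = g 0 + g 1" for g :: "nat \<Rightarrow> real" using True by simp
    have Hq: "(\<Sum>\<alpha>\<le>m. (r * H x \<alpha>) * coeff x \<alpha>) = 0" for x r by (simp add: sum2 H_def)
    have opH: "op (H x) x = (- coeff x 1) *\<^sub>R p 0 x + coeff x 0 *\<^sub>R p 1 x" for x
      unfolding op_def H_def using True by simp
    have cH: "continuous_on ?M (\<lambda>x. op (H x) x)"
      unfolding opH by (intro continuous_intros)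
    \<comment> \<open>Projecting \<open>B x y\<close> off \<open>x\<close> loses exactly the
      multiples of \<open>w x\<close>; the lost direction becomes the coordinate along the
      circle.\<close>
    let ?T = "\<lambda>x y. (y \<bullet> w x) *\<^sub>R op (H x) x + (B x y - (B x y \<bullet> x) *\<^sub>R x)"
    show ?thesis
    proof (rule trivializedI[OF W, of _ ?T])
      show "linear_family ?M ?T"
        by (intro linear_family_add proj B linear_family_rank1 linear_family_id w(1) cH)
      fix x assume x: "x \<in> ?M"
      note xs = focal_minus_simps[OF x]
      have HH: "op (H x) x \<bullet> op (H x) x = 1"
        using coeff_sum_sq_focal_minus[OF x] xs(1)
        by (simp add: op_inner_op sum2 H_def power2_eq_square) 
      have lin: "linear (?T x)"
        using \<open>linear_family ?M ?T\<close> linear_family_linear[OF _ x] by blast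
      show "inj_on (?T x) W"
        unfolding linear_inj_on_iff_eq_0[OF lin W]
      proof (intro ballI impI)
        fix y assume y: "y \<in> W" "?T x y = 0"
        have "((y \<bullet> w x) *\<^sub>R op (H x) x) \<bullet> (B x y - (B x y \<bullet> x) *\<^sub>R x) = 0"
          using op_inner_eig[OF x perp(1)[OF x y(1)] Hq[of "y \<bullet> w x" x]] by (simp add: op_scale_coeff)
        from split[OF y(2) this] have "(y \<bullet> w x) *\<^sub>R op (H x) x = 0" "B x y - (B x y \<bullet> x) *\<^sub>R x = 0"
          by auto
        moreover have "op (H x) x \<noteq> 0" using HH by auto
        ultimately have yw: "y \<bullet> w x = 0" and "\<exists>k. y = k *\<^sub>R w x" using kerB[OF x y(1)] by auto
        then show "y = 0" using w0[OF x] by auto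
      qed
      show "?T x ` W = tangent_space ?M x"
      proof (intro subset_antisym subsetI)
        fix v assume "v \<in> ?T x ` W"
        then obtain y where y: "y \<in> W" "v = ?T x y" by blast
        then have "v = op (\<lambda>\<alpha>. (y \<bullet> w x) * H x \<alpha>) x + (B x y - (B x y \<bullet> x) *\<^sub>R x)"
          by (simp add: op_scale_coeff)
        then show "v \<in> tangent_space ?M x"
          using tangent_focal_minusI[OF x Hq perp[OF x y(1)]] by simp
      next
        fix v assume v: "v \<in> tangent_space ?M x"
        obtain h z where hz: "(\<Sum>\<alpha>\<le>m. h \<alpha> * coeff x \<alpha>) = 0" "z \<in> eig x" "z \<bullet> x = 0" "v = op h x + z"
          using tangent_focal_minusE[OF x v] by blast
        have "z \<in> B x ` W" using hz(2) im[OF x] by simp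
        then obtain y0 where y0: "y0 \<in> W" "B x y0 = z" by blast
        define r where "r = h 1 * coeff x 0 - h 0 * coeff x 1"
        have q1: "coeff x 0 * coeff x 0 + coeff x 1 * coeff x 1 = 1"
          using coeff_sum_sq_focal_minus[OF x] by (simp add: sum2 power2_eq_square)
        have hq: "h 0 * coeff x 0 + h 1 * coeff x 1 = 0" using hz(1) by (simp add: sum2)
        have "h 0 = r * H x 0"
        proof -
          have "h 0 = h 0 * (coeff x 0 * coeff x 0 + coeff x 1 * coeff x 1) - coeff x 0 * (h 0 * coeff x 0 + h 1 * coeff x 1)"
            unfolding q1 hq by simp
          then show ?thesis by (simp add: r_def H_def algebra_simps)
        qed
        moreover have "h 1 = r * H x 1"
        proof -
          have "h 1 = h 1 * (coeff x 0 * coeff x 0 + coeff x 1 * coeff x 1) - coeff x 1 * (h 0 * coeff x 0 + h 1 * coeff x 1)"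
            unfolding q1 hq by simp
          then show ?thesis by (simp add: r_def H_def algebra_simps)
        qed
        ultimately have "h \<alpha> = r * H x \<alpha>" if "\<alpha> \<le> m" for \<alpha>
          using that True by (cases "\<alpha> = 0") (auto simp: le_Suc_eq)
        then have hr: "op h x = r *\<^sub>R op (H x) x" using op_cong[of h "\<lambda>\<alpha>. r * H x \<alpha>" x] by (simp add: op_scale_coeff)
        let ?y = "y0 + ((r - y0 \<bullet> w x) / (w x \<bullet> w x)) *\<^sub>R w x"
        have "?y \<bullet> w x = r" using w0[OF x] by (simp add: inner_add_left)
        moreover have "B x ?y - (B x ?y \<bullet> x) *\<^sub>R x = z" using perp_eq[OF x] y0(2) hz(3) by simp
        ultimately have "v = ?T x ?y" using hz(4) hr by simp
        moreover have "?y \<in> W" using y0(1) w(2)[OF x] W by (simp add: subspace_add subspace_scale)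
        ultimately show "v \<in> ?T x ` W" by (rule image_eqI)
      qed
    qed
  next
    case False
    then have m2: "2 \<le> m" "1 \<le> m" using m_pos by auto
    obtain e where e: "e \<in> Eplus" "e \<bullet> e = 1" by (rule Eplus_unit)
    note eM = Eplus_focal_minus[OF e]
    have "dim W = dim (B e ` W)"
      using dim_image_eq[OF linear_family_linear[OF B eM(1)], of W] inj[OF eM(1)] W by (metis span_eq_iff)
    then have dW: "dim W = dim Eplus" using im[OF eM(1)] eM(2) by simp
    \<comment> \<open>The model \<open>W\<close> has the dimension of the fibre
      \<open>Eplus\<close>, so an isometry transports the complex structure given by
      \<open>p 1\<close> and \<open>p 2\<close> to it.\<close>
    obtain f g where fg: "linear f" "linear g" "f ` W = Eplus" "g ` Eplus = W"
        "\<And>a. a \<in> W \<Longrightarrow> norm (f a) = norm a" "\<And>a. a \<in> Eplus \<Longrightarrow> norm (g a) = norm a"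
        "\<And>a. a \<in> W \<Longrightarrow> g (f a) = a" "\<And>a. a \<in> Eplus \<Longrightarrow> f (g a) = a"
      by (rule isometries_subspaces[OF W subspace_Eplus dW]) blast
    define J where "J = (\<lambda>a. g (p 1 (p 2 (f a))))"
    have J_lin: "linear J"
      unfolding J_def
      using linear_compose[OF linear_compose[OF linear_compose[OF fg(1) p_linear] p_linear] fg(2), of 1 2]
      by (simp add: o_def)
    have J: "J a \<in> W" "J a \<bullet> a = 0" "a \<bullet> J a = 0" "J a \<bullet> J a = a \<bullet> a" if a: "a \<in> W" for a
    proof -
      have fa: "f a \<in> Eplus" using fg(3) a by blast
      have pE: "p 1 (p 2 (f a)) \<in> Eplus" using p_Eminus[OF _ m2(2)] p_Eplus[OF _ m2(1) fa] by simp
      show JW: "J a \<in> W" unfolding J_def using fg(4) pE by blast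
      have fJ: "f (J a) = p 1 (p 2 (f a))" unfolding J_def by (rule fg(8)[OF pE])
      have "J a \<bullet> a = p 1 (p 2 (f a)) \<bullet> f a"
        unfolding fJ[symmetric] by (rule norm_preserving_inner[symmetric, OF fg(1) W fg(5) JW a])
      also have "\<dots> = 0" using p_orth[OF m2, of "f a"] p_sym[OF m2(2), of "p 2 (f a)" "f a"] by simp
      finally show "J a \<bullet> a = 0" .
      then show "a \<bullet> J a = 0" by (simp add: inner_commute)
      have "J a \<bullet> J a = p 1 (p 2 (f a)) \<bullet> p 1 (p 2 (f a))"
        unfolding fJ[symmetric] by (rule norm_preserving_inner[symmetric, OF fg(1) W fg(5) JW JW])
      also have "\<dots> = f a \<bullet> f a" using m2 by (simp add: p_inner)
      also have "\<dots> = a \<bullet> a" by (rule norm_preserving_inner[OF fg(1) W fg(5) a a])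
      finally show "J a \<bullet> J a = a \<bullet> a" .
    qed
    have cJ: "continuous_on ?M (\<lambda>x. J (w x))"
      by (rule bounded_linear.continuous_on[OF _ w(1)]) (use J_lin in \<open>simp add: linear_conv_bounded_linear\<close>)
    \<comment> \<open>Orthonormal labels for coordinates. Those from 2 on span \<open>S\<close>;
      coordinates 0 and 1 are read off \<open>W\<close> instead.\<close>
    define b where "b = (\<lambda>\<alpha>. p \<alpha> e)"
    have bb: "b \<alpha> \<bullet> b \<beta> = (if \<alpha> = \<beta> then 1 else 0)" if "\<alpha> \<le> m" "\<beta> \<le> m" for \<alpha> \<beta>
      using p_orth'[OF that, of e] e(2) by (simp add: b_def)
    define S where "S = span (b ` {2..m})"
    \<comment> \<open>\<open>z \<bullet> c x \<alpha>\<close> is the coordinate of index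
      \<open>\<alpha>\<close> of the vector \<open>a\<close> belonging to \<open>z\<close>, and
      \<open>z \<bullet> rv x\<close> is the inner product of \<open>a\<close> with
      \<open>coeff x\<close>.\<close>
    define c where "c = (\<lambda>x \<alpha>. if \<alpha> = 0 then (0, w x) else if \<alpha> = 1 then (0, J (w x)) else (b \<alpha>, 0 :: real^'n))"
    define rv where "rv = (\<lambda>x. \<Sum>\<alpha>\<le>m. coeff x \<alpha> *\<^sub>R c x \<alpha>)"
    \<comment> \<open>Removes from \<open>snd z\<close> the components along \<open>w x\<close> and
      \<open>J (w x)\<close>, already used as coordinates 0 and 1, and installs the radial part of
      \<open>a\<close> along \<open>J (w x)\<close>. No component along \<open>w x\<close> is
      needed, as it would be projected away with \<open>x\<close>.\<close>
    define Y where "Y = (\<lambda>x z. snd z - (z \<bullet> c x 0) *\<^sub>R ((1 / (w x \<bullet> w x)) *\<^sub>R w x)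
      - (z \<bullet> c x 1) *\<^sub>R ((1 / (w x \<bullet> w x)) *\<^sub>R J (w x)) + (z \<bullet> rv x) *\<^sub>R J (w x))"
    let ?T = "\<lambda>x z. ((\<Sum>\<alpha>\<le>m. (z \<bullet> c x \<alpha>) *\<^sub>R p \<alpha> x) - (z \<bullet> rv x) *\<^sub>R x)
      + (B x (Y x z) - (B x (Y x z) \<bullet> x) *\<^sub>R x)"
    have cc: "continuous_on ?M (\<lambda>x. c x \<alpha>)" for \<alpha>
      unfolding c_def by (cases "\<alpha> = 0"; cases "\<alpha> = 1") (auto intro!: continuous_intros w(1) cJ)
    have crv: "continuous_on ?M rv" unfolding rv_def by (intro continuous_intros cc)
    have linsnd: "linear (snd :: (real^'n) \<times> (real^'n) \<Rightarrow> real^'n)" by (rule linear_snd)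
    have cw: "continuous_on ?M (\<lambda>x. (1 / (w x \<bullet> w x)) *\<^sub>R w x)"
        "continuous_on ?M (\<lambda>x. (1 / (w x \<bullet> w x)) *\<^sub>R J (w x))"
      by (intro continuous_intros w(1) cJ; use w0 in auto)+
    have Yfam: "linear_family ?M Y"
      unfolding Y_def
      by (intro linear_family_add linear_family_diff linear_family_const[OF linsnd]
          linear_family_rank1[OF linear_family_id] cc crv cw cJ)
    have Tfam: "linear_family ?M ?T"
      by (intro linear_family_add linear_family_diff proj linear_family_sum
          linear_family_rank1[OF linear_family_id] linear_family_compose[OF Yfam B] cc crv)
         (auto intro!: continuous_intros)
    have subS: "subspace (S \<times> W)" using W by (simp add: S_def subspace_Times)
    have hsum: "(\<Sum>\<alpha>\<le>m. (z \<bullet> c x \<alpha> - (z \<bullet> rv x) * coeff x \<alpha>) * coeff x \<alpha>) = 0" if x: "x \<in> ?M" for x z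
    proof -
      have "(\<Sum>\<alpha>\<le>m. (z \<bullet> c x \<alpha> - (z \<bullet> rv x) * coeff x \<alpha>) * coeff x \<alpha>) =
          (\<Sum>\<alpha>\<le>m. coeff x \<alpha> * (z \<bullet> c x \<alpha>)) - (z \<bullet> rv x) * (\<Sum>\<alpha>\<le>m. (coeff x \<alpha>)\<^sup>2)"
        unfolding sum_distrib_left sum_subtractf[symmetric]
        by (rule sum.cong[OF refl]) (simp add: power2_eq_square algebra_simps)
      then show ?thesis
        using coeff_sum_sq_focal_minus[OF x] by (simp add: rv_def inner_sum_right)
    qed
    have hop: "(\<Sum>\<alpha>\<le>m. (z \<bullet> c x \<alpha>) *\<^sub>R p \<alpha> x) - (z \<bullet> rv x) *\<^sub>R x =
        op (\<lambda>\<alpha>. z \<bullet> c x \<alpha> - (z \<bullet> rv x) * coeff x \<alpha>) x" if x: "x \<in> ?M" for x z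
    proof -
      have "op (\<lambda>\<alpha>. z \<bullet> c x \<alpha> - (z \<bullet> rv x) * coeff x \<alpha>) x =
          (\<Sum>\<alpha>\<le>m. (z \<bullet> c x \<alpha>) *\<^sub>R p \<alpha> x) - (z \<bullet> rv x) *\<^sub>R op (coeff x) x"
        by (simp add: op_def scaleR_diff_left sum_subtractf scaleR_sum_right)
      then show ?thesis using focal_minus_simps(2)[OF x] by simp
    qed
    have YW: "Y x z \<in> W" if "x \<in> ?M" "z \<in> S \<times> W" for x z
      using that w(2)[OF that(1)] J(1)[OF w(2)[OF that(1)]] W
      by (auto simp: Y_def intro!: subspace_add subspace_diff subspace_scale)
    show ?thesis
    proof (rule trivializedI[OF subS Tfam])
      fix x assume x: "x \<in> ?M"
      note xs = focal_minus_simps[OF x] and wW = w(2)[OF x] and Jw = J[OF w(2)[OF x]] and wx0 = w0[OF x]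
      have lin: "linear (?T x)" by (rule linear_family_linear[OF Tfam x])
      show "inj_on (?T x) (S \<times> W)"
        unfolding linear_inj_on_iff_eq_0[OF lin subS]
      proof (intro ballI impI)
        fix z assume z: "z \<in> S \<times> W" "?T x z = 0"
        let ?h = "\<lambda>\<alpha>. z \<bullet> c x \<alpha> - (z \<bullet> rv x) * coeff x \<alpha>"
        note pp = perp[OF x YW[OF x z(1)]]
        have 0: "op ?h x + (B x (Y x z) - (B x (Y x z) \<bullet> x) *\<^sub>R x) = 0"
          using z(2) unfolding hop[OF x] .
        from split[OF 0 op_inner_eig[OF x pp(1) hsum[OF x]]]
        have h0: "op ?h x = 0" and "B x (Y x z) - (B x (Y x z) \<bullet> x) *\<^sub>R x = 0" by auto
        then obtain k where k: "Y x z = k *\<^sub>R w x" using kerB[OF x YW[OF x z(1)]] by blast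
        have "Y x z \<bullet> J (w x) = (z \<bullet> rv x) * (w x \<bullet> w x)"
          using Jw wx0 by (simp add: Y_def c_def inner_add_left inner_diff_left inner_prod_def)
        moreover have "Y x z \<bullet> J (w x) = 0" unfolding k using Jw by simp
        ultimately have r0: "z \<bullet> rv x = 0" using wx0 by simp
        have a0: "z \<bullet> c x \<alpha> = 0" if "\<alpha> \<le> m" for \<alpha>
          using op_eq_0[OF h0 xs(1) that] r0 by simp
        have "snd z = k *\<^sub>R w x" using k a0[of 0] a0[of 1] m2 r0 by (simp add: Y_def)
        moreover have "snd z \<bullet> w x = 0" using a0[of 0] by (simp add: c_def inner_prod_def)
        ultimately have "snd z = 0" using wx0 by auto
        moreover have "fst z = 0"
        proof -
          have "fst z \<bullet> b \<alpha> = 0" if "\<alpha> \<in> {2..m}" for \<alpha>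
            using a0[of \<alpha>] that by (simp add: c_def inner_prod_def)
          then have "orthogonal (fst z) (fst z)"
            using z(1) by (intro orthogonal_to_span[of "fst z" "b ` {2..m}"]) (auto simp: S_def orthogonal_def)
          then show ?thesis by (simp add: orthogonal_self)
        qed
        ultimately show "z = 0" by (simp add: prod_eq_iff)
      qed
      show "?T x ` (S \<times> W) = tangent_space ?M x"
      proof (intro subset_antisym subsetI)
        fix v assume "v \<in> ?T x ` (S \<times> W)"
        then obtain z where z: "z \<in> S \<times> W" "v = ?T x z" by blast
        show "v \<in> tangent_space ?M x"
          unfolding z(2) hop[OF x] by (rule tangent_focal_minusI[OF x hsum[OF x] perp[OF x YW[OF x z(1)]]])
      next
        fix v assume v: "v \<in> tangent_space ?M x"
        obtain h t where hz: "(\<Sum>\<alpha>\<le>m. h \<alpha> * coeff x \<alpha>) = 0" "t \<in> eig x" "t \<bullet> x = 0" "v = op h x + t"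
          using tangent_focal_minusE[OF x v] by blast
        have "t \<in> B x ` W" using hz(2) im[OF x] by simp
        then obtain y0 where y0: "y0 \<in> W" "B x y0 = t" by blast
        define \<kappa> where "\<kappa> = w x \<bullet> w x"
        define r where "r = (y0 \<bullet> w x) / \<kappa>"
        define s where "s = (y0 \<bullet> J (w x)) / \<kappa>"
        define y1 where "y1 = y0 - r *\<^sub>R w x - s *\<^sub>R J (w x)"
        \<comment> \<open>The inverse construction: the tangential part of \<open>a\<close> must be
          \<open>h\<close>, and its radial part the coefficient of \<open>J (w x)\<close> in
          \<open>y0\<close>.\<close>
        define a where "a = (\<lambda>\<alpha>. h \<alpha> + s * coeff x \<alpha>)"
        define y where "y = y1 + (a 0 / \<kappa>) *\<^sub>R w x + (a 1 / \<kappa>) *\<^sub>R J (w x)"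
        define u where "u = (\<Sum>\<alpha>\<in>{2..m}. a \<alpha> *\<^sub>R b \<alpha>)"
        have \<kappa>: "\<kappa> \<noteq> 0" using wx0 by (simp add: \<kappa>_def)
        have y1: "y1 \<bullet> w x = 0" "y1 \<bullet> J (w x) = 0"
          using Jw \<kappa> by (simp_all add: y1_def r_def s_def inner_diff_left \<kappa>_def[symmetric])
        have yw: "y \<bullet> w x = a 0" "y \<bullet> J (w x) = a 1"
          using Jw \<kappa> y1 by (simp_all add: y_def inner_add_left \<kappa>_def[symmetric])
        have ub: "u \<bullet> b \<alpha> = a \<alpha>" if "\<alpha> \<in> {2..m}" for \<alpha>
        proof -
          have "u \<bullet> b \<alpha> = (\<Sum>\<beta>\<in>{2..m}. if \<beta> = \<alpha> then a \<alpha> else 0)"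
            unfolding u_def inner_sum_left using that by (intro sum.cong refl) (simp add: bb)
          then show ?thesis using that by simp
        qed
        have ac: "(u, y) \<bullet> c x \<alpha> = a \<alpha>" if "\<alpha> \<le> m" for \<alpha>
          using yw ub[of \<alpha>] that by (simp add: c_def inner_prod_def)
        have \<rho>: "(u, y) \<bullet> rv x = s"
        proof -
          have "(u, y) \<bullet> rv x = (\<Sum>\<alpha>\<le>m. coeff x \<alpha> * a \<alpha>)"
            by (simp add: rv_def inner_sum_right ac)
          also have "\<dots> = (\<Sum>\<alpha>\<le>m. h \<alpha> * coeff x \<alpha>) + s * (\<Sum>\<alpha>\<le>m. (coeff x \<alpha>)\<^sup>2)"
            unfolding sum_distrib_left sum.distrib[symmetric]
            by (rule sum.cong[OF refl]) (simp add: a_def power2_eq_square algebra_simps)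
          finally show ?thesis using hz(1) coeff_sum_sq_focal_minus[OF x] by simp
        qed
        have "Y x (u, y) = y - a 0 *\<^sub>R ((1 / \<kappa>) *\<^sub>R w x) - a 1 *\<^sub>R ((1 / \<kappa>) *\<^sub>R J (w x)) + s *\<^sub>R J (w x)"
          unfolding Y_def \<rho> \<kappa>_def ac[OF le0] ac[OF m2(2)] by simp
        also have "\<dots> = y0 + (- r) *\<^sub>R w x" by (simp add: y_def y1_def)
        finally have Yeq: "Y x (u, y) = y0 + (- r) *\<^sub>R w x" .
        have "op (\<lambda>\<alpha>. (u, y) \<bullet> c x \<alpha> - ((u, y) \<bullet> rv x) * coeff x \<alpha>) x = op h x"
          by (rule op_cong) (simp add: ac \<rho> a_def)
        then have Tv: "?T x (u, y) = v"
          unfolding hop[OF x] Yeq using perp_eq[OF x, of y0 "- r"] y0(2) hz(3,4) by simp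
        have mem: "(u, y) \<in> S \<times> W"
        proof (rule SigmaI)
          show "u \<in> S" unfolding u_def S_def by (intro span_sum span_scale span_base) auto
          show "y \<in> W" unfolding y_def y1_def using W y0(1) wW Jw(1)
            by (intro subspace_add subspace_diff subspace_scale)
        qed
        show "v \<in> ?T x ` (S \<times> W)" using imageI[OF mem, of "?T x"] unfolding Tv .
      qed
    qed
  qed
qed

text \<open>For a unit vector \<open>e\<close> this is the image of the Clifford sphere under
  evaluation at \<open>e\<close>. Since the \<open>p \<alpha> e\<close> are orthonormal, it is the
  unit sphere of a subspace, the kind of base that \<open>gl_equivalent_frame_const\<close>
  requires.\<close>

definition csphere :: "real^'n \<Rightarrow> (real^'n) set"
  where "csphere e = sphere 0 1 \<inter> range (\<lambda>y. op (\<lambda>\<alpha>. y \<bullet> p \<alpha> e) e)"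

lemma csphere_linear: "linear (\<lambda>y. op (\<lambda>\<alpha>. y \<bullet> p \<alpha> e) e)"
  by (rule op_coeff_family) (simp_all add: inner_add_left)

lemma csphere_iff:
  assumes "e \<bullet> e = 1"
  shows "y \<in> csphere e \<longleftrightarrow> (\<exists>a. (\<Sum>\<alpha>\<le>m. (a \<alpha>)\<^sup>2) = 1 \<and> y = op a e)"
proof -
  have nrm: "norm (op a e) = 1 \<longleftrightarrow> (\<Sum>\<alpha>\<le>m. (a \<alpha>)\<^sup>2) = 1" for a
    using op_inner_op[of a e a] assms by (simp add: norm_eq_1 power2_eq_square)
  have "op a e = op (\<lambda>\<alpha>. op a e \<bullet> p \<alpha> e) e" for a
    by (rule op_cong) (simp add: op_inner_p assms)
  then have "op a e \<in> range (\<lambda>y. op (\<lambda>\<alpha>. y \<bullet> p \<alpha> e) e)" for a by (rule range_eqI)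
  then show ?thesis unfolding csphere_def using nrm by auto
qed

lemma Clifford_sphere_compact: "compact (Clifford_sphere m P)"
proof -
  obtain e where e: "e \<in> Eplus" "e \<bullet> e = 1" by (rule Eplus_unit)
  have "subspace (range (\<lambda>y. op (\<lambda>\<alpha>. y \<bullet> p \<alpha> e) e))"
    by (intro linear_subspace_image subspace_UNIV csphere_linear)
  then have "compact (csphere e)" unfolding csphere_def by (intro compact_Int_closed closed_subspace compact_sphere)
  then have "compact ((\<lambda>y. \<Sum>\<alpha>\<le>m. (y \<bullet> p \<alpha> e) *\<^sub>R P \<alpha>) ` csphere e)"
    by (intro compact_continuous_image continuous_intros)
  moreover have eq: "(\<Sum>\<alpha>\<le>m. (op a e \<bullet> p \<alpha> e) *\<^sub>R P \<alpha>) = (\<Sum>\<alpha>\<le>m. a \<alpha> *\<^sub>R P \<alpha>)" for a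
    by (rule sum.cong[OF refl]) (simp add: op_inner_p e)
  have "(\<lambda>y. \<Sum>\<alpha>\<le>m. (y \<bullet> p \<alpha> e) *\<^sub>R P \<alpha>) ` csphere e = Clifford_sphere m P"
  proof (intro subset_antisym subsetI)
    fix Q assume "Q \<in> (\<lambda>y. \<Sum>\<alpha>\<le>m. (y \<bullet> p \<alpha> e) *\<^sub>R P \<alpha>) ` csphere e"
    then obtain y where y: "y \<in> csphere e" "Q = (\<Sum>\<alpha>\<le>m. (y \<bullet> p \<alpha> e) *\<^sub>R P \<alpha>)" by (rule imageE)
    obtain a where a: "(\<Sum>\<alpha>\<le>m. (a \<alpha>)\<^sup>2) = 1" "y = op a e"
      using y(1) unfolding csphere_iff[OF e(2)] by blast
    have "Q = (\<Sum>\<alpha>\<le>m. a \<alpha> *\<^sub>R P \<alpha>)" unfolding y(2) a(2) by (rule eq)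
    then show "Q \<in> Clifford_sphere m P" unfolding Clifford_sphere_iff using a(1) by (intro exI[of _ a] conjI)
  next
    fix Q assume "Q \<in> Clifford_sphere m P"
    then obtain a where a: "Q = (\<Sum>\<alpha>\<le>m. a \<alpha> *\<^sub>R P \<alpha>)" "(\<Sum>\<alpha>\<le>m. (a \<alpha>)\<^sup>2) = 1"
      unfolding Clifford_sphere_iff by blast
    then have "op a e \<in> csphere e" using csphere_iff[OF e(2)] by blast
    then show "Q \<in> (\<lambda>y. \<Sum>\<alpha>\<le>m. (y \<bullet> p \<alpha> e) *\<^sub>R P \<alpha>) ` csphere e"
      by (rule image_eqI[rotated]) (simp only: eq a(1))
  qed
  ultimately show ?thesis by simp
qed

text \<open>The map \<open>q\<close> sends \<open>x\<close> to the element fixing it. Along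
  \<open>q\<close> the bundle \<open>xi\<close> pulls back to \<open>eig\<close>, of which
  \<open>x\<close> itself is a section with coordinate \<open>k (q x) x\<close>.\<close>

lemma xi_trivial_imp_parallelizable:
  assumes "trivial_bundle (Clifford_sphere m P) xi_fibre"
  shows "parallelizable (focal_minus m P)"
proof -
  let ?M = "focal_minus m P" and ?S = "Clifford_sphere m P"
  define q where "q = (\<lambda>x. \<Sum>\<alpha>\<le>m. coeff x \<alpha> *\<^sub>R P \<alpha>)"
  have q: "q x \<in> ?S" "xi_fibre (q x) = eig x" if "x \<in> ?M" for x
    using xi_fibre_focal_minus[OF that] by (simp_all add: q_def)
  have cq: "continuous_on ?M q" unfolding q_def by (intro continuous_intros)
  have "trivialized ?M (tangent_space ?M)"
    using assms
  proof (rule trivial_bundleE)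
    fix W :: "(real^'n) set" and A k
    assume W: "subspace W" and A: "linear_family ?S A"
      and inj: "\<And>x. x \<in> ?S \<Longrightarrow> inj_on (A x) W" and im: "\<And>x. x \<in> ?S \<Longrightarrow> A x ` W = xi_fibre x"
      and ck: "continuous_on (Sigma ?S xi_fibre) (\<lambda>z. k (fst z) (snd z))"
      and k: "\<And>x y. x \<in> ?S \<Longrightarrow> y \<in> xi_fibre x \<Longrightarrow> k x y \<in> W"
        "\<And>x y. x \<in> ?S \<Longrightarrow> y \<in> xi_fibre x \<Longrightarrow> A x (k x y) = y"
    show ?thesis
    proof (rule tangent_focal_minus_trivialized[OF W, of "\<lambda>x. A (q x)" "\<lambda>x. k (q x) x"])
      show "linear_family ?M (\<lambda>x. A (q x))"
        by (rule linear_family_pullback[OF A cq]) (use q in auto)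
      have "continuous_on ?M (\<lambda>x. k (fst (q x, x)) (snd (q x, x)))"
        by (rule continuous_on_compose2[OF ck]) (use q focal_minus_simps(4) in \<open>auto intro!: continuous_intros cq\<close>)
      then show "continuous_on ?M (\<lambda>x. k (q x) x)" by simp
      fix x assume x: "x \<in> ?M"
      have xq: "x \<in> xi_fibre (q x)" using q(2)[OF x] focal_minus_simps(4)[OF x] by simp
      show "inj_on (A (q x)) W" by (rule inj[OF q(1)[OF x]])
      show "A (q x) ` W = eig x" using im[OF q(1)[OF x]] q(2)[OF x] by simp
      show "k (q x) x \<in> W" "A (q x) (k (q x) x) = x" by (rule k[OF q(1)[OF x] xq])+
    qed
  qed
  then show ?thesis
    unfolding parallelizable_def by (rule trivialized_imp_trivial_bundle[OF level_compact])
qed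

text \<open>As \<open>m < l\<close>, some unit vector of \<open>Eminus\<close> is orthogonal to all
  \<open>p \<alpha> u\<close>; its normalized sum with \<open>u\<close> has vanishing
  coefficients.\<close>

lemma focal_plus_nonempty: "\<exists>y. y \<in> focal_plus m P"
proof -
  obtain u where u: "u \<in> Eplus" "u \<bullet> u = 1" by (rule Eplus_unit)
  let ?A = "span ((\<lambda>\<alpha>. p \<alpha> u) ` {1..m})"
  have pE: "p \<alpha> u \<in> Eminus" if "\<alpha> \<in> {1..m}" for \<alpha> using that p_Eplus[OF _ _ u(1), of \<alpha>] by auto
  then have "?A \<subseteq> Eminus" by (intro span_minimal subspace_Eminus) auto
  then have "dim {y \<in> Eminus. \<forall>x\<in>?A. orthogonal x y} + dim ?A = dim Eminus"
    using dim_subspace_orthogonal_to_vectors subspace_span subspace_Eminus by blast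
  moreover have "dim ?A \<le> m"
  proof -
    have "dim ?A \<le> card ((\<lambda>\<alpha>. p \<alpha> u) ` {1..m})" by (simp add: dim_le_card')
    also have "\<dots> \<le> m" using card_image_le[of "{1..m}" "\<lambda>\<alpha>. p \<alpha> u"] by simp
    finally show ?thesis .
  qed
  ultimately have "1 \<le> dim {y \<in> Eminus. \<forall>x\<in>?A. orthogonal x y}" using l_gt dim_Eminus by simp
  moreover have "subspace {y \<in> Eminus. \<forall>x\<in>?A. orthogonal x y}"
    using subspace_Eminus by (auto simp: subspace_def orthogonal_def inner_add_right)
  ultimately obtain w where w: "w \<in> Eminus" "\<forall>x\<in>?A. orthogonal x w" "w \<bullet> w = 1"
  proof (elim orthonormal_in_subspace)
    fix T assume T: "T \<subseteq> {y \<in> Eminus. \<forall>x\<in>?A. orthogonal x y}" "card T = 1" "\<And>a. a \<in> T \<Longrightarrow> a \<bullet> a = 1"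
    obtain a where "T = {a}" using T(2) card_1_singletonE by blast
    then show thesis using T(1) T(3)[of a] by (intro that[of a]) auto
  qed
  let ?y = "(1 / sqrt 2) *\<^sub>R (u + w)"
  have uw: "u \<bullet> w = 0" "w \<bullet> u = 0" using Eplus_Eminus_orth u(1) w(1) by auto
  have "?y \<bullet> ?y = 1" using u w uw by (simp add: inner_add_left inner_add_right)
  then have n: "norm ?y = 1" unfolding norm_eq_1 .
  have c: "coeff ?y \<alpha> = 0" if "\<alpha> \<le> m" for \<alpha>
  proof (cases "\<alpha> = 0")
    case True
    have "p 0 u = u" "p 0 w = - w" using u w by (auto simp: Eplus_def Eminus_def)
    then show ?thesis using u w uw True
      by (simp add: coeff_def p_simps inner_add_left inner_add_right inner_diff_left add_divide_distrib[symmetric])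
  next
    case False
    then have a: "0 < \<alpha>" "\<alpha> \<in> {1..m}" using that by auto
    have "p \<alpha> u \<bullet> w = 0" using w(2) a(2) by (auto simp: orthogonal_def span_base)
    moreover have "p \<alpha> w \<bullet> u = p \<alpha> u \<bullet> w" using p_sym[OF that] by (simp add: inner_commute)
    moreover have "p \<alpha> u \<bullet> u = 0" "p \<alpha> w \<bullet> w = 0"
      using pE[OF a(2)] p_Eminus[OF a(1) that w(1)] Eplus_Eminus_orth u(1) w(1) by auto
    ultimately show ?thesis by (simp add: coeff_def p_simps inner_add_left inner_add_right)
  qed
  have "?y \<in> focal_plus m P"
    unfolding focal_plus_iff by (intro conjI allI impI n c)
  then show ?thesis by (rule exI)
qed

text \<open>
  The vectors \<open>f \<alpha> x\<close> represent the coordinates on the summand \<open>TS\<^sup>m \<oplus> \<real>\<close> of the trivialized bundle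
  \<open>TM\<^sub>- \<oplus> \<real> \<oplus> \<real>\<close>, so that their common kernel is the summand \<open>\<xi>\<close>. The constant vectors \<open>g j\<close> cut the model
  fibre \<open>W \<times> \<real>\<close> out of the ambient space.
\<close>
lemma s_parallelizable_imp_xi_trivialized:
  assumes "trivialized (focal_minus m P) (whitney_sum (tangent_space (focal_minus m P)) (\<lambda>_. UNIV :: real set))"
  shows "trivialized (Clifford_sphere m P) xi_fibre"
proof -
  let ?M = "focal_minus m P"
  obtain W :: "((real^'n) \<times> real) set" and A where W: "subspace W" and A: "linear_family ?M A"
    and Ainj: "\<And>x. x \<in> ?M \<Longrightarrow> inj_on (A x) W"
    and Aim: "\<And>x. x \<in> ?M \<Longrightarrow> A x ` W = tangent_space ?M x \<times> (UNIV :: real set)"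
    using assms unfolding trivialized_def whitney_sum_def by blast
  have Alin: "linear (A x)" if "x \<in> ?M" for x using linear_family_linear[OF A that] .
  have AE: "\<exists>w\<in>W. A x w = (a, \<rho>)" if x: "x \<in> ?M" and a: "a \<in> tangent_space ?M x" for x a \<rho>
  proof -
    have "(a, \<rho>) \<in> A x ` W" unfolding Aim[OF x] using a by simp
    then show ?thesis by force
  qed
  have AT: "fst (A x w) \<in> tangent_space ?M x" if x: "x \<in> ?M" and w: "w \<in> W" for x w
    using imageI[OF w, of "A x"] unfolding Aim[OF x] by (simp add: mem_Times_iff)
  \<comment> \<open>The difference kills the vertical part and doubles the horizontal one, so the
    value is \<open>2 * h \<alpha>\<close>.\<close>
  define \<phi> where "\<phi> = (\<lambda>x \<alpha> w. (fst (A x w) - op (coeff x) (fst (A x w))) \<bullet> p \<alpha> x)"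
  \<comment> \<open>Represents the functional \<open>\<phi> x \<alpha>\<close> extended to the
    second trivial line, which supplies the radial direction \<open>coeff x\<close> missing from the
    tangent space of the sphere.\<close>
  define f where "f = (\<lambda>\<alpha> x. (\<Sum>b\<in>Basis. \<phi> x \<alpha> b *\<^sub>R b, coeff x \<alpha>))"
  have \<phi>lin: "linear (\<phi> x \<alpha>)" if "x \<in> ?M" for x \<alpha>
    unfolding \<phi>_def using Alin[OF that]
    by (intro linearI) (simp_all add: linear_add linear_scale linear_add[OF op_linear] linear_scale[OF op_linear]
        inner_add_left inner_diff_left right_diff_distrib)
  have ip: "z \<bullet> f \<alpha> x = \<phi> x \<alpha> (fst z) + snd z * coeff x \<alpha>" if x: "x \<in> ?M" for z \<alpha> x
  proof -
    have "\<phi> x \<alpha> (fst z) = \<phi> x \<alpha> (\<Sum>b\<in>Basis. (fst z \<bullet> b) *\<^sub>R b)" by (simp only: euclidean_representation)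
    also have "\<dots> = (\<Sum>b\<in>Basis. (fst z \<bullet> b) * \<phi> x \<alpha> b)"
      by (simp add: linear_sum[OF \<phi>lin[OF x]] linear_scale[OF \<phi>lin[OF x]])
    finally show ?thesis by (cases z) (simp add: f_def inner_Pair inner_sum_right mult.commute)
  qed
  have cA: "continuous_on ?M (\<lambda>x. A x b)" for b
    using A unfolding linear_family_def by blast
  have cop: "continuous_on ?M (\<lambda>x. op (coeff x) (h x))" if "continuous_on ?M h" for h
    unfolding op_def using that by (intro continuous_intros)
  have cf: "continuous_on ?M (f \<alpha>)" for \<alpha>
    unfolding f_def \<phi>_def by (intro continuous_intros cA cop)
  define N where "N = orthogonal_comp W \<times> {0 :: real}"
  have N: "subspace N" unfolding N_def by (intro subspace_Times subspace_orthogonal_comp) (simp add: subspace_def)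
  define D where "D = dim N"
  have "\<exists>g :: nat \<Rightarrow> ((real^'n) \<times> real) \<times> real. (\<forall>i<D. g i \<notin> span (g ` {..<i})) \<and> span (g ` {..<D}) = N"
  proof (rule independent_family_of_basis[OF N])
    fix b :: "nat \<Rightarrow> ((real^'n) \<times> real) \<times> real"
    assume "\<And>i. i < dim N \<Longrightarrow> b i \<notin> span (b ` {..<i})" "span (b ` {..<dim N}) = N"
    then show ?thesis unfolding D_def by (intro exI[of _ b] conjI) auto
  qed
  then obtain g :: "nat \<Rightarrow> ((real^'n) \<times> real) \<times> real" where
    g: "\<And>i. i < D \<Longrightarrow> g i \<notin> span (g ` {..<i})" "span (g ` {..<D}) = N" by blast
  have gN: "g j \<in> N" if "j < D" for j using that unfolding g(2)[symmetric] by (intro span_base) auto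
  have gW: "z \<bullet> g j = 0" if "fst z \<in> W" "j < D" for z j
  proof -
    have "fst (g j) \<in> orthogonal_comp W" "snd (g j) = 0" using gN[OF that(2)] by (auto simp: N_def)
    then show ?thesis using that(1) by (simp add: inner_prod_def orthogonal_comp_def orthogonal_def)
  qed
  define fr where "fr = (\<lambda>j x. if j < D then g j else f (j - D) x)"
  define k where "k = D + (m + 1)"
  have cfr: "continuous_on ?M (fr j)" for j
    unfolding fr_def by (cases "j < D") (simp_all add: cf)
  have dual: "\<exists>z. fst z \<in> W \<and> (\<forall>\<beta>\<le>m. z \<bullet> f \<beta> x = (if \<beta> = \<alpha> then 1 else 0))" if x: "x \<in> ?M" and \<alpha>: "\<alpha> \<le> m" for x \<alpha>
  proof -
    note xs = focal_minus_simps[OF x]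
    \<comment> \<open>The tangential part of the unit vector of index \<open>\<alpha>\<close>, whose
      radial part \<open>coeff x \<alpha>\<close> goes to the second line. The factor 1/2 below
      offsets the 2 in \<open>\<phi>\<close>.\<close>
    define h where "h = (\<lambda>\<beta>. (if \<beta> = \<alpha> then 1 else 0) - coeff x \<alpha> * coeff x \<beta>)"
    have "(\<Sum>\<beta>\<le>m. h \<beta> * coeff x \<beta>) = (\<Sum>\<beta>\<le>m. if \<beta> = \<alpha> then coeff x \<alpha> else 0) - coeff x \<alpha> * (\<Sum>\<beta>\<le>m. (coeff x \<beta>)\<^sup>2)"
      unfolding sum_distrib_left sum_subtractf[symmetric]
      by (rule sum.cong[OF refl]) (simp add: h_def power2_eq_square left_diff_distrib)
    then have h0: "(\<Sum>\<beta>\<le>m. h \<beta> * coeff x \<beta>) = 0"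
      using \<alpha> coeff_sum_sq_focal_minus[OF x] by simp
    then have h0': "(\<Sum>\<beta>\<le>m. ((1/2) * h \<beta>) * coeff x \<beta>) = 0" by (simp add: sum_divide_distrib[symmetric])
    have "op (\<lambda>\<beta>. (1/2) * h \<beta>) x + 0 \<in> tangent_space ?M x"
      by (rule tangent_focal_minusI[OF x h0']) (simp_all add: subspace_0[OF subspace_eig])
    then have "(1/2) *\<^sub>R op h x \<in> tangent_space ?M x" unfolding op_scale_coeff by simp
    then obtain w where w: "w \<in> W" "A x w = ((1/2) *\<^sub>R op h x, 0)" using AE[OF x] by blast
    have "op (coeff x) ((1/2) *\<^sub>R op h x) = - ((1/2) *\<^sub>R op h x)"
      using op_minus[OF x h0] by (simp add: linear_scale[OF op_linear])
    then have "fst (A x w) - op (coeff x) (fst (A x w)) = op h x"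
      using w(2) by (simp add: scaleR_2[symmetric] flip: scaleR_add_left)
    then have "\<phi> x \<beta> w = h \<beta>" if "\<beta> \<le> m" for \<beta>
      using op_inner_p[OF that, of h x] xs(1) by (simp add: \<phi>_def)
    then have "(w, coeff x \<alpha>) \<bullet> f \<beta> x = (if \<beta> = \<alpha> then 1 else 0)" if "\<beta> \<le> m" for \<beta>
      using that by (simp add: ip[OF x] h_def)
    then show ?thesis using w(1) by (intro exI[of _ "(w, coeff x \<alpha>)"]) simp
  qed
  have ind: "fr i x \<notin> span ((\<lambda>j. fr j x) ` {..<i})" if x: "x \<in> ?M" and i: "i < k" for x i
  proof (cases "i < D")
    case True
    then have "(\<lambda>j. fr j x) ` {..<i} = g ` {..<i}" by (intro image_cong) (auto simp: fr_def)
    then show ?thesis using True g(1) by (simp add: fr_def)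
  next
    case False
    then have im: "i - D \<le> m" using i by (simp add: k_def)
    obtain z where z: "fst z \<in> W" "\<And>\<beta>. \<beta> \<le> m \<Longrightarrow> z \<bullet> f \<beta> x = (if \<beta> = i - D then 1 else 0)"
      using dual[OF x im] by blast
    show ?thesis
    proof (rule notin_span_test[of z])
      show "z \<bullet> fr i x \<noteq> 0" using z(2)[OF im] False by (simp add: fr_def)
      fix b assume "b \<in> (\<lambda>j. fr j x) ` {..<i}"
      then obtain j where j: "j < i" "b = fr j x" by auto
      show "z \<bullet> b = 0"
      proof (cases "j < D")
        case True
        then show ?thesis using gW[OF z(1) True] by (simp add: j(2) fr_def)
      next
        case False
        then have "j - D \<le> m" "j - D \<noteq> i - D" using j(1) im by auto
        then show ?thesis using z(2)[of "j - D"] False by (simp add: j(2) fr_def)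
      qed
    qed
  qed
  define Z where "Z = (\<lambda>x. orthogonal_comp (span ((\<lambda>j. fr j x) ` {..<k})))"
  have Z_iff: "z \<in> Z x \<longleftrightarrow> fst z \<in> W \<and> (\<forall>\<alpha>\<le>m. z \<bullet> f \<alpha> x = 0)" for z x
  proof -
    have "fst z \<in> W" if "\<forall>j<D. z \<bullet> g j = 0"
    proof -
      have "z \<in> orthogonal_comp (span (g ` {..<D}))" using that by (auto simp: orthogonal_comp_span)
      then have zN: "z \<in> orthogonal_comp N" unfolding g(2) .
      have "fst z \<bullet> y = 0" if "y \<in> orthogonal_comp W" for y
      proof -
        have "(y, 0) \<in> N" using that by (simp add: N_def)
        then have "(y, 0) \<bullet> z = 0" using zN unfolding orthogonal_comp_def orthogonal_def by blast
        then show ?thesis by (cases z) (simp add: inner_Pair inner_commute)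
      qed
      then have "fst z \<in> orthogonal_comp (orthogonal_comp W)"
        by (simp add: orthogonal_comp_def[of "orthogonal_comp W"] orthogonal_def inner_commute)
      then show ?thesis using orthogonal_comp_self[OF W] by simp
    qed
    then have gz: "(\<forall>j<D. z \<bullet> g j = 0) \<longleftrightarrow> fst z \<in> W" using gW by blast
    have "z \<in> Z x \<longleftrightarrow> (\<forall>j<k. z \<bullet> fr j x = 0)" by (auto simp: Z_def orthogonal_comp_span)
    also have "\<dots> \<longleftrightarrow> (\<forall>j<D. z \<bullet> g j = 0) \<and> (\<forall>\<alpha>\<le>m. z \<bullet> f \<alpha> x = 0)"
    proof (intro iffI conjI allI impI)
      fix j assume a: "\<forall>j<k. z \<bullet> fr j x = 0" "j < D"
      then show "z \<bullet> g j = 0" using a(1)[rule_format, of j] by (simp add: fr_def k_def)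
    next
      fix \<alpha> assume a: "\<forall>j<k. z \<bullet> fr j x = 0" "\<alpha> \<le> m"
      then show "z \<bullet> f \<alpha> x = 0" using a(1)[rule_format, of "D + \<alpha>"] by (simp add: fr_def k_def)
    next
      fix j assume a: "(\<forall>j<D. z \<bullet> g j = 0) \<and> (\<forall>\<alpha>\<le>m. z \<bullet> f \<alpha> x = 0)" "j < k"
      then have "\<not> j < D \<Longrightarrow> j - D \<le> m" by (simp add: k_def)
      then show "z \<bullet> fr j x = 0" using a by (simp add: fr_def)
    qed
    finally show ?thesis unfolding gz .
  qed
  have subZ: "subspace (Z x)" for x unfolding Z_def by (rule subspace_orthogonal_comp)
  \<comment> \<open>On the common kernel no horizontal part is left. The vertical part, together
    with the first trivial line placed along \<open>x\<close>, makes up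
    \<open>eig x\<close>.\<close>
  define \<psi> where "\<psi> = (\<lambda>x (z :: ((real^'n) \<times> real) \<times> real). (1/2) *\<^sub>R (fst (A x (fst z)) + op (coeff x) (fst (A x (fst z)))) + snd (A x (fst z)) *\<^sub>R x)"
  have \<psi>fam: "linear_family ?M \<psi>"
  proof (rule linear_familyI)
    show "linear (\<psi> x)" if "x \<in> ?M" for x
      unfolding \<psi>_def using Alin[OF that]
      by (intro linearI) (simp_all add: linear_add linear_scale linear_add[OF op_linear] linear_scale[OF op_linear]
          scaleR_add_left scaleR_add_right)
    show "continuous_on ?M (\<lambda>x. \<psi> x z)" for z
      unfolding \<psi>_def by (intro continuous_intros cA cop)
  qed
  have \<psi>_eq: "\<psi> x z = t + \<rho> *\<^sub>R x" "\<And>\<alpha>. \<alpha> \<le> m \<Longrightarrow> z \<bullet> f \<alpha> x = 2 * h \<alpha> + snd z * coeff x \<alpha>"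
    if x: "x \<in> ?M" and h: "(\<Sum>\<alpha>\<le>m. h \<alpha> * coeff x \<alpha>) = 0" and t: "t \<in> eig x" and z: "A x (fst z) = (op h x + t, \<rho>)"
    for x h t z \<rho>
  proof -
    have Q: "op (coeff x) (op h x + t) = - op h x + t"
      using op_minus[OF x h] t by (simp add: linear_add[OF op_linear] eig_def)
    show "\<psi> x z = t + \<rho> *\<^sub>R x"
      unfolding \<psi>_def z fst_conv snd_conv Q by (simp add: scaleR_2[symmetric])
    fix \<alpha> assume \<alpha>: "\<alpha> \<le> m"
    have "\<phi> x \<alpha> (fst z) = (2 *\<^sub>R op h x) \<bullet> p \<alpha> x"
      unfolding \<phi>_def z fst_conv snd_conv Q by (simp add: scaleR_2)
    then show "z \<bullet> f \<alpha> x = 2 * h \<alpha> + snd z * coeff x \<alpha>"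
      using op_inner_p[OF \<alpha>, of h x] focal_minus_simps(1)[OF x] by (simp add: ip[OF x])
  qed
  have \<psi>inj: "inj_on (\<psi> x) (Z x)" and \<psi>im: "\<psi> x ` Z x = eig x" if x: "x \<in> ?M" for x
  proof -
    note xs = focal_minus_simps[OF x]
    have dec: "\<exists>h t \<rho>. (\<Sum>\<alpha>\<le>m. h \<alpha> * coeff x \<alpha>) = 0 \<and> t \<in> eig x \<and> t \<bullet> x = 0 \<and> A x (fst z) = (op h x + t, \<rho>)"
      if "z \<in> Z x" for z
    proof -
      have "fst z \<in> W" using that Z_iff by blast
      from tangent_focal_minusE[OF x AT[OF x this]] show ?thesis by (metis prod.collapse)
    qed
    show "inj_on (\<psi> x) (Z x)"
      unfolding linear_inj_on_iff_eq_0[OF linear_family_linear[OF \<psi>fam x] subZ]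
    proof (intro ballI impI)
      fix z assume z: "z \<in> Z x" "\<psi> x z = 0"
      obtain h t \<rho> where ht: "(\<Sum>\<alpha>\<le>m. h \<alpha> * coeff x \<alpha>) = 0" "t \<in> eig x" "t \<bullet> x = 0" "A x (fst z) = (op h x + t, \<rho>)"
        using dec[OF z(1)] by blast
      note e = \<psi>_eq[OF x ht(1,2,4)]
      have "(t + \<rho> *\<^sub>R x) \<bullet> x = \<rho>" using ht(3) xs(1) by (simp add: inner_add_left)
      then have \<rho>: "\<rho> = 0" using e(1) z(2) by simp
      then have t: "t = 0" using e(1) z(2) by simp
      have hz: "2 * h \<alpha> + snd z * coeff x \<alpha> = 0" if "\<alpha> \<le> m" for \<alpha>
        using e(2)[OF that] z(1) that unfolding Z_iff by simp
      have "(\<Sum>\<alpha>\<le>m. (2 * h \<alpha> + snd z * coeff x \<alpha>) * coeff x \<alpha>) = 2 * (\<Sum>\<alpha>\<le>m. h \<alpha> * coeff x \<alpha>) + snd z * (\<Sum>\<alpha>\<le>m. (coeff x \<alpha>)\<^sup>2)"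
        unfolding sum_distrib_left sum.distrib[symmetric]
        by (rule sum.cong[OF refl]) (simp add: power2_eq_square algebra_simps)
      then have r: "snd z = 0" using hz ht(1) coeff_sum_sq_focal_minus[OF x] by simp
      then have "op h x = op (\<lambda>_. 0) x" using hz by (intro op_cong) auto
      then have "A x (fst z) = 0" using ht(4) t \<rho> by (simp add: op_def zero_prod_def)
      then have "A x (fst z) = A x 0" using linear_0[OF Alin[OF x]] by simp
      then have "fst z = 0" using Ainj[OF x] z(1) W subspace_0 unfolding Z_iff by (meson inj_onD)
      then show "z = 0" using r by (simp add: prod_eq_iff)
    qed
    show "\<psi> x ` Z x = eig x"
    proof (intro subset_antisym subsetI)
      fix v assume "v \<in> \<psi> x ` Z x"
      then obtain z where z: "z \<in> Z x" "v = \<psi> x z" by blast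
      obtain h t \<rho> where ht: "(\<Sum>\<alpha>\<le>m. h \<alpha> * coeff x \<alpha>) = 0" "t \<in> eig x" "t \<bullet> x = 0" "A x (fst z) = (op h x + t, \<rho>)"
        using dec[OF z(1)] by blast
      show "v \<in> eig x"
        unfolding z(2) \<psi>_eq(1)[OF x ht(1,2,4)]
        by (intro subspace_add[OF subspace_eig] subspace_scale[OF subspace_eig] ht(2) xs(4))
    next
      fix v assume v: "v \<in> eig x"
      define t where "t = v - (v \<bullet> x) *\<^sub>R x"
      have t: "t \<in> eig x" "t \<bullet> x = 0"
        using v xs subspace_eig[of x] by (auto simp: t_def inner_diff_left intro!: subspace_diff subspace_scale)
      have h0: "(\<Sum>\<alpha>\<le>m. (0::real) * coeff x \<alpha>) = 0" by simp
      obtain w where w: "w \<in> W" "A x w = (op (\<lambda>_. 0) x + t, v \<bullet> x)"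
        using AE[OF x tangent_focal_minusI[OF x h0 t]] by blast
      have wz: "A x (fst (w, 0::real)) = (op (\<lambda>_. 0) x + t, v \<bullet> x)" using w(2) by simp
      note e = \<psi>_eq[OF x h0 t(1) wz]
      have "(w, 0) \<in> Z x" unfolding Z_iff using w(1) e(2) by simp
      moreover have "\<psi> x (w, 0) = v" using e(1) by (simp add: t_def)
      ultimately show "v \<in> \<psi> x ` Z x" by force
    qed
  qed
  obtain e where e: "e \<in> Eplus" "e \<bullet> e = 1" by (rule Eplus_unit)
  note eM = Eplus_focal_minus[OF e]
  \<comment> \<open>Rank count at one point: the ambient space has dimension
    \<open>2 * l + 2\<close>, and \<open>\<psi> e\<close> identifies the complement of the frame
    with a space of dimension \<open>l\<close>.\<close>
  have k: "k = l + 2"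
  proof -
    have "dim (Z e) = dim (\<psi> e ` Z e)"
      using dim_image_eq[OF linear_family_linear[OF \<psi>fam eM(1)], of "Z e"] \<psi>inj[OF eM(1)] subZ
      by (metis span_eq_iff)
    then have "dim (Z e) = l" using \<psi>im[OF eM(1)] eM(2) dim_Eplus by simp
    moreover have "dim (span ((\<lambda>j. fr j e) ` {..<k})) = k"
      by (rule dim_span_frame) (rule ind[OF eM(1)])
    moreover have "dim {y \<in> UNIV. \<forall>x\<in>span ((\<lambda>j. fr j e) ` {..<k}). orthogonal x y} +
        dim (span ((\<lambda>j. fr j e) ` {..<k})) = dim (UNIV :: (((real^'n) \<times> real) \<times> real) set)"
      by (intro dim_subspace_orthogonal_to_vectors subspace_span subspace_UNIV subset_UNIV)
    ultimately show ?thesis using card by (simp add: Z_def orthogonal_comp_def)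
  qed
  let ?U = "range (\<lambda>y. op (\<lambda>\<alpha>. y \<bullet> p \<alpha> e) e)"
  have U: "subspace ?U" by (intro linear_subspace_image subspace_UNIV csphere_linear)
  have "dim ?U \<le> m + 1"
  proof -
    have "op c e \<in> span ((\<lambda>\<alpha>. p \<alpha> e) ` {..m})" for c
      unfolding op_def by (intro span_sum span_scale) (auto intro: span_base)
    then have "?U \<subseteq> span ((\<lambda>\<alpha>. p \<alpha> e) ` {..m})" by blast
    then have "dim ?U \<le> card ((\<lambda>\<alpha>. p \<alpha> e) ` {..m})" by (intro dim_le_card) auto
    also have "\<dots> \<le> m + 1" using card_image_le[of "{..m}" "\<lambda>\<alpha>. p \<alpha> e"] by simp
    finally show ?thesis .
  qed
  \<comment> \<open>With \<open>dim ?U \<le> m + 1\<close> this amounts to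
    \<open>m + 1 \<le> l\<close>, the stable range for rank \<open>l\<close> over the sphere of
    dimension \<open>m\<close>.\<close>
  then have dims: "dim ?U + k \<le> DIM(((real^'n) \<times> real) \<times> real)" using k l_gt card by simp
  obtain y0 where y0: "y0 \<in> focal_plus m P" using focal_plus_nonempty by blast
  \<comment> \<open>For \<open>y = Q e\<close> this is the normalized sum of \<open>y0\<close> and
    \<open>Q y0\<close>. They are orthonormal because \<open>y0\<close> lies in
    \<open>M\<^sub>+\<close>, and \<open>Q\<close> exchanges them, so the sum is fixed by
    \<open>Q\<close>.\<close>
  define \<sigma> where "\<sigma> = (\<lambda>y. (1 / sqrt 2) *\<^sub>R (y0 + op (\<lambda>\<alpha>. y \<bullet> p \<alpha> e) y0))"
  have \<sigma>a: "\<sigma> (op a e) \<in> ?M" "\<And>\<alpha>. \<alpha> \<le> m \<Longrightarrow> coeff (\<sigma> (op a e)) \<alpha> = a \<alpha>"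
    if a: "(\<Sum>\<alpha>\<le>m. (a \<alpha>)\<^sup>2) = 1" for a
  proof -
    have y01: "y0 \<bullet> y0 = 1" and y0c: "\<And>\<alpha>. \<alpha> \<le> m \<Longrightarrow> coeff y0 \<alpha> = 0"
      using y0 by (simp_all add: focal_plus_iff norm_eq_1)
    have "op (\<lambda>\<alpha>. op a e \<bullet> p \<alpha> e) y0 = op a y0"
      by (rule op_cong) (simp add: op_inner_p e)
    then have \<sigma>: "\<sigma> (op a e) = (1 / sqrt 2) *\<^sub>R (y0 + op a y0)" by (simp add: \<sigma>_def)
    have "op a y0 \<bullet> y0 = 0" "y0 \<bullet> op a y0 = 0" using y0c op_coeff_inner[of a y0] by (simp_all add: inner_commute)
    moreover have "op a y0 \<bullet> op a y0 = 1" using op_inner_op[of a y0 a] a y01 by (simp add: power2_eq_square)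
    ultimately have "\<sigma> (op a e) \<bullet> \<sigma> (op a e) = 1"
      using y01 unfolding \<sigma> by (simp add: inner_add_left inner_add_right)
    then have 1: "norm (\<sigma> (op a e)) = 1" by (simp add: norm_eq_1)
    have 2: "op a (\<sigma> (op a e)) = \<sigma> (op a e)"
      unfolding \<sigma> using a by (simp add: linear_add[OF op_linear] linear_scale[OF op_linear] op_sq add.commute)
    show "\<sigma> (op a e) \<in> ?M" by (rule focal_minusI[OF 1 2])
    show "coeff (\<sigma> (op a e)) \<alpha> = a \<alpha>" if "\<alpha> \<le> m" for \<alpha> by (rule coeff_eqI[OF 1 2 that])
  qed
  have \<sigma>M: "\<sigma> y \<in> ?M" if "y \<in> csphere e" for y using that \<sigma>a(1) csphere_iff[OF e(2)] by auto
  have c\<sigma>: "continuous_on X \<sigma>" for X unfolding \<sigma>_def op_def by (intro continuous_intros)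
  have "\<exists>C. subspace C \<and> dim C \<le> k \<and> gl_equivalent (sphere 0 1 \<inter> ?U)
      (\<lambda>y. span ((\<lambda>j. fr j (\<sigma> y)) ` {..<k})) (\<lambda>_. C)"
  proof (rule gl_equivalent_frame_const[OF U dims])
    show "continuous_on (sphere 0 1 \<inter> ?U) (\<lambda>y. fr j (\<sigma> y))" for j
      by (rule continuous_on_compose2[OF cfr c\<sigma>]) (use \<sigma>M in \<open>auto simp: csphere_def\<close>)
    show "fr j (\<sigma> y) \<notin> span ((\<lambda>i. fr i (\<sigma> y)) ` {..<j})" if "j < k" "y \<in> sphere 0 1 \<inter> ?U" for j y
      using ind[OF \<sigma>M that(1)] that(2) by (simp add: csphere_def)
  qed
  then obtain C where "gl_equivalent (csphere e) (\<lambda>y. span ((\<lambda>j. fr j (\<sigma> y)) ` {..<k})) (\<lambda>_. C)"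
    unfolding csphere_def by blast
  from orthogonal_comp_trivialized[OF this] have "trivialized (csphere e) (\<lambda>y. Z (\<sigma> y))" unfolding Z_def .
  then obtain W' :: "(((real^'n) \<times> real) \<times> real) set" and B where W': "subspace W'" and B: "linear_family (csphere e) B"
    and BZ: "\<And>y. y \<in> csphere e \<Longrightarrow> inj_on (B y) W'" "\<And>y. y \<in> csphere e \<Longrightarrow> B y ` W' = Z (\<sigma> y)"
    unfolding trivialized_def by blast
  have "trivialized (csphere e) (\<lambda>y. eig (\<sigma> y))"
  proof (rule trivializedI[OF W'])
    have "linear_family (csphere e) (\<lambda>y. \<psi> (\<sigma> y))"
      by (rule linear_family_pullback[OF \<psi>fam c\<sigma>]) (use \<sigma>M in auto)
    then show "linear_family (csphere e) (\<lambda>y v. \<psi> (\<sigma> y) (B y v))" by (rule linear_family_compose[OF B])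
    fix y assume y: "y \<in> csphere e"
    show "inj_on (\<lambda>v. \<psi> (\<sigma> y) (B y v)) W'"
      using comp_inj_on[OF BZ(1)[OF y], of "\<psi> (\<sigma> y)"] \<psi>inj[OF \<sigma>M[OF y]] BZ(2)[OF y] by (simp add: o_def)
    show "(\<lambda>v. \<psi> (\<sigma> y) (B y v)) ` W' = eig (\<sigma> y)"
      unfolding \<psi>im[OF \<sigma>M[OF y], symmetric] BZ(2)[OF y, symmetric] by (simp add: image_image)
  qed
  then have "trivialized (Clifford_sphere m P) (\<lambda>Q. eig (\<sigma> (Q *v e)))"
  proof (rule trivialized_pullback)
    show "continuous_on (Clifford_sphere m P) (\<lambda>Q. Q *v e)"
      by (rule linear_continuous_on)
         (auto simp: linear_conv_bounded_linear[symmetric] matrix_vector_mult_add_rdistrib scaleR_matrix_vector_assoc intro!: linearI)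
    have "Q *v e \<in> csphere e" if Q: "Q \<in> Clifford_sphere m P" for Q
    proof -
      obtain a where a: "Q = (\<Sum>\<alpha>\<le>m. a \<alpha> *\<^sub>R P \<alpha>)" "(\<Sum>\<alpha>\<le>m. (a \<alpha>)\<^sup>2) = 1"
        using Q unfolding Clifford_sphere_iff by blast
      show ?thesis
        unfolding csphere_iff[OF e(2)] a(1) matrix_sum_op using a(2) by (intro exI[of _ a] conjI refl)
    qed
    then show "(\<lambda>Q. Q *v e) \<in> Clifford_sphere m P \<rightarrow> csphere e" by blast
  qed
  moreover have "eig (\<sigma> (Q *v e)) = xi_fibre Q" if Q: "Q \<in> Clifford_sphere m P" for Q
  proof -
    obtain a where a: "Q = (\<Sum>\<alpha>\<le>m. a \<alpha> *\<^sub>R P \<alpha>)" "(\<Sum>\<alpha>\<le>m. (a \<alpha>)\<^sup>2) = 1"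
      using Q unfolding Clifford_sphere_iff by blast
    have "op (coeff (\<sigma> (op a e))) x = op a x" for x
      by (rule op_cong) (rule \<sigma>a(2)[OF a(2)])
    then show ?thesis by (simp add: a(1) matrix_sum_op xi_fibre_def eig_def)
  qed
  ultimately show ?thesis
    using trivialized_cong[of "Clifford_sphere m P" "\<lambda>Q. eig (\<sigma> (Q *v e))" xi_fibre] by simp
qed

end

theorem theorem2p6:
  fixes P :: "nat \<Rightarrow> real^'n^'n" and m l :: nat and t :: real
  assumes "CARD('n) = 2 * l"
    and "m > 0"
    and "l > m + 1"
    and "symmetric_Clifford_system m P"
    and "-1 < t" and "t < 1"
  shows "((parallelizable (focal_minus m P) \<longleftrightarrow> s_parallelizable (focal_minus m P)) \<and>
          (s_parallelizable (focal_minus m P) \<longleftrightarrow> trivial_bundle (Clifford_sphere m P) xi_fibre)) \<and>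
         parallelizable (focal_plus m P) \<and>
         parallelizable (OT_FKM_level m P t)"
proof -
  interpret clifford_system P m l by unfold_locales (fact assms)+
  let ?M = "focal_minus m P"
  have 1: "s_parallelizable ?M" if "parallelizable ?M"
    using that trivialized_whitney_sum_line
    unfolding parallelizable_def s_parallelizable_def trivial_bundle_iff_trivialized[OF level_compact] by blast
  have 2: "trivial_bundle (Clifford_sphere m P) xi_fibre" if "s_parallelizable ?M"
    using that s_parallelizable_imp_xi_trivialized
    unfolding s_parallelizable_def trivial_bundle_iff_trivialized[OF level_compact]
      trivial_bundle_iff_trivialized[OF Clifford_sphere_compact] by blast
  show ?thesis
    using 1 2 xi_trivial_imp_parallelizable parallelizable_focal_plus parallelizable_level[OF assms(5,6)] by blast
qed

end
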